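(* Let $T_1$ and $T_2$ be trees, $T_2$ having at least two vertices, with $6\le n=|V(T_1)|\ge |V(T_2)|$. Then $R(B^3T_1,B^3T_2)=n$.
   Context: A 3-uniform hypergraph consists of a vertex set and a set of 3-element subsets (hyperedges); $\mathcal{K}_N^3$ is the complete 3-uniform hypergraph on $N$ vertices. A 3-uniform hypergraph $\mathcal{H}$ contains a Berge-$F$ (for a graph $F$) if there are an injection $\varphi:V(F)\to V(\mathcal{H})$ and an injection $f$ from $E(F)$ to the hyperedges of $\mathcal{H}$ with $\{\varphi(x),\varphi(y)\}\subseteq f(xy)$ for every edge $xy$. $R(B^3T_1,B^3T_2)$ is the smallest $N$ such that for every coloring of the hyperedges of $\mathcal{K}_N^3$ with blue and red, the blue hyperedges contain a Berge-$T_1$ or the red hyperedges contain a Berge-$T_2$. *)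

theory Defs
  imports Main "HOL-Library.Ramsey"
begin

record 'a hypergraph =
  verts :: "'a set"
  edges :: "'a set set"

definition uniform :: "nat \<Rightarrow> 'a hypergraph \<Rightarrow> bool" where
  "uniform k H \<longleftrightarrow> edges H \<subseteq> nsets (verts H) k"

text \<open>A finite simple graph is a finite 2-uniform hypergraph. Loops are excluded
  since \<open>nsets V 2\<close> consists of two-element sets only.\<close>

definition simple_graph :: "'a hypergraph \<Rightarrow> bool" where
  "simple_graph G \<longleftrightarrow> finite (verts G) \<and> uniform 2 G"

definition is_walk :: "'a hypergraph \<Rightarrow> 'a list \<Rightarrow> bool" where
  "is_walk G p \<longleftrightarrow> p \<noteq> [] \<and> set p \<subseteq> verts G \<and>
     (\<forall>i. Suc i < length p \<longrightarrow> {p ! i, p ! Suc i} \<in> edges G)"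

definition graph_connected :: "'a hypergraph \<Rightarrow> bool" where
  "graph_connected G \<longleftrightarrow> verts G \<noteq> {} \<and>
     (\<forall>u\<in>verts G. \<forall>v\<in>verts G. \<exists>p. is_walk G p \<and> hd p = u \<and> last p = v)"

text \<open>A cycle is listed without repeating its first vertex at the end.\<close>

definition is_cycle :: "'a hypergraph \<Rightarrow> 'a list \<Rightarrow> bool" where
  "is_cycle G p \<longleftrightarrow> is_walk G p \<and> distinct p \<and> length p \<ge> 3 \<and> {last p, hd p} \<in> edges G"

definition is_tree :: "'a hypergraph \<Rightarrow> bool" where
  "is_tree G \<longleftrightarrow> simple_graph G \<and> graph_connected G \<and> (\<nexists>p. is_cycle G p)"

definition contains_Berge :: "'b hypergraph \<Rightarrow> 'a hypergraph \<Rightarrow> bool" where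
  "contains_Berge H F \<longleftrightarrow>
     (\<exists>\<phi> f. inj_on \<phi> (verts F) \<and> \<phi> ` verts F \<subseteq> verts H \<and>
            inj_on f (edges F) \<and> f ` edges F \<subseteq> edges H \<and>
            (\<forall>x y. {x, y} \<in> edges F \<longrightarrow> {\<phi> x, \<phi> y} \<subseteq> f {x, y}))"

definition complete3 :: "nat \<Rightarrow> nat hypergraph" where
  "complete3 N = \<lparr>verts = {..<N}, edges = nsets {..<N} 3\<rparr>"

datatype colour = Blue | Red

definition colour_class :: "'a hypergraph \<Rightarrow> ('a set \<Rightarrow> colour) \<Rightarrow> colour \<Rightarrow> 'a hypergraph" where
  "colour_class H c k = \<lparr>verts = verts H, edges = {h \<in> edges H. c h = k}\<rparr>"

definition Berge3_arrows :: "nat \<Rightarrow> 'a hypergraph \<Rightarrow> 'b hypergraph \<Rightarrow> bool" where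
  "Berge3_arrows N F G \<longleftrightarrow>
     (\<forall>c. contains_Berge (colour_class (complete3 N) c Blue) F \<or>
          contains_Berge (colour_class (complete3 N) c Red) G)"

definition Berge3_Ramsey :: "'a hypergraph \<Rightarrow> 'b hypergraph \<Rightarrow> nat" where
  "Berge3_Ramsey F G = (LEAST N. Berge3_arrows N F G)"

end

theory Submission
  imports Defs
begin

text \<open>Call a pair full in a colour if all triples containing it have that colour. Deleting a leaf from each
  tree and a vertex \<open>z\<close> from the ground set, induction gives a monochromatic copy avoiding \<open>z\<close>, and any triple of
  the right colour through \<open>z\<close> and the image of the neighbour of the leaf is unused; so either we are done or \<open>z\<close> lies
  in a pair that is full in the other colour. Hence full pairs cover all vertices, and since full pairs of different
  colours do not meet, the vertices split into the set \<open>A\<close> covered in one colour and the set \<open>B\<close> covered in the other,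
  say with \<open>card B \<le> card A\<close>. Let \<open>T\<close> be the tree wanted in the colour of \<open>A\<close>.

  A set of at least four vertices covered by full pairs contains every tree of its size. If \<open>T\<close> has \<open>card B\<close> leaves,
  embed the rest of \<open>T\<close> into \<open>A\<close> and put these leaves on \<open>B\<close>. Otherwise all degrees in \<open>T\<close> are smaller than
  \<open>card B\<close>. Two vertices of \<open>A\<close> which each have a unique full partner, the partners being different, allow an
  induction that deletes both. If there are no such vertices, the vertices of \<open>A\<close>, except possibly one, can be assigned
  distinct full pairs, and \<open>T\<close> is embedded by placing one of its colour classes inside \<open>A\<close>. The statement for five
  vertices (false for two stars) and some six-vertex configurations are checked by computation.\<close>

section \<open>Trees built by adding leaves\<close>

text \<open>The obstacle is the failure of the five-vertex statement for two stars. Colour the five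
  cyclically consecutive triples on five points blue and the other five red: every point lies in
  three triples of each colour, while a star with four edges needs four through its centre. The
  induction must therefore never arrive at two stars on five vertices. This is why the leaves to be
  deleted from six-vertex trees are chosen with care, why two stars on six vertices are treated
  directly, and why the step from seven to five vertices excludes a star by a degree bound. Full
  pairs arise because they are exactly what blocks a leaf: if the new vertex lies in no triple used
  so far, a leaf can be placed there in one colour unless the new vertex and the image of the
  neighbour form a full pair of the other colour. Trees are taken as built by adding leaves, so that
  a deletion reverses a construction step.\<close>

inductive tree_on :: "'a set \<Rightarrow> 'a set set \<Rightarrow> bool" where
  single: "tree_on {x} {}"
| leaf: "tree_on V E \<Longrightarrow> u \<in> V \<Longrightarrow> x \<notin> V \<Longrightarrow> tree_on (insert x V) (insert {u, x} E)"

section \<open>Degrees and the number of leaves\<close>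

definition deg :: "'a set set \<Rightarrow> 'a \<Rightarrow> nat" where
  "deg E x = card {e \<in> E. x \<in> e}"

definition leaves :: "'a set \<Rightarrow> 'a set set \<Rightarrow> 'a set" where
  "leaves V E = {x \<in> V. deg E x = 1}"

definition is_star :: "'a set \<Rightarrow> 'a set set \<Rightarrow> bool" where
  "is_star V E \<longleftrightarrow> (\<exists>c\<in>V. \<forall>e\<in>E. c \<in> e)"

lemma tree_on_finite: "tree_on V E \<Longrightarrow> finite V \<and> finite E \<and> V \<noteq> {}"
  by (induction rule: tree_on.induct) auto

lemma tree_on_edge:
  assumes "tree_on V E" "e \<in> E"
  obtains a b where "e = {a, b}" "a \<noteq> b" "a \<in> V" "b \<in> V"
proof -
  from assms have "\<exists>a b. e = {a, b} \<and> a \<noteq> b \<and> a \<in> V \<and> b \<in> V"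
  proof (induction arbitrary: e rule: tree_on.induct)
    case (leaf V E u x)
    show ?case
    proof (cases "e = {u, x}")
      case True then show ?thesis using leaf by (intro exI[of _ u] exI[of _ x]) auto
    next
      case False then show ?thesis using leaf by blast
    qed
  qed auto
  then show thesis using that by blast
qed

lemma tree_on_edge_subset: "tree_on V E \<Longrightarrow> e \<in> E \<Longrightarrow> e \<subseteq> V"
  by (erule tree_on_edge) auto

lemma deg_insert_leaf:
  assumes "tree_on V E" "u \<in> V" "x \<notin> V"
  shows "deg (insert {u, x} E) y = (if y = x then 1 else if y = u then Suc (deg E u) else deg E y)"
proof -
  have sub: "e \<subseteq> V" if "e \<in> E" for e using tree_on_edge_subset[OF assms(1) that] .
  have fin: "finite E" using tree_on_finite[OF assms(1)] by simp
  have new: "{u, x} \<notin> E" using sub assms(3) by blast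
  have "{e \<in> insert {u, x} E. y \<in> e} =
      (if y = x then {{u, x}} else if y = u then insert {u, x} {e \<in> E. y \<in> e} else {e \<in> E. y \<in> e})"
    using sub assms(2,3) by auto
  then show ?thesis using new fin by (simp add: deg_def)
qed

lemma deg_pos:
  assumes "tree_on V E" "card V \<ge> 2" "x \<in> V"
  shows "deg E x \<ge> 1"
  using assms
proof (induction arbitrary: x rule: tree_on.induct)
  case (leaf V E u y)
  show ?case
  proof (cases "card V \<ge> 2")
    case True
    then show ?thesis using leaf by (auto simp: deg_insert_leaf)
  next
    case False
    have "card V \<noteq> 0" using tree_on_finite[OF leaf.hyps(1)] by simp
    with False have "card V = 1" by simp
    then have "V = {u}" using leaf.hyps(2) by (auto simp: card_1_singleton_iff)
    then show ?thesis using leaf by (auto simp: deg_insert_leaf)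
  qed
qed auto

text \<open>Only an inclusion holds in general: if \<open>V\<close> consists of \<open>u\<close>
  alone, then \<open>u\<close> becomes a leaf as well.\<close>

lemma leaves_insert_leaf:
  assumes "tree_on V E" "u \<in> V" "x \<notin> V"
  shows "insert x (leaves V E - {u}) \<subseteq> leaves (insert x V) (insert {u, x} E)"
  using assms by (auto simp: leaves_def deg_insert_leaf)

lemma finite_leaves: "tree_on V E \<Longrightarrow> finite (leaves V E)"
  by (simp add: leaves_def tree_on_finite)

lemma tree_on_card_1:
  assumes "tree_on V E" "card V < 2" "u \<in> V"
  shows "V = {u} \<and> E = {}"
proof -
  have "card V \<noteq> 0" using tree_on_finite[OF assms(1)] by simp
  with assms(2) have "card V = 1" by simp
  then have V: "V = {u}" using assms(3) by (auto simp: card_1_singleton_iff)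
  have "E = {}"
  proof (rule ccontr)
    assume "E \<noteq> {}"
    then obtain e where "e \<in> E" by blast
    then obtain a b where "a \<noteq> b" "a \<in> V" "b \<in> V" using tree_on_edge[OF assms(1)] by metis
    with V show False by simp
  qed
  with V show ?thesis by simp
qed

lemma deg_empty [simp]: "deg {} x = 0"
  by (simp add: deg_def)

lemma two_le_leaves:
  assumes "tree_on V E" "card V \<ge> 2"
  shows "2 \<le> card (leaves V E)"
  using assms
proof (induction rule: tree_on.induct)
  case (leaf V E u x)
  have fin: "finite (leaves (insert x V) (insert {u, x} E))"
    using finite_leaves tree_on.leaf[OF leaf.hyps] by blast
  show ?case
  proof (cases "card V \<ge> 2")
    case True
    have "card (insert x (leaves V E - {u})) \<ge> card (leaves V E)"
      using leaf.hyps finite_leaves[OF leaf.hyps(1)]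
      by (subst card_insert_disjoint) (auto simp: leaves_def card_Diff_singleton_if)
    then show ?thesis
      using card_mono[OF fin leaves_insert_leaf[OF leaf.hyps]] leaf.IH[OF True] by linarith
  next
    case False
    then have "V = {u}" "E = {}" using tree_on_card_1[of V E u] leaf.hyps by auto
    then have "leaves (insert x V) (insert {u, x} E) = {u, x}"
      using leaf.hyps by (auto simp: leaves_def deg_insert_leaf)
    then show ?thesis using leaf.hyps(2,3) by (simp add: card_insert_if) blast
  qed
qed auto

text \<open>Every edge at \<open>y\<close> opens a branch that ends in a leaf. In the induction,
  when the degree of \<open>u\<close> grows from a value above 1, \<open>u\<close> was not a leaf,
  so the number of leaves grows too; smaller degrees are covered by \<open>two_le_leaves\<close>.
  The lemma turns few leaves into small degrees everywhere.\<close>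

lemma deg_le_leaves:
  assumes "tree_on V E" "card V \<ge> 2" "y \<in> V"
  shows "deg E y \<le> card (leaves V E)"
  using assms
proof (induction arbitrary: y rule: tree_on.induct)
  case (leaf V E u x)
  let ?L = "leaves (insert x V) (insert {u, x} E)"
  have T: "tree_on (insert x V) (insert {u, x} E)" using tree_on.leaf[OF leaf.hyps] .
  have two: "2 \<le> card ?L" using two_le_leaves[OF T leaf.prems(1)] .
  have le: "card (insert x (leaves V E - {u})) \<le> card ?L"
    by (rule card_mono[OF finite_leaves[OF T] leaves_insert_leaf[OF leaf.hyps]])
  have c: "card (insert x (leaves V E - {u})) = Suc (card (leaves V E - {u}))"
    using leaf.hyps finite_leaves[OF leaf.hyps(1)] by (subst card_insert_disjoint) (auto simp: leaves_def)
  show ?case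
  proof (cases "card V \<ge> 2")
    case True
    consider "y = x" | "y = u" "deg E u \<le> 1" | "y = u" "deg E u > 1" | "y \<noteq> x" "y \<noteq> u" by linarith
    then show ?thesis
    proof cases
      case 3
      then have "leaves V E - {u} = leaves V E" by (auto simp: leaves_def)
      then show ?thesis using 3 leaf.IH[OF True, of u] le c leaf.hyps by (auto simp: deg_insert_leaf)
    next
      case 4
      have "card (leaves V E) \<le> Suc (card (leaves V E - {u}))"
        by (simp add: card_Diff_singleton_if) arith
      then show ?thesis using 4 leaf.IH[OF True, of y] le c leaf.hyps leaf.prems(2) by (simp add: deg_insert_leaf)
    qed (use two leaf.hyps in \<open>auto simp: deg_insert_leaf\<close>)
  next
    case False
    then have "V = {u}" "E = {}" using tree_on_card_1[of V E u] leaf.hyps by auto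
    then show ?thesis using two leaf by (auto simp: deg_insert_leaf)
  qed
qed auto

text \<open>Any vertex with a single incident edge can be deleted, not only the one attached last:
  delete it from the smaller tree and attach \<open>y\<close> again. This fails only if
  \<open>y\<close> hangs on \<open>x\<close> itself, and then the smaller tree is a single
  vertex.\<close>

lemma leaf_remove:
  assumes "tree_on V E" "{e \<in> E. x \<in> e} = {{u, x}}"
  shows "tree_on (V - {x}) (E - {{u, x}})"
  using assms
proof (induction rule: tree_on.induct)
  case (leaf V E v y)
  have sub: "e \<subseteq> V" if "e \<in> E" for e using tree_on_edge_subset[OF leaf.hyps(1) that] .
  have new: "{v, y} \<notin> E" using sub leaf.hyps(3) by blast
  have uniq: "e = {u, x}" if "e \<in> insert {v, y} E" "x \<in> e" for e
  proof -
    have "e \<in> {e \<in> insert {v, y} E. x \<in> e}" using that by simp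
    then show ?thesis by (simp only: leaf.prems singleton_iff)
  qed
  show ?case
  proof (cases "x = y")
    case True
    have "{v, y} = {u, x}" by (rule uniq) (simp_all add: True)
    then have "insert {v, y} E - {{u, x}} = E" using new by auto
    moreover have "insert y V - {x} = V" using True leaf.hyps by auto
    ultimately show ?thesis using leaf.hyps(1) by (simp only:)
  next
    case xy: False
    show ?thesis
    proof (cases "x = v")
      case True
      have eq: "{v, y} = {u, x}" by (rule uniq) (simp_all add: True)
      have "x \<notin> e" if "e \<in> E" for e
      proof
        assume "x \<in> e"
        then have "e = {v, y}" using uniq[of e] that eq by simp
        then show False using that new by simp
      qed
      then have "{e \<in> E. x \<in> e} = {}" by simp
      then have "deg E x = 0" unfolding deg_def by (simp only: card.empty)
      then have "card V < 2" using deg_pos[OF leaf.hyps(1), of x] leaf.hyps(2) True by (metis not_le not_one_le_zero)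
      then have VE: "V = {v}" "E = {}" using tree_on_card_1[OF leaf.hyps(1) _ leaf.hyps(2)] by auto
      have "insert {v, y} E - {{u, x}} = {}" using eq VE by simp
      moreover have "insert y V - {x} = {y}" using VE True xy by auto
      ultimately show ?thesis using tree_on.single[of y] by (simp only:)
    next
      case xv: False
      have px: "{v, y} \<noteq> {u, x}" using xv xy by (auto simp: doubleton_eq_iff)
      have "{e \<in> insert {v, y} E. x \<in> e} = {e \<in> E. x \<in> e}" using xv xy by auto
      then have "{e \<in> E. x \<in> e} = {{u, x}}" by (simp only: leaf.prems)
      then have "tree_on (V - {x}) (E - {{u, x}})" by (rule leaf.IH)
      then have "tree_on (insert y (V - {x})) (insert {v, y} (E - {{u, x}}))"
        by (rule tree_on.leaf) (use leaf.hyps(2,3) xv in simp_all)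
      moreover have "insert y V - {x} = insert y (V - {x})" using xy by auto
      moreover have "insert {v, y} E - {{u, x}} = insert {v, y} (E - {{u, x}})" using px by auto
      ultimately show ?thesis by (simp only:)
    qed
  qed
qed auto

lemma leafE:
  assumes "tree_on V E" "x \<in> leaves V E"
  obtains u where "u \<in> V" "u \<noteq> x" "{u, x} \<in> E" "{e \<in> E. x \<in> e} = {{u, x}}"
proof -
  have "card {e \<in> E. x \<in> e} = 1" using assms(2) by (simp add: leaves_def deg_def)
  then obtain e where e: "{e \<in> E. x \<in> e} = {e}" by (auto simp: card_1_singleton_iff)
  then have "e \<in> E" "x \<in> e" by auto
  then obtain a b where ab: "e = {a, b}" "a \<noteq> b" "a \<in> V" "b \<in> V" using tree_on_edge[OF assms(1)] by metis
  define u where "u = (if x = a then b else a)"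
  have "e = {u, x}" "u \<noteq> x" "u \<in> V" using ab \<open>x \<in> e\<close> by (auto simp: u_def)
  then show thesis using that e \<open>e \<in> E\<close> by simp
qed

section \<open>Stars and trees that are not stars\<close>

lemma star_leaf:
  assumes "tree_on V E" "\<forall>e\<in>E. c \<in> e" "c \<in> V" "z \<in> V" "z \<noteq> c"
  shows "{e \<in> E. z \<in> e} = {{c, z}}"
proof -
  have "card {c, z} \<le> card V" using assms tree_on_finite[OF assms(1)] by (intro card_mono) auto
  then have "card V \<ge> 2" using assms(5) by simp
  then have "deg E z \<ge> 1" using deg_pos assms by metis
  then obtain e where "e \<in> {e \<in> E. z \<in> e}" unfolding deg_def
    by (metis card.empty ex_in_conv not_one_le_zero)
  moreover have "e = {c, z}" if e: "e \<in> E" "z \<in> e" for e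
  proof -
    obtain a b where "e = {a, b}" using tree_on_edge[OF assms(1) e(1)] by metis
    moreover have "c \<in> e" using assms(2) e by blast
    ultimately show ?thesis using e(2) assms(5) by auto
  qed
  ultimately show ?thesis by blast
qed

lemma star_insert_leaf: "\<forall>e\<in>E. c \<in> e \<Longrightarrow> c \<in> V \<Longrightarrow> is_star (insert x V) (insert {c, x} E)"
  by (auto simp: is_star_def)

text \<open>Two leaves with different neighbours, detachable together, are what a star lacks. If the
  new leaf \<open>y\<close> turns a star with centre \<open>c\<close> into a non-star, then
  \<open>y\<close> hangs on some \<open>u\<close> other than \<open>c\<close>, and a further leaf at
  \<open>c\<close> completes the pair.\<close>

lemma nonstar_two_leaves:
  assumes "tree_on V E" "\<not> is_star V E"
  shows "\<exists>V0 E0 x1 x2 u1 u2. tree_on V0 E0 \<and> u1 \<in> V0 \<and> u2 \<in> V0 \<and> u1 \<noteq> u2 \<and> x1 \<notin> V0 \<and> x2 \<notin> V0 \<and>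
      x1 \<noteq> x2 \<and> V = insert x1 (insert x2 V0) \<and> E = insert {u1, x1} (insert {u2, x2} E0)"
    (is "?P V E")
  using assms
proof (induction rule: tree_on.induct)
  case (single x)
  then show ?case by (simp add: is_star_def)
next
  case (leaf V E u y)
  have I: "?P V' E'" if "tree_on V0 E0" "u1 \<in> V0" "u2 \<in> V0" "u1 \<noteq> u2" "x1 \<notin> V0" "x2 \<notin> V0"
      "x1 \<noteq> x2" "V' = insert x1 (insert x2 V0)" "E' = insert {u1, x1} (insert {u2, x2} E0)"
    for V' E' V0 E0 u1 u2 x1 x2
    using that by blast
  show ?case
  proof (cases "is_star V E")
    case True
    then obtain c where c: "c \<in> V" "\<forall>e\<in>E. c \<in> e" by (auto simp: is_star_def)
    have uc: "u \<noteq> c" using leaf.prems c star_insert_leaf[of E c V y] by blast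
    \<comment> \<open>Otherwise \<open>u\<close> is a centre as well, and attaching \<open>y\<close>
      to it gives a star again.\<close>
    have "V \<noteq> {c, u}"
    proof
      assume V: "V = {c, u}"
      have "u \<in> e" if e: "e \<in> E" for e
      proof -
        obtain a b where "e = {a, b}" "a \<noteq> b" "a \<in> V" "b \<in> V"
          using tree_on_edge[OF leaf.hyps(1) e] by metis
        with V show ?thesis by auto
      qed
      then show False using leaf.prems leaf.hyps(2) star_insert_leaf[of E u V y] by blast
    qed
    then obtain z where z: "z \<in> V" "z \<noteq> c" "z \<noteq> u" using c leaf.hyps(2) by blast
    have *: "{e \<in> E. z \<in> e} = {{c, z}}" using star_leaf[OF leaf.hyps(1) c(2,1) z(1,2)] .
    have czE: "{c, z} \<in> E" using * by blast
    show ?thesis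
    proof (rule I[of "V - {z}" "E - {{c, z}}" u c y z])
      show "tree_on (V - {z}) (E - {{c, z}})" by (rule leaf_remove[OF leaf.hyps(1) *])
      show "insert y V = insert y (insert z (V - {z}))" using z(1) by (simp add: insert_absorb)
      show "insert {u, y} E = insert {u, y} (insert {c, z} (E - {{c, z}}))"
        using czE by (simp add: insert_absorb)
    qed (use uc z c leaf.hyps in auto)
  next
    case False
    then obtain V0 E0 x1 x2 u1 u2 where IH: "tree_on V0 E0" "u1 \<in> V0" "u2 \<in> V0" "u1 \<noteq> u2" "x1 \<notin> V0" "x2 \<notin> V0"
      "x1 \<noteq> x2" "V = insert x1 (insert x2 V0)" "E = insert {u1, x1} (insert {u2, x2} E0)"
      using leaf.IH by blast
    have y: "y \<notin> V0" "y \<noteq> x1" "y \<noteq> x2" using leaf.hyps IH by auto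
    \<comment> \<open>The old pair of leaves survives unless \<open>y\<close> is attached to one of
      them; in that case \<open>y\<close> replaces it, with the former leaf as its
      neighbour.\<close>
    consider "u \<in> V0" | "u = x1" | "u = x2" using leaf.hyps(2) IH(8) by blast
    then show ?thesis
    proof cases
      case 1
      show ?thesis
      proof (rule I[of "insert y V0" "insert {u, y} E0" u1 u2 x1 x2])
        show "tree_on (insert y V0) (insert {u, y} E0)" using tree_on.leaf[OF IH(1) 1 y(1)] .
      qed (use IH y in \<open>simp_all add: insert_commute\<close>)
    next
      case 2
      show ?thesis
      proof (rule I[of "insert x1 V0" "insert {u1, x1} E0" x1 u2 y x2])
        show "tree_on (insert x1 V0) (insert {u1, x1} E0)" using tree_on.leaf[OF IH(1) IH(2) IH(5)] .
        show "insert {u, y} E = insert {x1, y} (insert {u2, x2} (insert {u1, x1} E0))"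
          unfolding IH(9) 2 by (simp only: insert_commute[of "{u1, x1}" "{u2, x2}"])
        show "insert y V = insert y (insert x2 (insert x1 V0))" unfolding IH(8) by (simp only: insert_commute)
      qed (use IH y in auto)
    next
      case 3
      show ?thesis
      proof (rule I[of "insert x2 V0" "insert {u2, x2} E0" x2 u1 y x1])
        show "tree_on (insert x2 V0) (insert {u2, x2} E0)" using tree_on.leaf[OF IH(1) IH(3) IH(6)] .
        show "insert {u, y} E = insert {x2, y} (insert {u1, x1} (insert {u2, x2} E0))"
          unfolding IH(9) 3 ..
        show "insert y V = insert y (insert x1 (insert x2 V0))" unfolding IH(8) ..
      qed (use IH y in auto)
    qed
  qed
qed

text \<open>The bound 5 is sharp, since the path on four vertices minus an end is a star. If
  deleting \<open>y\<close> leaves a star with centre \<open>c\<close>, then \<open>c\<close> has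
  two leaves \<open>z\<close>, \<open>z'\<close> other than \<open>u\<close>; deleting
  \<open>z\<close> instead keeps the disjoint edges \<open>{c, z'}\<close> and
  \<open>{u, y}\<close>.\<close>

lemma nonstar_remove_leaf:
  assumes "tree_on V E" "\<not> is_star V E" "card V \<ge> 5"
  shows "\<exists>V0 E0 u x. tree_on V0 E0 \<and> u \<in> V0 \<and> x \<notin> V0 \<and> V = insert x V0 \<and> E = insert {u, x} E0 \<and>
      \<not> is_star V0 E0"
  using assms(1)
proof (cases rule: tree_on.cases)
  case (single x)
  then show ?thesis using assms by simp
next
  case (leaf V0 E0 u y)
  show ?thesis
  proof (cases "is_star V0 E0")
    case False
    then show ?thesis using leaf by metis
  next
    case True
    then obtain c where c: "c \<in> V0" "\<forall>e\<in>E0. c \<in> e" by (auto simp: is_star_def)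
    have uc: "u \<noteq> c" using leaf(1,2) assms(2) c star_insert_leaf[of E0 c V0 y] by metis
    have fin: "finite V0" using tree_on_finite[OF leaf(3)] by simp
    have "card V0 \<ge> 4" using assms(3) leaf(1,5) fin by simp
    then have "card (V0 - {c, u}) \<ge> 2" using uc c(1) leaf(4) by (simp add: card_Diff_subset)
    then have "\<not> card (V0 - {c, u}) \<le> Suc 0" by simp
    then obtain z z' where z: "z \<in> V0" "z' \<in> V0" "z \<noteq> z'" "z \<notin> {c, u}" "z' \<notin> {c, u}"
      using card_le_Suc0_iff_eq[of "V0 - {c, u}"] fin by blast
    have *: "{e \<in> E0. z \<in> e} = {{c, z}}" "{e \<in> E0. z' \<in> e} = {{c, z'}}"
      using star_leaf[OF leaf(3) c(2,1)] z by blast+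
    have czE: "{c, z} \<in> E0" "{c, z'} \<in> E0" using * by blast+
    define V1 E1 where "V1 = insert y (V0 - {z})" and "E1 = insert {u, y} (E0 - {{c, z}})"
    have "tree_on (V0 - {z}) (E0 - {{c, z}})" by (rule leaf_remove[OF leaf(3) *(1)])
    then have T: "tree_on V1 E1" unfolding V1_def E1_def
      by (rule tree_on.leaf) (use leaf z in auto)
    have "{c, z'} \<noteq> {c, z}" using z by (auto simp: doubleton_eq_iff)
    then have "{c, z'} \<in> E1" "{u, y} \<in> E1" using czE by (simp_all add: E1_def)
    moreover have "{c, z'} \<inter> {u, y} = {}" using uc z c leaf(5) by auto
    ultimately have ns: "\<not> is_star V1 E1" unfolding is_star_def by blast
    have "E = insert {c, z} E1"
      unfolding leaf(2) E1_def insert_commute[of "{c, z}"] using czE by (simp add: insert_absorb)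
    moreover have "V = insert z V1"
      unfolding leaf(1) V1_def insert_commute[of z] using z by (simp add: insert_absorb)
    moreover have "c \<in> V1" "z \<notin> V1" using z c leaf(5) by (auto simp: V1_def)
    ultimately show ?thesis using T ns by metis
  qed
qed

section \<open>Bipartition, rooting, relabelling and enlargement of trees\<close>

lemma tree_on_bipartition:
  assumes "tree_on V E"
  obtains P Q where "P \<inter> Q = {}" "P \<union> Q = V" "\<And>e. e \<in> E \<Longrightarrow> \<exists>q\<in>Q. \<exists>p\<in>P. e = {q, p}"
proof -
  from assms have "\<exists>P Q. P \<inter> Q = {} \<and> P \<union> Q = V \<and> (\<forall>e\<in>E. \<exists>q\<in>Q. \<exists>p\<in>P. e = {q, p})"
  proof (induction rule: tree_on.induct)
    case (single x)
    show ?case by (intro exI[of _ "{x}"] exI[of _ "{}"]) auto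
  next
    case (leaf V E u x)
    then obtain P Q where PQ: "P \<inter> Q = {}" "P \<union> Q = V" "\<forall>e\<in>E. \<exists>q\<in>Q. \<exists>p\<in>P. e = {q, p}" by blast
    show ?case
    proof (cases "u \<in> P")
      case True
      have "\<exists>q\<in>insert x Q. \<exists>p\<in>P. {u, x} = {q, p}"
        using True by (intro bexI[of _ x] bexI[of _ u]) auto
      then have "\<forall>e\<in>insert {u, x} E. \<exists>q\<in>insert x Q. \<exists>p\<in>P. e = {q, p}" using PQ(3) by simp
      moreover have "P \<inter> insert x Q = {}" "P \<union> insert x Q = insert x V" using PQ leaf.hyps by auto
      ultimately show ?thesis by metis
    next
      case False
      then have "\<exists>q\<in>Q. \<exists>p\<in>insert x P. {u, x} = {q, p}"
        using PQ leaf.hyps by (intro bexI[of _ u] bexI[of _ x]) auto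
      then have "\<forall>e\<in>insert {u, x} E. \<exists>q\<in>Q. \<exists>p\<in>insert x P. e = {q, p}"
        using PQ(3) by (metis insert_iff)
      moreover have "insert x P \<inter> Q = {}" "insert x P \<union> Q = insert x V" using PQ leaf.hyps by auto
      ultimately show ?thesis by metis
    qed
  qed
  then show thesis using that by blast
qed

text \<open>Edges oriented towards the root \<open>p\<close>.\<close>

lemma tree_on_root:
  assumes "tree_on V E" "p \<in> V"
  shows "\<exists>r. (\<forall>x\<in>V - {p}. r x \<in> V \<and> {x, r x} \<in> E) \<and> inj_on (\<lambda>x. {x, r x}) (V - {p})"
  using assms
proof (induction arbitrary: p rule: tree_on.induct)
  case (single x)
  then show ?case by simp
next
  case (leaf V E u y)
  have new: "{u, y} \<notin> E" using tree_on_edge_subset[OF leaf.hyps(1)] leaf.hyps(3) by blast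
  \<comment> \<open>The new edge is oriented from \<open>a\<close> to \<open>b\<close> and added to
    an orientation towards the old root \<open>q\<close>. If \<open>y\<close> is the new root, the
    old root \<open>u\<close> takes the edge; otherwise \<open>y\<close> does.\<close>
  have step: "\<exists>r. (\<forall>x\<in>insert a (V - {q}). r x \<in> insert y V \<and> {x, r x} \<in> insert {u, y} E) \<and>
      inj_on (\<lambda>x. {x, r x}) (insert a (V - {q}))"
    if q: "q \<in> V" and ab: "a \<notin> V - {q}" "b \<in> insert y V" "{a, b} = {u, y}" for a b q
  proof -
    obtain r where r: "\<forall>x\<in>V - {q}. r x \<in> V \<and> {x, r x} \<in> E" "inj_on (\<lambda>x. {x, r x}) (V - {q})"
      using leaf.IH[OF q] by blast
    define r' where "r' = r(a := b)"
    have ra: "r' a = b" and rx: "\<And>x. x \<in> V - {q} \<Longrightarrow> r' x = r x" using ab(1) by (auto simp: r'_def)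
    have "inj_on (\<lambda>x. {x, r' x}) (V - {q})"
      using inj_on_cong[of "V - {q}" "\<lambda>x. {x, r' x}" "\<lambda>x. {x, r x}"] rx r(2) by simp
    moreover have "{a, r' a} \<notin> (\<lambda>x. {x, r' x}) ` (V - {q} - {a})"
    proof
      assume "{a, r' a} \<in> (\<lambda>x. {x, r' x}) ` (V - {q} - {a})"
      then obtain x where x: "x \<in> V - {q}" "{a, r' a} = {x, r' x}" by blast
      then have "{u, y} = {x, r x}" using rx ab(3) ra by simp
      then show False using r(1) x(1) new by metis
    qed
    ultimately have "inj_on (\<lambda>x. {x, r' x}) (insert a (V - {q}))" by (simp only: inj_on_insert simp_thms)
    moreover have "r' x \<in> insert y V \<and> {x, r' x} \<in> insert {u, y} E" if "x \<in> insert a (V - {q})" for x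
    proof (cases "x = a")
      case True
      then show ?thesis using ra ab by simp
    next
      case False
      then show ?thesis using that rx r(1) by simp
    qed
    ultimately show ?thesis by blast
  qed
  show ?case
  proof (cases "p = y")
    case True
    have "insert y V - {p} = insert u (V - {u})" using True leaf.hyps by auto
    then show ?thesis using step[of u u y] leaf.hyps by simp
  next
    case False
    then have "p \<in> V" using leaf.prems by simp
    moreover have "insert y V - {p} = insert y (V - {p})" using False by auto
    ultimately show ?thesis using step[of p y u] leaf.hyps by (simp add: insert_commute)
  qed
qed

lemma tree_on_image:
  assumes "tree_on V E" "inj_on g V"
  shows "tree_on (g ` V) ((`) g ` E)"
  using assms
proof (induction rule: tree_on.induct)
  case (leaf V E u x)
  have "tree_on (insert (g x) (g ` V)) (insert {g u, g x} ((`) g ` E))"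
    by (rule tree_on.leaf) (use leaf in auto)
  then show ?case by simp
qed (simp add: tree_on.single)

text \<open>Lets the induction deal with two trees of equal size only. The type \<open>nat\<close>
  supplies fresh vertices, which a finite vertex type could not.\<close>

lemma tree_on_extend:
  fixes V :: "nat set"
  assumes "tree_on V E" "card V \<le> n"
  shows "\<exists>V' E'. tree_on V' E' \<and> V \<subseteq> V' \<and> E \<subseteq> E' \<and> card V' = n"
  using assms(2)
proof (induction rule: dec_induct)
  case base
  then show ?case using assms(1) by blast
next
  case (step m)
  then obtain V' E' where IH: "tree_on V' E'" "V \<subseteq> V'" "E \<subseteq> E'" "card V' = m" by blast
  obtain x where x: "x \<notin> V'" using tree_on_finite[OF IH(1)] infinite_UNIV_nat by (metis ex_new_if_finite)
  obtain u where "u \<in> V'" using tree_on_finite[OF IH(1)] by blast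
  then have "tree_on (insert x V') (insert {u, x} E')" using tree_on.leaf[OF IH(1)] x by blast
  moreover have "card (insert x V') = Suc m" using x IH tree_on_finite[OF IH(1)] by simp
  ultimately show ?case using IH by blast
qed

section \<open>From connected acyclic graphs to trees built by leaves\<close>

lemma tree_on_path:
  assumes "tree_on V E" "a \<in> V" "b \<in> V"
  shows "\<exists>p. p \<noteq> [] \<and> distinct p \<and> set p \<subseteq> V \<and> hd p = a \<and> last p = b \<and> successively (\<lambda>x y. {x, y} \<in> E) p"
  using assms
proof (induction arbitrary: a b rule: tree_on.induct)
  case (single x)
  then show ?case by (intro exI[of _ "[x]"]) auto
next
  case (leaf V E u y)
  let ?R = "\<lambda>x z. {x, z} \<in> insert {u, y} E"
  have mono: "successively ?R p" if "successively (\<lambda>x z. {x, z} \<in> E) p" for p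
    using that by (rule successively_mono) auto
  consider "a \<in> V" "b \<in> V" | "a = y" "b \<in> V" | "a \<in> V" "b = y" | "a = y" "b = y"
    using leaf.prems by blast
  then show ?case
  proof cases
    case 1
    then show ?thesis using leaf.IH[of a b] mono by (metis subset_insertI2)
  next
    case 2
    obtain p where p: "p \<noteq> []" "distinct p" "set p \<subseteq> V" "hd p = u" "last p = b" "successively (\<lambda>x y. {x, y} \<in> E) p"
      using leaf.IH[OF leaf.hyps(2) 2(2)] by blast
    then have "successively ?R (y # p)" using mono by (cases p) (auto simp: insert_commute)
    then show ?thesis using p 2 leaf.hyps by (intro exI[of _ "y # p"]) auto
  next
    case 3
    obtain p where p: "p \<noteq> []" "distinct p" "set p \<subseteq> V" "hd p = a" "last p = u" "successively (\<lambda>x y. {x, y} \<in> E) p"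
      using leaf.IH[OF 3(1) leaf.hyps(2)] by blast
    then have "successively ?R (p @ [y])" using mono by (simp add: successively_append_iff)
    then show ?thesis using p 3 leaf.hyps by (intro exI[of _ "p @ [y]"]) auto
  next
    case 4
    then show ?thesis by (intro exI[of _ "[y]"]) auto
  qed
qed

lemma successively_leaves_set:
  assumes "successively R p" "p \<noteq> []" "hd p \<in> S" "last p \<notin> S"
  shows "\<exists>x y. x \<in> S \<and> y \<notin> S \<and> y \<in> set p \<and> R x y"
  using assms
proof (induction p)
  case (Cons a p)
  have "p \<noteq> []" using Cons.prems by auto
  then obtain b q where p: "p = b # q" by (cases p) auto
  show ?case
  proof (cases "b \<in> S")
    case True
    then have "\<exists>x y. x \<in> S \<and> y \<notin> S \<and> y \<in> set p \<and> R x y" using Cons p by simp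
    then show ?thesis by (metis list.set_intros(2))
  next
    case False
    then show ?thesis using Cons.prems p by (intro exI[of _ a] exI[of _ b]) simp
  qed
qed simp

text \<open>A tree with the largest number of vertices cannot be extended, so it spans a whole
  component. Here \<open>A\<close> is merely a set of permitted edges: the edges of a given graph,
  or the pairs of a symmetric relation.\<close>

lemma maximal_tree_on:
  fixes W :: "'a set"
  assumes "finite W" "x \<in> W"
  shows "\<exists>V E. tree_on V E \<and> V \<subseteq> W \<and> E \<subseteq> A \<and> x \<in> V \<and> (\<forall>u\<in>V. \<forall>v\<in>W. {u, v} \<in> A \<longrightarrow> v \<in> V)"
proof -
  let ?C = "\<lambda>m. \<exists>V E. tree_on V E \<and> V \<subseteq> W \<and> E \<subseteq> A \<and> x \<in> V \<and> card V = m"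
  have "?C 1" using assms tree_on.single[of x] by (intro exI[of _ "{x}"] exI[of _ "{}"]) auto
  moreover have "\<forall>m. ?C m \<longrightarrow> m \<le> card W" using assms card_mono by blast
  ultimately have ex: "\<exists>m. ?C m \<and> (\<forall>k. ?C k \<longrightarrow> k \<le> m)" by (rule Nat.ex_has_greatest_nat)
  define m where "m = (SOME m. ?C m \<and> (\<forall>k. ?C k \<longrightarrow> k \<le> m))"
  have m: "?C m" "\<forall>k. ?C k \<longrightarrow> k \<le> m" using someI_ex[OF ex] unfolding m_def by (rule conjunct1, rule conjunct2)
  then obtain V E where VE: "tree_on V E" "V \<subseteq> W" "E \<subseteq> A" "x \<in> V" "card V = m" by blast
  have "v \<in> V" if uv: "u \<in> V" "v \<in> W" "{u, v} \<in> A" for u v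
  proof (rule ccontr)
    assume v: "v \<notin> V"
    have "card (insert v V) = Suc m" using v VE tree_on_finite[OF VE(1)] by simp
    moreover have "tree_on (insert v V) (insert {u, v} E)" using tree_on.leaf[OF VE(1) uv(1) v] .
    moreover have "insert v V \<subseteq> W" "insert {u, v} E \<subseteq> A" "x \<in> insert v V" using uv VE by simp_all
    ultimately have C: "?C (Suc m)"
      by (intro exI[of _ "insert v V"] exI[of _ "insert {u, v} E"]) (simp only: simp_thms)
    have "Suc m \<le> m" by (rule mp[OF spec[OF m(2)] C])
    then show False by simp
  qed
  then have "\<forall>u\<in>V. \<forall>v\<in>W. {u, v} \<in> A \<longrightarrow> v \<in> V" by blast
  with VE(1-4) show ?thesis by (intro exI[of _ V] exI[of _ E] conjI)
qed

text \<open>Take a maximal tree built by leaves. Connectedness makes it spanning. An edge outside it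
  would close a cycle with the path between its ends, which has at least three vertices because that
  edge is not in the tree.\<close>

lemma is_tree_imp_tree_on:
  assumes "is_tree G"
  shows "tree_on (verts G) (edges G)"
proof -
  have fin: "finite (verts G)" and uni: "edges G \<subseteq> nsets (verts G) 2"
    and conn: "graph_connected G" and acyc: "\<nexists>p. is_cycle G p"
    using assms by (auto simp: is_tree_def simple_graph_def uniform_def)
  obtain x where x: "x \<in> verts G" using conn by (auto simp: graph_connected_def)
  obtain V E where VE: "tree_on V E" "V \<subseteq> verts G" "E \<subseteq> edges G" "x \<in> V"
    and cl: "\<And>u v. u \<in> V \<Longrightarrow> v \<in> verts G \<Longrightarrow> {u, v} \<in> edges G \<Longrightarrow> v \<in> V"
    using maximal_tree_on[OF fin x, of "edges G"] by metis
  have V: "V = verts G"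
  proof (rule ccontr)
    assume "V \<noteq> verts G"
    then obtain v where v: "v \<in> verts G" "v \<notin> V" using VE by blast
    obtain p where p: "is_walk G p" "hd p = x" "last p = v"
      using conn x v unfolding graph_connected_def by metis
    then have "successively (\<lambda>x y. {x, y} \<in> edges G) p" "p \<noteq> []" "set p \<subseteq> verts G"
      by (auto simp: is_walk_def successively_conv_nth)
    then show False using successively_leaves_set[of _ p V] p v VE(4) cl by blast
  qed
  have "E = edges G"
  proof (rule ccontr)
    assume "E \<noteq> edges G"
    then obtain e where e: "e \<in> edges G" "e \<notin> E" using VE by blast
    then have "e \<in> nsets (verts G) 2" using uni by blast
    then obtain a b where ab: "e = {a, b}" "a \<noteq> b" "a \<in> V" "b \<in> V"
      using V by (auto simp: nsets_def card_2_iff)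
    obtain p where p: "p \<noteq> []" "distinct p" "set p \<subseteq> V" "hd p = a" "last p = b"
        "successively (\<lambda>x y. {x, y} \<in> E) p"
      using tree_on_path[OF VE(1) ab(3,4)] by blast
    have "length p \<noteq> 1" using p ab(2) by (auto simp: length_Suc_conv)
    moreover have "length p \<noteq> 2"
    proof
      assume "length p = 2"
      then obtain c d where "p = [c, d]" by (auto simp: numeral_2_eq_2 length_Suc_conv)
      then show False using p e ab by simp
    qed
    moreover have "length p \<noteq> 0" using p by simp
    ultimately have "length p \<ge> 3" by linarith
    moreover have "is_walk G p" using p VE V by (auto simp: is_walk_def successively_conv_nth)
    ultimately have "is_cycle G p" using p e ab by (simp add: is_cycle_def insert_commute)
    then show False using acyc by blast
  qed
  with V VE(1) show ?thesis by simp
qed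

section \<open>Monochromatic Berge copies\<close>

fun opp :: "colour \<Rightarrow> colour" where
  "opp Blue = Red"
| "opp Red = Blue"

lemma opp_opp [simp]: "opp (opp k) = k"
  by (cases k) auto

lemma neq_colour_iff: "j \<noteq> k \<longleftrightarrow> j = opp k"
  by (cases j; cases k) auto

text \<open>The witnesses are explicit because adding a leaf depends on which vertices and triples
  are occupied; the ground set \<open>X\<close> is a parameter so that a copy can be moved into a
  larger one.\<close>

definition Berge_emb ::
  "'x set \<Rightarrow> ('x set \<Rightarrow> colour) \<Rightarrow> colour \<Rightarrow> 'a set \<Rightarrow> 'a set set \<Rightarrow> ('a \<Rightarrow> 'x) \<Rightarrow> ('a set \<Rightarrow> 'x set) \<Rightarrow> bool" where
  "Berge_emb X c k V E \<phi> f \<longleftrightarrow> inj_on \<phi> V \<and> \<phi> ` V \<subseteq> X \<and> inj_on f E \<and>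
     (\<forall>e\<in>E. f e \<in> nsets X 3 \<and> c (f e) = k \<and> \<phi> ` e \<subseteq> f e)"

definition Berge_copy :: "'x set \<Rightarrow> ('x set \<Rightarrow> colour) \<Rightarrow> colour \<Rightarrow> 'a set \<Rightarrow> 'a set set \<Rightarrow> bool" where
  "Berge_copy X c k V E \<longleftrightarrow> (\<exists>\<phi> f. Berge_emb X c k V E \<phi> f)"

text \<open>Fullness is relative to \<open>X\<close>: it survives shrinking the ground set, which
  makes inductions possible. On two points it is vacuous, hence the assumptions
  \<open>card X \<ge> 3\<close> below.\<close>

definition full_pair :: "'x set \<Rightarrow> ('x set \<Rightarrow> colour) \<Rightarrow> colour \<Rightarrow> 'x \<Rightarrow> 'x \<Rightarrow> bool" where
  "full_pair X c k u v \<longleftrightarrow> u \<in> X \<and> v \<in> X \<and> u \<noteq> v \<and> (\<forall>w\<in>X - {u, v}. c {u, v, w} = k)"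

lemma full_pair_sym: "full_pair X c k u v \<Longrightarrow> full_pair X c k v u"
  by (auto simp: full_pair_def insert_commute)

lemma full_pair_subset: "full_pair X c k u v \<Longrightarrow> Y \<subseteq> X \<Longrightarrow> u \<in> Y \<Longrightarrow> v \<in> Y \<Longrightarrow> full_pair Y c k u v"
  by (auto simp: full_pair_def)

lemma triple_in_nsets: "a \<in> X \<Longrightarrow> b \<in> X \<Longrightarrow> d \<in> X \<Longrightarrow> a \<noteq> b \<Longrightarrow> a \<noteq> d \<Longrightarrow> b \<noteq> d \<Longrightarrow> {a, b, d} \<in> nsets X 3"
  by (simp add: nsets_def card_insert_if)

lemma nsets3E:
  assumes "t \<in> nsets X 3" "a \<in> t" "b \<in> t" "a \<noteq> b"
  obtains d where "t = {a, b, d}" "d \<in> X" "d \<noteq> a" "d \<noteq> b" "a \<in> X" "b \<in> X"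
proof -
  have t: "t \<subseteq> X" "card t = 3" "finite t" using assms(1) by (auto simp: nsets_def)
  have "card (t - {a, b}) = 1" using t assms by (simp add: card_Diff_subset)
  then obtain d where "t - {a, b} = {d}" by (auto simp: card_1_singleton_iff)
  then have "d \<in> t - {a, b}" by simp
  then have "d \<in> t" "d \<noteq> a" "d \<noteq> b" by auto
  moreover have "t = {a, b} \<union> (t - {a, b})" using assms by auto
  ultimately have "t = {a, b, d}" "d \<in> t" "d \<noteq> a" "d \<noteq> b" using \<open>t - {a, b} = {d}\<close> by auto
  moreover have "a \<in> X" "b \<in> X" using t assms by auto
  moreover have "d \<in> X" using t \<open>d \<in> t\<close> by auto
  ultimately show thesis using that by metis
qed

lemma Berge_emb_mono: "Berge_emb X c k V E \<phi> f \<Longrightarrow> X \<subseteq> Y \<Longrightarrow> Berge_emb Y c k V E \<phi> f"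
  using nsets_mono[of X Y 3] by (auto simp: Berge_emb_def)

lemma Berge_emb_subgraph:
  "Berge_emb X c k V E \<phi> f \<Longrightarrow> V' \<subseteq> V \<Longrightarrow> E' \<subseteq> E \<Longrightarrow> Berge_emb X c k V' E' \<phi> f"
  unfolding Berge_emb_def by (meson image_mono inj_on_subset subsetD subset_trans)

lemma inj_on_fun_upd_insert:
  "inj_on g A \<Longrightarrow> x \<notin> A \<Longrightarrow> y \<notin> g ` A \<Longrightarrow> inj_on (g(x := y)) (insert x A)"
  by (auto simp: inj_on_def)

lemma Berge_emb_insert:
  assumes emb: "Berge_emb X c k V E \<phi> f" and E: "\<And>e. e \<in> E \<Longrightarrow> e \<subseteq> V"
    and u: "u \<in> V" and x: "x \<notin> V" and v: "v \<in> X" "v \<notin> \<phi> ` V"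
    and t: "t \<in> nsets X 3" "c t = k" "\<phi> u \<in> t" "v \<in> t" "t \<notin> f ` E"
  shows "Berge_emb X c k (insert x V) (insert {u, x} E) (\<phi>(x := v)) (f({u, x} := t))"
proof -
  let ?\<phi> = "\<phi>(x := v)" and ?f = "f({u, x} := t)"
  have new: "{u, x} \<notin> E" using E x by blast
  have f: "?f e = f e" if "e \<in> E" for e using that new by auto
  have img: "?\<phi> ` e = \<phi> ` e" if "e \<in> E" for e
    using E[OF that] x by (intro image_cong) auto
  have "inj_on ?\<phi> (insert x V)"
    using emb x v(2) by (intro inj_on_fun_upd_insert) (auto simp: Berge_emb_def)
  moreover have "?\<phi> ` insert x V \<subseteq> X" using emb v(1) by (auto simp: Berge_emb_def)
  moreover have "inj_on ?f (insert {u, x} E)"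
    using emb new t(5) by (intro inj_on_fun_upd_insert) (auto simp: Berge_emb_def)
  moreover have "\<forall>e\<in>insert {u, x} E. ?f e \<in> nsets X 3 \<and> c (?f e) = k \<and> ?\<phi> ` e \<subseteq> ?f e"
  proof
    fix e assume e: "e \<in> insert {u, x} E"
    show "?f e \<in> nsets X 3 \<and> c (?f e) = k \<and> ?\<phi> ` e \<subseteq> ?f e"
    proof (cases "e = {u, x}")
      case True
      then show ?thesis using t u x by auto
    next
      case False
      then have "e \<in> E" using e by simp
      then show ?thesis using emb f[of e] img[of e] by (simp add: Berge_emb_def del: fun_upd_apply)
    qed
  qed
  ultimately show ?thesis unfolding Berge_emb_def by (intro conjI)
qed

text \<open>A triple through a vertex outside \<open>Y\<close> has not been used by a copy inside \<open>Y\<close>.\<close>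

lemma Berge_emb_add_leaf:
  assumes emb: "Berge_emb Y c k V E \<phi> f" and T: "tree_on V E" and "Y \<subseteq> X" "v \<in> X" "v \<notin> Y"
    and "u \<in> V" "x \<notin> V" and "w \<in> X" "w \<noteq> v" "w \<noteq> \<phi> u" "c {\<phi> u, v, w} = k"
  shows "Berge_emb X c k (insert x V) (insert {u, x} E) (\<phi>(x := v)) (f({u, x} := {\<phi> u, v, w}))"
proof (rule Berge_emb_insert[OF Berge_emb_mono[OF emb assms(3)]])
  have "\<phi> u \<in> Y" using emb assms(6) by (auto simp: Berge_emb_def)
  then show "{\<phi> u, v, w} \<in> nsets X 3" using assms by (intro triple_in_nsets) auto
  show "v \<notin> \<phi> ` V" using emb assms(5) by (auto simp: Berge_emb_def)
  have "v \<notin> f e" if "e \<in> E" for e using emb assms(5) that by (auto simp: Berge_emb_def nsets_def)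
  then show "{\<phi> u, v, w} \<notin> f ` E" by (metis imageE insertCI)
qed (use assms tree_on_edge_subset[OF T] in auto)

text \<open>Carries a copy found among named points to the actual ground set; the colouring is
  pulled back along the labelling \<open>h\<close>.\<close>

lemma Berge_copy_transfer:
  assumes "Berge_copy Y (\<lambda>t. c (h ` t)) k V E" "inj_on h Y" "h ` Y \<subseteq> X"
  shows "Berge_copy X c k V E"
proof -
  obtain \<phi> f where emb: "Berge_emb Y (\<lambda>t. c (h ` t)) k V E \<phi> f" using assms(1) by (auto simp: Berge_copy_def)
  have sub: "f e \<subseteq> Y" if "e \<in> E" for e using emb that by (auto simp: Berge_emb_def nsets_def)
  have "inj_on (h \<circ> \<phi>) V"
    using emb assms(2) by (auto simp: Berge_emb_def intro!: comp_inj_on intro: inj_on_subset)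
  moreover have "(h \<circ> \<phi>) ` V \<subseteq> X" using emb assms(3) by (auto simp: Berge_emb_def)
  moreover have "inj_on (\<lambda>e. h ` f e) E"
  proof (rule inj_onI)
    fix e e' assume e: "e \<in> E" "e' \<in> E" "h ` f e = h ` f e'"
    then have "f e = f e'" using inj_on_image_eq_iff[OF assms(2) sub sub] by blast
    then show "e = e'" using emb e by (auto simp: Berge_emb_def dest: inj_onD)
  qed
  moreover have "\<forall>e\<in>E. h ` f e \<in> nsets X 3 \<and> c (h ` f e) = k \<and> (h \<circ> \<phi>) ` e \<subseteq> h ` f e"
  proof
    fix e assume e: "e \<in> E"
    have "card (h ` f e) = card (f e)" using card_image[OF inj_on_subset[OF assms(2) sub[OF e]]] .
    moreover have fe: "f e \<in> nsets Y 3" "c (h ` f e) = k" "\<phi> ` e \<subseteq> f e" using emb e by (auto simp: Berge_emb_def)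
    moreover have "h ` f e \<subseteq> X" using sub[OF e] assms(3) by blast
    ultimately have "h ` f e \<in> nsets X 3" by (simp add: nsets_def)
    moreover have "(h \<circ> \<phi>) ` e \<subseteq> h ` f e" using fe(3) by auto
    ultimately show "h ` f e \<in> nsets X 3 \<and> c (h ` f e) = k \<and> (h \<circ> \<phi>) ` e \<subseteq> h ` f e" using fe(2) by simp
  qed
  ultimately have "Berge_emb X c k V E (h \<circ> \<phi>) (\<lambda>e. h ` f e)"
    unfolding Berge_emb_def by (intro conjI)
  then show ?thesis unfolding Berge_copy_def by (intro exI)
qed

section \<open>Small cases by exhaustive search\<close>

text \<open>The tree is given by the list of positions to which successive leaves are attached.\<close>

inductive grow :: "'a list \<Rightarrow> 'a set set \<Rightarrow> nat list \<Rightarrow> 'a list \<Rightarrow> 'a set set \<Rightarrow> bool" where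
  grow_Nil: "grow xs E [] xs E"
| grow_Cons: "p < length xs \<Longrightarrow> y \<notin> set xs \<Longrightarrow> grow (xs @ [y]) (insert {xs ! p, y} E) ps ys E' \<Longrightarrow>
    grow xs E (p # ps) ys E'"

lemma grow_snoc:
  "grow xs E ps ys E' \<Longrightarrow> p < length ys \<Longrightarrow> y \<notin> set ys \<Longrightarrow> grow xs E (ps @ [p]) (ys @ [y]) (insert {ys ! p, y} E')"
  by (induction rule: grow.induct) (auto intro: grow.intros)

lemma grow_prefix: "grow xs E ps ys E' \<Longrightarrow> \<exists>zs. ys = xs @ zs \<and> length zs = length ps"
  by (induction rule: grow.induct) auto

text \<open>There are \<open>m!\<close> such lists, 24 for five vertices and 120 for six. Isomorphic
  trees occur repeatedly, so no isomorphism argument is involved.\<close>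

fun parent_lists :: "nat \<Rightarrow> nat list list" where
  "parent_lists 0 = [[]]"
| "parent_lists (Suc m) = concat (map (\<lambda>ps. map (\<lambda>p. ps @ [p]) [0..<Suc m]) (parent_lists m))"

lemma tree_on_grow:
  assumes "tree_on V E"
  shows "\<exists>x ps ys. grow [x] {} ps ys E \<and> set ys = V \<and> ps \<in> set (parent_lists (card V - 1))"
  using assms
proof (induction rule: tree_on.induct)
  case (single x)
  then show ?case using grow_Nil[of "[x]" "{}"] by (intro exI[of _ x] exI[of _ "[]"] exI[of _ "[x]"]) auto
next
  case (leaf V E u y)
  then obtain x ps ys where g: "grow [x] {} ps ys E" "set ys = V" "ps \<in> set (parent_lists (card V - 1))" by blast
  obtain p where p: "p < length ys" "ys ! p = u" using g leaf.hyps(2) by (metis in_set_conv_nth)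
  have fin: "finite V" "card V \<noteq> 0" using tree_on_finite[OF leaf.hyps(1)] by auto
  have "length qs = m" if "qs \<in> set (parent_lists m)" for qs m
    using that by (induction m arbitrary: qs) auto
  then have "length ps = card V - 1" using g(3) by blast
  then have "p < Suc (card V - 1)" using grow_prefix[OF g(1)] p(1) by auto
  then have "ps @ [p] \<in> set (parent_lists (Suc (card V - 1)))"
    using g(3) by (force simp del: upt_Suc)
  moreover have "card (insert y V) - 1 = Suc (card V - 1)" using fin leaf.hyps(3) by (cases "card V") simp_all
  moreover have "grow [x] {} (ps @ [p]) (ys @ [y]) (insert {u, y} E)"
    using grow_snoc[OF g(1) p(1), of y] g(2) leaf.hyps(3) p(2) by simp
  moreover have "set (ys @ [y]) = insert y V" using g(2) by simp
  ultimately show ?case by (metis (no_types))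
qed

text \<open>Growth starts at the centre, so the all-zero list represents every star. If the vertex
  attached last is the centre, the smaller tree is a single vertex, and the two vertices are listed
  in reverse order.\<close>

lemma star_grow:
  assumes "tree_on V E" "\<forall>e\<in>E. s \<in> e" "s \<in> V"
  shows "\<exists>ys. grow [s] {} (replicate (card V - 1) 0) ys E \<and> set ys = V"
  using assms
proof (induction rule: tree_on.induct)
  case (single x)
  then show ?case using grow_Nil[of "[s]" "{}"] by (intro exI[of _ "[s]"]) simp
next
  case (leaf V E u y)
  have fin: "finite V" "card V \<noteq> 0" using tree_on_finite[OF leaf.hyps(1)] by auto
  show ?case
  proof (cases "s = y")
    case True
    have "E = {}" using leaf.prems(1) True tree_on_edge_subset[OF leaf.hyps(1)] leaf.hyps(3) by blast
    moreover have "V = {u}"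
    proof (rule ccontr)
      assume "V \<noteq> {u}"
      then have "\<not> card V < 2" using tree_on_card_1[OF leaf.hyps(1) _ leaf.hyps(2)] by blast
      then have "card V \<ge> 2" by simp
      then have "deg E u \<ge> 1" using deg_pos[OF leaf.hyps(1) _ leaf.hyps(2)] by blast
      then show False using \<open>E = {}\<close> by simp
    qed
    moreover have "grow [y] {} [0] ([y] @ [u]) (insert {[y] ! 0, u} {})"
      by (rule grow_Cons) (use leaf.hyps in \<open>auto intro: grow_Nil\<close>)
    ultimately show ?thesis using True leaf.hyps
      by (intro exI[of _ "[y, u]"]) (auto simp: insert_commute)
  next
    case False
    then have sV: "s \<in> V" and us: "u = s" using leaf.prems by auto
    obtain ys where ys: "grow [s] {} (replicate (card V - 1) 0) ys E" "set ys = V"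
      using leaf.IH sV leaf.prems(1) by auto
    obtain zs where "ys = [s] @ zs" using grow_prefix[OF ys(1)] by blast
    then have "0 < length ys" "ys ! 0 = u" using us by auto
    then have "grow [s] {} (replicate (card V - 1) 0 @ [0]) (ys @ [y]) (insert {u, y} E)"
      using grow_snoc[OF ys(1), of 0 y] ys(2) leaf.hyps(3) by simp
    moreover have "replicate (card V - 1) (0::nat) @ [0] = replicate (card (insert y V) - 1) 0"
      using fin leaf.hyps(3) by (metis Suc_pred' card_insert_disjoint diff_Suc_1 neq0_conv replicate_Suc replicate_append_same)
    ultimately show ?thesis using ys(2) by (intro exI[of _ "ys @ [y]"]) simp
  qed
qed

text \<open>Conditionals rather than connectives, since the simplifier then evaluates lazily.\<close>

fun any :: "('a \<Rightarrow> bool) \<Rightarrow> 'a list \<Rightarrow> bool" where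
  "any P [] = False"
| "any P (x # xs) = (if P x then True else any P xs)"

lemma any_iff: "any P xs \<longleftrightarrow> (\<exists>x\<in>set xs. P x)"
  by (induction xs) auto

text \<open>Backtracking over embeddings: \<open>zs\<close> lists the images chosen so far and
  \<open>R\<close> the triples still available.\<close>

fun search :: "'a list \<Rightarrow> nat list \<Rightarrow> 'a list list \<Rightarrow> bool" where
  "search zs [] R = True"
| "search zs (p # ps) R = any (\<lambda>t. if any ((=) (zs ! p)) t then
     any (\<lambda>v. if any ((=) v) zs then False else search (zs @ [v]) ps (remove1 t R)) t else False) R"

text \<open>The invariant is that no triple left in \<open>R\<close> has been used. Distinctness is
  required of the underlying sets, since \<open>remove1\<close> deletes a list whereas a Berge copy
  must not repeat a set.\<close>

lemma search_sound:
  assumes "grow xs E ps ys E'" "Berge_emb X c k (set xs) E \<phi> f" "\<And>e. e \<in> E \<Longrightarrow> e \<subseteq> set xs"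
    "search (map \<phi> xs) ps R" "distinct (map set R)"
    "\<And>t. t \<in> set R \<Longrightarrow> set t \<in> nsets X 3 \<and> c (set t) = k \<and> set t \<notin> f ` E"
  shows "Berge_copy X c k (set ys) E'"
  using assms
proof (induction arbitrary: \<phi> f R rule: grow.induct)
  case (grow_Nil xs E)
  then show ?case by (auto simp: Berge_copy_def)
next
  case (grow_Cons p xs y E ps ys E')
  have "map \<phi> xs ! p = \<phi> (xs ! p)" using grow_Cons.hyps by simp
  then obtain t v where t: "t \<in> set R" "\<phi> (xs ! p) \<in> set t" "v \<in> set t" "v \<notin> set (map \<phi> xs)"
    and s: "search (map \<phi> xs @ [v]) ps (remove1 t R)"
    using grow_Cons.prems(3) by (auto simp: any_iff split: if_splits)
  let ?\<phi> = "\<phi>(y := v)" and ?f = "f({xs ! p, y} := set t)"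
  have tX: "set t \<in> nsets X 3" "c (set t) = k" "set t \<notin> f ` E" using grow_Cons.prems(5) t by auto
  have "v \<in> X" using tX(1) t(3) by (auto simp: nsets_def)
  then have emb: "Berge_emb X c k (insert y (set xs)) (insert {xs ! p, y} E) ?\<phi> ?f"
    using grow_Cons.hyps grow_Cons.prems(2) t tX
    by (intro Berge_emb_insert[OF grow_Cons.prems(1)]) auto
  have new: "{xs ! p, y} \<notin> E" using grow_Cons.hyps grow_Cons.prems(2) by blast
  show ?case
  proof (rule grow_Cons.IH[of ?\<phi> ?f "remove1 t R"])
    show "Berge_emb X c k (set (xs @ [y])) (insert {xs ! p, y} E) ?\<phi> ?f" using emb by simp
    show "e \<subseteq> set (xs @ [y])" if "e \<in> insert {xs ! p, y} E" for e
      using that grow_Cons.prems(2) grow_Cons.hyps by fastforce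
    have "map ?\<phi> (xs @ [y]) = map \<phi> xs @ [v]" using grow_Cons.hyps by auto
    then show "search (map ?\<phi> (xs @ [y])) ps (remove1 t R)" using s by (simp only:)
    have d: "distinct R" "inj_on set (set R)" using grow_Cons.prems(4) by (auto simp: distinct_map)
    show "distinct (map set (remove1 t R))"
      using d by (auto simp: distinct_map set_remove1_eq intro: inj_on_subset)
    show "set t' \<in> nsets X 3 \<and> c (set t') = k \<and> set t' \<notin> ?f ` insert {xs ! p, y} E" if t': "t' \<in> set (remove1 t R)" for t'
    proof -
      have "t' \<in> set R" "t' \<noteq> t" using t' d(1) by auto
      then have "set t' \<noteq> set t" using d(2) t(1) by (auto dest: inj_onD)
      moreover have "?f ` E = f ` E" using new by (intro image_cong) auto
      then have "?f ` insert {xs ! p, y} E = insert (set t) (f ` E)" by (simp only: image_insert fun_upd_same)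
      ultimately show ?thesis using grow_Cons.prems(5)[OF \<open>t' \<in> set R\<close>] by simp
    qed
  qed
qed

lemma search_Berge_copy:
  assumes "grow [x] {} ps ys E" "search [z] ps R" "z \<in> X" "distinct (map set R)"
    "\<And>t. t \<in> set R \<Longrightarrow> set t \<in> nsets X 3 \<and> c (set t) = k"
  shows "Berge_copy X c k (set ys) E"
proof (rule search_sound[OF assms(1)])
  show "Berge_emb X c k (set [x]) {} (\<lambda>_. z) (\<lambda>_. {})" using assms(3) by (simp add: Berge_emb_def)
qed (use assms in auto)

section \<open>Configurations on four, five and six points\<close>

datatype pt = P0 | P1 | P2 | P3 | P4 | P5

fun sublists :: "nat \<Rightarrow> 'a list \<Rightarrow> 'a list list" where
  "sublists 0 xs = [[]]"
| "sublists (Suc m) [] = []"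
| "sublists (Suc m) (x # xs) = map ((#) x) (sublists m xs) @ sublists (Suc m) xs"

text \<open>A colour class may be cut down to exactly \<open>m\<close> triples, so only the sublists
  of length \<open>m\<close> have to be searched.\<close>

lemma take_filter_sublists:
  "m \<le> length (filter P xs) \<Longrightarrow> take m (filter P xs) \<in> set (sublists m xs)"
proof (induction xs arbitrary: m)
  case Nil
  then show ?case by simp
next
  case (Cons x xs)
  then show ?case
  proof (cases m)
    case 0
    then show ?thesis by simp
  next
    case (Suc m')
    then show ?thesis using Cons.IH[of m'] Cons.IH[of m] Cons.prems by (cases "P x") auto
  qed
qed

lemma filter_subseqs: "filter P xs \<in> set (subseqs xs)"
  by (induction xs) (auto simp: Let_def)

definition triples5 :: "pt list list" where
  "triples5 = [[P0,P1,P2],[P0,P1,P3],[P0,P1,P4],[P0,P2,P3],[P0,P2,P4],[P0,P3,P4],[P1,P2,P3],[P1,P2,P4],[P1,P3,P4],[P2,P3,P4]]"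

text \<open>The two excluded lists are those that grow a star: its centre is placed first or second,
  since the third vertex already gives one of these two degree 2.\<close>

definition nonstars5 :: "nat list list" where
  "nonstars5 = filter (\<lambda>ps. ps \<noteq> [0,0,0,0] \<and> ps \<noteq> [0,1,1,1]) (parent_lists 4)"

lemma nonstars5_eq: "nonstars5 =
  [[0,0,0,1],[0,0,0,2],[0,0,0,3],[0,0,1,0],[0,0,1,1],[0,0,1,2],[0,0,1,3],[0,0,2,0],[0,0,2,1],[0,0,2,2],[0,0,2,3],
   [0,1,0,0],[0,1,0,1],[0,1,0,2],[0,1,0,3],[0,1,1,0],[0,1,1,2],[0,1,1,3],[0,1,2,0],[0,1,2,1],[0,1,2,2],[0,1,2,3]]"
  by (simp add: nonstars5_def numeral_eq_Suc upt_rec)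

text \<open>For trees that are not stars, \<open>m = 5\<close> is the right value: one of the two
  colours always has five of the ten triples.\<close>

definition search5 :: "nat \<Rightarrow> nat list \<Rightarrow> bool" where
  "search5 m ps \<longleftrightarrow> list_all (\<lambda>R. any (\<lambda>x. search [x] ps R) [P0,P1,P2,P3,P4]) (sublists m triples5)"

lemma search5_a: "list_all (search5 (Suc (Suc (Suc (Suc (Suc 0))))))
  [[0,0,0,Suc 0],[0,0,0,Suc (Suc 0)],[0,0,0,Suc (Suc (Suc 0))],[0,0,Suc 0,0],[0,0,Suc 0,Suc 0],[0,0,Suc 0,Suc (Suc 0)]]"
  by code_simp

lemma search5_b: "list_all (search5 (Suc (Suc (Suc (Suc (Suc 0))))))
  [[0,0,Suc 0,Suc (Suc (Suc 0))],[0,0,Suc (Suc 0),0],[0,0,Suc (Suc 0),Suc 0],[0,0,Suc (Suc 0),Suc (Suc 0)],[0,0,Suc (Suc 0),Suc (Suc (Suc 0))]]"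
  by code_simp

lemma search5_c: "list_all (search5 (Suc (Suc (Suc (Suc (Suc 0))))))
  [[0,Suc 0,0,0],[0,Suc 0,0,Suc 0],[0,Suc 0,0,Suc (Suc 0)],[0,Suc 0,0,Suc (Suc (Suc 0))],[0,Suc 0,Suc 0,0],[0,Suc 0,Suc 0,Suc (Suc 0)]]"
  by code_simp

lemma search5_d: "list_all (search5 (Suc (Suc (Suc (Suc (Suc 0))))))
  [[0,Suc 0,Suc 0,Suc (Suc (Suc 0))],[0,Suc 0,Suc (Suc 0),0],[0,Suc 0,Suc (Suc 0),Suc 0],[0,Suc 0,Suc (Suc 0),Suc (Suc 0)],[0,Suc 0,Suc (Suc 0),Suc (Suc (Suc 0))]]"
  by code_simp

lemma search5_nonstar: "ps \<in> set nonstars5 \<Longrightarrow> search5 5 ps"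
  using search5_a search5_b search5_c search5_d
  unfolding nonstars5_eq by (auto simp: numeral_eq_Suc)

text \<open>Six triples have eighteen incidences, so one of the five points lies in four of them.
  These give four edges on the other four points, which form a connected graph with one cycle, so
  each point can be assigned its own edge. Five triples do not suffice.\<close>

lemma search5_star: "search5 (Suc (Suc (Suc (Suc (Suc (Suc 0)))))) [0,0,0,0]"
  by code_simp

text \<open>These are the three triples through \<open>P0\<close>; all of them get used, as a tree
  on four vertices has three edges.\<close>

lemma search_path4: "list_all (\<lambda>ps. any (\<lambda>x. search [x] ps [[P0,P1,P2],[P0,P1,P3],[P0,P2,P3]]) [P0,P1,P2,P3])
    (parent_lists (Suc (Suc (Suc 0))))"
  by code_simp

text \<open>The seven triples on six points that contain \<open>{P0, P1}\<close> or
  \<open>{P0, P2}\<close>, as supplied by two full pairs meeting in \<open>P0\<close>.\<close>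

definition cherry_triples :: "pt list list" where
  "cherry_triples = [[P0,P1,P2],[P0,P1,P3],[P0,P1,P4],[P0,P1,P5],[P0,P2,P3],[P0,P2,P4],[P0,P2,P5]]"

lemma search_cherry6: "list_all (\<lambda>ps. any (\<lambda>x. search [x] ps cherry_triples) [P0,P1,P2,P3,P4,P5])
    (parent_lists (Suc (Suc (Suc (Suc (Suc 0))))))"
  by code_simp

text \<open>The ten triples through \<open>P0\<close>, to be read as the edges of the complete graph
  on the other five points.\<close>

definition link6 :: "pt list list" where
  "link6 = [[P0,P1,P2],[P0,P1,P3],[P0,P1,P4],[P0,P1,P5],[P0,P2,P3],[P0,P2,P4],[P0,P2,P5],[P0,P3,P4],[P0,P3,P5],[P0,P4,P5]]"

fun every :: "('a \<Rightarrow> bool) \<Rightarrow> 'a list \<Rightarrow> bool" where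
  "every P [] = True"
| "every P (x # xs) = (if P x then every P xs else False)"

lemma every_iff: "every P xs \<longleftrightarrow> (\<forall>x\<in>set xs. P x)"
  by (induction xs) auto

fun at_least :: "nat \<Rightarrow> 'a list \<Rightarrow> bool" where
  "at_least 0 xs = True"
| "at_least (Suc m) [] = False"
| "at_least (Suc m) (x # xs) = at_least m xs"

lemma at_least_iff: "at_least m xs \<longleftrightarrow> m \<le> length xs"
  by (induction m xs rule: at_least.induct) auto

text \<open>A graph on five points with at least five edges and no isolated point is connected,
  because components of sizes 2 and 3 have at most four edges together. So it contains a cycle, and
  every point can be given its own incident edge, which is a Berge star centred at
  \<open>P0\<close>.\<close>

lemma search_link6: "list_all (\<lambda>R. if at_least (Suc (Suc (Suc (Suc (Suc 0))))) R
    then if every (\<lambda>v. any (any ((=) v)) R) [P1,P2,P3,P4,P5] then search [P0] [0,0,0,0,0] R else True else True)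
  (subseqs link6)"
  by code_simp

lemma ex_distinct_list_card:
  assumes "finite X"
  shows "\<exists>xs. distinct xs \<and> set xs = X \<and> length xs = card X"
  using finite_distinct_list[OF assms] distinct_card by metis

lemma grow_star:
  assumes "grow xs E (replicate m p) ys E'" "p < length xs" "\<forall>e\<in>E. xs ! p \<in> e"
  shows "is_star (set ys) E'"
  using assms
proof (induction m arbitrary: xs E)
  case 0
  then have "ys = xs" "E' = E" by (auto elim: grow.cases)
  then show ?case using 0 unfolding is_star_def by (metis nth_mem)
next
  case (Suc m)
  from Suc.prems(1) obtain y where y: "grow (xs @ [y]) (insert {xs ! p, y} E) (replicate m p) ys E'"
    by (auto elim: grow.cases)
  show ?case
  proof (rule Suc.IH[OF y])
    show "p < length (xs @ [y])" using Suc.prems(2) by simp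
    have "(xs @ [y]) ! p = xs ! p" using Suc.prems(2) by (simp add: nth_append)
    then show "\<forall>e\<in>insert {xs ! p, y} E. (xs @ [y]) ! p \<in> e" using Suc.prems(3) by simp
  qed
qed

lemma nonstar5_grow:
  assumes "tree_on V E" "card V = 5" "\<not> is_star V E"
  shows "\<exists>x ps ys. grow [x] {} ps ys E \<and> set ys = V \<and> ps \<in> set nonstars5"
proof -
  obtain x ps ys where g: "grow [x] {} ps ys E" "set ys = V" "ps \<in> set (parent_lists 4)"
    using tree_on_grow[OF assms(1)] assms(2) by auto
  have "ps \<noteq> [0,0,0,0]"
  proof
    assume "ps = [0,0,0,0]"
    then have "grow [x] {} (replicate 4 0) ys E" using g(1) by (simp add: numeral_eq_Suc)
    then have "is_star (set ys) E" by (rule grow_star) auto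
    then show False using assms(3) g(2) by simp
  qed
  moreover have "ps \<noteq> [0,1,1,1]"
  proof
    assume "ps = [0,1,1,1]"
    then obtain y where "grow ([x] @ [y]) {{x, y}} [1,1,1] ys E" using g(1) by (auto elim: grow.cases)
    then have "grow ([x] @ [y]) {{x, y}} (replicate 3 1) ys E" by (simp add: numeral_eq_Suc)
    then have "is_star (set ys) E" by (rule grow_star) auto
    then show False using assms(3) g(2) by simp
  qed
  ultimately show ?thesis using g unfolding nonstars5_def by auto
qed

lemma triples5_nsets: "t \<in> set triples5 \<Longrightarrow> set t \<in> nsets {P0, P1, P2, P3, P4} 3"
  by (auto simp: triples5_def nsets_def)

lemma distinct_triples5: "distinct (map set triples5)"
  by (simp add: triples5_def set_eq_iff) auto

lemma distinct_map_take_filter: "distinct (map g xs) \<Longrightarrow> distinct (map g (take m (filter P xs)))"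
  by (metis distinct_map_filter distinct_take take_map)

lemma search5_Berge_copy:
  assumes h: "inj_on h {P0, P1, P2, P3, P4}" "h ` {P0, P1, P2, P3, P4} \<subseteq> X"
    and g: "grow [x] {} ps ys E" "search5 m ps" "m \<le> length (filter (\<lambda>t. c (h ` set t) = k) triples5)"
  shows "Berge_copy X c k (set ys) E"
proof (rule Berge_copy_transfer[OF _ h])
  let ?R = "take m (filter (\<lambda>t. c (h ` set t) = k) triples5)"
  have "?R \<in> set (sublists m triples5)" by (rule take_filter_sublists[OF g(3)])
  then have "any (\<lambda>x. search [x] ps ?R) [P0, P1, P2, P3, P4]"
    using g(2) unfolding search5_def list_all_iff by blast
  then obtain z where z: "z \<in> {P0, P1, P2, P3, P4}" "search [z] ps ?R" by (auto simp: any_iff)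
  show "Berge_copy {P0, P1, P2, P3, P4} (\<lambda>t. c (h ` t)) k (set ys) E"
  proof (rule search_Berge_copy[OF g(1) z(2,1)])
    show "distinct (map set ?R)" by (rule distinct_map_take_filter[OF distinct_triples5])
    show "set t \<in> nsets {P0, P1, P2, P3, P4} 3 \<and> c (h ` set t) = k" if "t \<in> set ?R" for t
      using in_set_takeD[OF that] triples5_nsets by auto
  qed
qed

fun pt_map :: "'a list \<Rightarrow> pt \<Rightarrow> 'a" where
  "pt_map xs P0 = xs ! 0"
| "pt_map xs P1 = xs ! 1"
| "pt_map xs P2 = xs ! 2"
| "pt_map xs P3 = xs ! 3"
| "pt_map xs P4 = xs ! 4"
| "pt_map xs P5 = xs ! 5"

text \<open>Five triples in colour \<open>opp k\<close> are enough for the second tree, as it is not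
  a star; otherwise colour \<open>k\<close> has at least six of the ten triples, and these are
  enough for every tree.\<close>

lemma five_vertices_nonstar:
  fixes X :: "'a set" and V1 V2 :: "'b set"
  assumes X: "card X = 5" and T1: "tree_on V1 E1" "card V1 = 5" and T2: "tree_on V2 E2" "card V2 = 5"
    and ns: "\<not> is_star V2 E2"
  shows "Berge_copy X c k V1 E1 \<or> Berge_copy X c (opp k) V2 E2"
proof -
  have "finite X" using X card.infinite by fastforce
  then obtain xs where xs: "distinct xs" "set xs = X" "length xs = 5" using ex_distinct_list_card X by metis
  then obtain a b d e f where xs5: "xs = [a, b, d, e, f]" by (auto simp: numeral_eq_Suc length_Suc_conv)
  have h: "inj_on (pt_map xs) {P0, P1, P2, P3, P4}" "pt_map xs ` {P0, P1, P2, P3, P4} \<subseteq> X"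
    using xs unfolding xs5 by (auto simp: inj_on_def)
  let ?n = "\<lambda>k. length (filter (\<lambda>t. c (pt_map xs ` set t) = k) triples5)"
  have "?n k + length (filter (\<lambda>t. \<not> c (pt_map xs ` set t) = k) triples5) = length triples5"
    by (rule sum_length_filter_compl)
  then have sum: "?n k + ?n (opp k) = 10" by (simp add: neq_colour_iff triples5_def)
  have N: "Berge_copy X c j V E" if T: "tree_on V E" "card V = 5" "\<not> is_star V E" and j: "5 \<le> ?n j" for V :: "'b set" and E j
  proof -
    obtain x ps ys where g: "grow [x] {} ps ys E" "set ys = V" "ps \<in> set nonstars5"
      using nonstar5_grow[OF T] by blast
    show ?thesis using search5_Berge_copy[OF h g(1) search5_nonstar[OF g(3)] j] g(2) by simp
  qed
  show ?thesis
  proof (cases "5 \<le> ?n (opp k)")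
    case True
    then show ?thesis using N[OF T2 ns] by blast
  next
    case False
    then have n6: "6 \<le> ?n k" using sum by linarith
    show ?thesis
    proof (cases "is_star V1 E1")
      case True
      then obtain s where s: "s \<in> V1" "\<forall>e\<in>E1. s \<in> e" by (auto simp: is_star_def)
      obtain ys where "grow [s] {} (replicate 4 0) ys E1" and ys: "set ys = V1"
        using star_grow[OF T1(1) s(2,1)] T1(2) by auto
      then have g: "grow [s] {} [0,0,0,0] ys E1" by (simp add: numeral_eq_Suc)
      have "search5 6 [0,0,0,0]" using search5_star by (simp add: numeral_eq_Suc)
      then show ?thesis using search5_Berge_copy[OF h g _ n6] ys by simp
    next
      case False
      then show ?thesis using N[OF T1 False] n6 by simp
    qed
  qed
qed

lemma five_vertices:
  fixes X :: "'a set" and V1 V2 :: "'b set"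
  assumes "card X = 5" "tree_on V1 E1" "card V1 = 5" "tree_on V2 E2" "card V2 = 5"
    "\<not> (is_star V1 E1 \<and> is_star V2 E2)"
  shows "Berge_copy X c k V1 E1 \<or> Berge_copy X c (opp k) V2 E2"
proof (cases "is_star V2 E2")
  case True
  then show ?thesis using five_vertices_nonstar[of X V2 E2 V1 E1 c "opp k"] assms by auto
qed (use five_vertices_nonstar assms in blast)

text \<open>Some vertex \<open>s\<close> lies only in triples of colour \<open>k\<close>. If
  \<open>t0\<close> is a triple of the other colour, let \<open>s\<close> be the fourth vertex: a
  vertex of \<open>t0\<close> cannot have its full partner in \<open>t0\<close>, so the partner is
  \<open>s\<close>.\<close>

lemma four_vertices:
  assumes Y: "card Y = 4" and full: "\<And>v. v \<in> Y \<Longrightarrow> \<exists>u. full_pair Y c k v u"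
    and T: "tree_on V E" "card V = 4"
  shows "Berge_copy Y c k V E"
proof -
  have fin: "finite Y" using Y card.infinite by fastforce
  have "\<exists>s\<in>Y. \<forall>t\<in>nsets Y 3. s \<in> t \<longrightarrow> c t = k"
  proof (cases "\<forall>t\<in>nsets Y 3. c t = k")
    case True
    have "Y \<noteq> {}" using Y by auto
    then show ?thesis using True by blast
  next
    case False
    then obtain t0 where t0: "t0 \<in> nsets Y 3" "c t0 \<noteq> k" by blast
    have sub: "t0 \<subseteq> Y" "card t0 = 3" "finite t0" using t0(1) by (auto simp: nsets_def)
    then have "card (Y - t0) = 1" using Y by (simp add: card_Diff_subset)
    then obtain s where s: "Y - t0 = {s}" by (auto simp: card_1_singleton_iff)
    have "c t = k" if t: "t \<in> nsets Y 3" "s \<in> t" for t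
    proof -
      have "t \<noteq> {s}" using t by (auto simp: nsets_def)
      then obtain a where a: "a \<in> t" "a \<noteq> s" using t(2) by blast
      have aY: "a \<in> Y" using t(1) a(1) by (auto simp: nsets_def)
      then have at0: "a \<in> t0" using s a(2) by blast
      obtain u where u: "full_pair Y c k a u" using full[OF aY] by blast
      have "u = s"
      proof (rule ccontr)
        assume "u \<noteq> s"
        then have "u \<in> t0" using u s by (auto simp: full_pair_def)
        moreover have "a \<noteq> u" using u by (simp add: full_pair_def)
        ultimately obtain w where "t0 = {a, u, w}" "w \<in> Y" "w \<noteq> a" "w \<noteq> u"
          using nsets3E[OF t0(1) at0] by metis
        then show False using u t0(2) by (auto simp: full_pair_def)
      qed
      obtain w where "t = {a, s, w}" "w \<in> Y" "w \<noteq> a" "w \<noteq> s" using nsets3E[OF t(1) a(1) t(2) a(2)] by metis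
      then show "c t = k" using u \<open>u = s\<close> by (auto simp: full_pair_def)
    qed
    moreover have "s \<in> Y" using s by blast
    ultimately show ?thesis by blast
  qed
  then obtain s where s: "s \<in> Y" "\<And>t. t \<in> nsets Y 3 \<Longrightarrow> s \<in> t \<Longrightarrow> c t = k" by blast
  obtain xs where xs: "distinct xs" "set xs = Y - {s}" "length xs = card (Y - {s})"
    using ex_distinct_list_card[of "Y - {s}"] fin by auto
  moreover have "card (Y - {s}) = 3" using Y s(1) fin by simp
  ultimately obtain a b d where abd: "xs = [a, b, d]" by (auto simp: numeral_eq_Suc length_Suc_conv)
  have Yeq: "Y = {s, a, b, d}" and dist: "distinct [s, a, b, d]" using xs s(1) unfolding abd by auto
  let ?h = "pt_map [s, a, b, d]"
  let ?R = "[[P0,P1,P2],[P0,P1,P3],[P0,P2,P3]]"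
  have h: "inj_on ?h {P0, P1, P2, P3}" "?h ` {P0, P1, P2, P3} \<subseteq> Y"
    using dist Yeq by (auto simp: inj_on_def)
  obtain x ps ys where g: "grow [x] {} ps ys E" "set ys = V" "ps \<in> set (parent_lists 3)"
    using tree_on_grow[OF T(1)] T(2) by auto
  have "any (\<lambda>x. search [x] ps ?R) [P0, P1, P2, P3]"
    using search_path4 g(3) unfolding list_all_iff by (simp only: numeral_3_eq_3)
  then obtain z where z: "z \<in> {P0, P1, P2, P3}" "search [z] ps ?R" by (auto simp: any_iff)
  have "Berge_copy {P0, P1, P2, P3} (\<lambda>t. c (?h ` t)) k (set ys) E"
  proof (rule search_Berge_copy[OF g(1) z(2,1)])
    show "distinct (map set ?R)" by (simp add: set_eq_iff) auto
    show "set t \<in> nsets {P0, P1, P2, P3} 3 \<and> c (?h ` set t) = k" if t: "t \<in> set ?R" for t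
    proof -
      have "?h ` set t \<in> nsets Y 3" "s \<in> ?h ` set t" using t dist Yeq by (auto simp: nsets_def)
      then have "c (?h ` set t) = k" by (rule s(2))
      moreover have "set t \<in> nsets {P0, P1, P2, P3} 3" using t by (auto simp: nsets_def)
      ultimately show ?thesis by blast
    qed
  qed
  then show ?thesis using Berge_copy_transfer[OF _ h] g(2) by blast
qed

text \<open>Serves the case where both covered sets have three vertices, fewer than
  \<open>full_cover_universal\<close> requires.\<close>

lemma six_vertices_cherry:
  assumes X: "card X = 6" and full: "full_pair X c k m l" "full_pair X c k m l'" "l \<noteq> l'"
    and T: "tree_on V E" "card V = 6"
  shows "Berge_copy X c k V E"
proof -
  have fin: "finite X" using X card.infinite by fastforce
  have mem: "m \<in> X" "l \<in> X" "l' \<in> X" "m \<noteq> l" "m \<noteq> l'" using full by (auto simp: full_pair_def)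
  obtain xs where xs: "distinct xs" "set xs = X - {m, l, l'}" "length xs = card (X - {m, l, l'})"
    using ex_distinct_list_card[of "X - {m, l, l'}"] fin by auto
  moreover have "card (X - {m, l, l'}) = 3" using X mem full(3) by (simp add: card_Diff_subset)
  ultimately obtain a b d where abd: "xs = [a, b, d]" by (auto simp: numeral_eq_Suc length_Suc_conv)
  have Xeq: "X = {m, l, l', a, b, d}" and dist: "distinct [m, l, l', a, b, d]"
    using xs mem full(3) unfolding abd by auto
  let ?h = "pt_map [m, l, l', a, b, d]"
  have h: "inj_on ?h {P0, P1, P2, P3, P4, P5}" "?h ` {P0, P1, P2, P3, P4, P5} \<subseteq> X"
    using dist Xeq by (auto simp: inj_on_def)
  obtain x ps ys where g: "grow [x] {} ps ys E" "set ys = V" "ps \<in> set (parent_lists 5)"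
    using tree_on_grow[OF T(1)] T(2) by auto
  have five: "Suc (Suc (Suc (Suc (Suc 0)))) = 5" by simp
  have "any (\<lambda>x. search [x] ps cherry_triples) [P0, P1, P2, P3, P4, P5]"
    using search_cherry6 g(3) unfolding list_all_iff five by blast
  then obtain z where z: "z \<in> {P0, P1, P2, P3, P4, P5}" "search [z] ps cherry_triples" by (auto simp: any_iff)
  have "Berge_copy {P0, P1, P2, P3, P4, P5} (\<lambda>t. c (?h ` t)) k (set ys) E"
  proof (rule search_Berge_copy[OF g(1) z(2,1)])
    show "distinct (map set cherry_triples)" by (simp add: cherry_triples_def set_eq_iff) auto
    show "set t \<in> nsets {P0, P1, P2, P3, P4, P5} 3 \<and> c (?h ` set t) = k" if t: "t \<in> set cherry_triples" for t
    proof -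
      have 1: "c {m, l, w} = k" if "w \<in> {l', a, b, d}" for w
      proof -
        have "w \<in> X - {m, l}" using that dist Xeq by auto
        then show ?thesis using full(1) unfolding full_pair_def by blast
      qed
      have 2: "c {m, l', w} = k" if "w \<in> {l, a, b, d}" for w
      proof -
        have "w \<in> X - {m, l'}" using that dist Xeq by auto
        then show ?thesis using full(2) unfolding full_pair_def by blast
      qed
      have "\<forall>t\<in>set cherry_triples. c (?h ` set t) = k" by (simp add: cherry_triples_def 1 2)
      then have "c (?h ` set t) = k" using t by blast
      moreover have "set t \<in> nsets {P0, P1, P2, P3, P4, P5} 3" using t by (auto simp: cherry_triples_def nsets_def)
      ultimately show ?thesis by blast
    qed
  qed
  then show ?thesis using Berge_copy_transfer[OF _ h] g(2) by blast
qed

text \<open>Deleting leaves from two stars would lead to the false five-vertex statement, so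
  \<open>z\<close> is treated through its link. One colour has five of the ten triples through
  \<open>z\<close>. If these reach all other points, the star wanted in that colour is centred at
  \<open>z\<close>; a point they miss forms with \<open>z\<close> a full pair of the other
  colour.\<close>

lemma six_vertices_stars:
  fixes X :: "'a set" and V1 V2 :: "'b set"
  assumes X: "card X = 6" "z \<in> X"
    and T1: "tree_on V1 E1" "card V1 = 6" "is_star V1 E1" and T2: "tree_on V2 E2" "card V2 = 6" "is_star V2 E2"
  shows "Berge_copy X c k V1 E1 \<or> Berge_copy X c (opp k) V2 E2 \<or>
    (\<exists>u. full_pair X c k z u \<or> full_pair X c (opp k) z u)"
proof -
  have fin: "finite X" using X card.infinite by fastforce
  obtain xs where xs: "distinct xs" "set xs = X - {z}" "length xs = card (X - {z})"
    using ex_distinct_list_card[of "X - {z}"] fin by auto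
  moreover have "card (X - {z}) = 5" using X by simp
  ultimately obtain a b d e f where xs5: "xs = [a, b, d, e, f]" by (auto simp: numeral_eq_Suc length_Suc_conv)
  have Xeq: "X = {z, a, b, d, e, f}" and dist: "distinct [z, a, b, d, e, f]"
    using xs X unfolding xs5 by auto
  let ?h = "pt_map [z, a, b, d, e, f]"
  let ?P = "{P0, P1, P2, P3, P4, P5}"
  have h: "inj_on ?h ?P" "?h ` ?P \<subseteq> X" using dist Xeq by (auto simp: inj_on_def)
  let ?R = "\<lambda>k. filter (\<lambda>t. c (?h ` set t) = k) link6"
  have dl: "distinct (map set link6)" by (simp add: link6_def set_eq_iff) auto
  have star: "Berge_copy X c j V E" if T: "tree_on V E" "card V = 6" "is_star V E"
    and j: "5 \<le> length (?R j)" "\<And>v. v \<in> {P1, P2, P3, P4, P5} \<Longrightarrow> \<exists>t\<in>set (?R j). v \<in> set t"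
    for V :: "'b set" and E j
  proof -
    obtain s where s: "s \<in> V" "\<forall>e\<in>E. s \<in> e" using T(3) by (auto simp: is_star_def)
    obtain ys where "grow [s] {} (replicate 5 0) ys E" and ys: "set ys = V"
      using star_grow[OF T(1) s(2,1)] T(2) by auto
    then have g: "grow [s] {} [0,0,0,0,0] ys E" by (simp add: numeral_eq_Suc)
    have "search [P0] [0,0,0,0,0] (?R j)"
      using search_link6 filter_subseqs[of "\<lambda>t. c (?h ` set t) = j" link6] j
      unfolding list_all_iff every_iff any_iff at_least_iff
      by (simp add: numeral_eq_Suc Ball_def del: search.simps)
    then have "Berge_copy ?P (\<lambda>t. c (?h ` t)) j (set ys) E"
    proof (rule search_Berge_copy[OF g])
      show "distinct (map set (?R j))" by (rule distinct_map_filter[OF dl])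
      show "set t \<in> nsets ?P 3 \<and> c (?h ` set t) = j" if "t \<in> set (?R j)" for t
      proof -
        have "t \<in> set link6" "c (?h ` set t) = j" using that by simp_all
        moreover have "set t \<in> nsets ?P 3" using \<open>t \<in> set link6\<close> by (auto simp: link6_def nsets_def)
        ultimately show ?thesis by blast
      qed
    qed simp
    then show ?thesis using Berge_copy_transfer[OF _ h] ys by blast
  qed
  have link: "full_pair X c (opp j) z (?h v)" if v: "v \<in> {P1, P2, P3, P4, P5}" and no: "\<not> (\<exists>t\<in>set (?R j). v \<in> set t)" for v j
  proof -
    have opp: "c (?h ` set t) = opp j" if "t \<in> set link6" "v \<in> set t" for t
      using no that neq_colour_iff by auto
    have "c {z, ?h v, w} = opp j" if w: "w \<in> X - {z, ?h v}" for w
    proof -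
      have "\<exists>v'\<in>{P1, P2, P3, P4, P5}. w = ?h v'" using w Xeq by auto
      then obtain v' where v': "v' \<in> {P1, P2, P3, P4, P5}" "w = ?h v'" by blast
      then have "v \<noteq> v'" using w by auto
      then have "{P0, v, v'} \<in> set (map set link6)" using v v'(1)
        by (cases v; cases v') (simp_all add: link6_def insert_commute)
      then have "\<exists>t\<in>set link6. set t = {P0, v, v'}" by (metis (no_types, lifting) image_iff list.set_map)
      then obtain t where t: "t \<in> set link6" "set t = {P0, v, v'}" by blast
      then have "?h ` set t = {z, ?h v, w}" using v' by auto
      then show ?thesis using opp[OF t(1)] t(2) by auto
    qed
    moreover have "?h v \<in> X" "?h v \<noteq> z" using v dist Xeq by auto
    ultimately show ?thesis using X(2) by (auto simp: full_pair_def)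
  qed
  have "length (?R k) + length (filter (\<lambda>t. \<not> c (?h ` set t) = k) link6) = length link6"
    by (rule sum_length_filter_compl)
  then have "length (?R k) + length (?R (opp k)) = 10" by (simp add: neq_colour_iff link6_def)
  then consider "5 \<le> length (?R k)" | "5 \<le> length (?R (opp k))" by linarith
  then show ?thesis
  proof cases
    case 1
    then show ?thesis using star[OF T1, of k] link[of _ k] by blast
  next
    case 2
    then show ?thesis using star[OF T2, of "opp k"] link[of _ "opp k"] by (metis opp_opp)
  qed
qed

section \<open>Full pairs\<close>

lemma full_pair_color: "full_pair X c k u v \<Longrightarrow> w \<in> X \<Longrightarrow> w \<noteq> u \<Longrightarrow> w \<noteq> v \<Longrightarrow> c {u, v, w} = k"
  by (simp add: full_pair_def)

lemma full_pair_mem: "full_pair X c k u v \<Longrightarrow> u \<in> X \<and> v \<in> X \<and> u \<noteq> v"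
  by (simp add: full_pair_def)

lemma not_full_pair:
  assumes "\<not> full_pair X c k u v" "u \<in> X" "v \<in> X" "u \<noteq> v"
  obtains w where "w \<in> X" "w \<noteq> u" "w \<noteq> v" "c {u, v, w} = opp k"
  using assms neq_colour_iff unfolding full_pair_def by blast

text \<open>Two pairs through \<open>v\<close> lie in a common triple, which would need both
  colours; if the pairs coincide, \<open>card X \<ge> 3\<close> provides the third vertex.\<close>

lemma full_pair_opp_disjoint:
  assumes "full_pair X c k v u" "full_pair X c (opp k) v u'" "card X \<ge> 3" "finite X"
  shows False
proof -
  note m = full_pair_mem[OF assms(1)] full_pair_mem[OF assms(2)]
  have ne: "k \<noteq> opp k" by (cases k) auto
  show False
  proof (cases "u = u'")
    case True
    have "card (X - {v, u}) \<noteq> 0" using m assms(3) by (simp add: card_Diff_subset)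
    then obtain w where "w \<in> X - {v, u}" by (metis all_not_in_conv card.empty)
    then have "c {v, u, w} = k" "c {v, u, w} = opp k"
      using full_pair_color[OF assms(1)] full_pair_color[OF assms(2)] True by auto
    then show False using ne by simp
  next
    case False
    have "c {v, u, u'} = k" using full_pair_color[OF assms(1), of u'] m False by auto
    moreover have "c {v, u', u} = opp k" using full_pair_color[OF assms(2), of u] m False by auto
    ultimately show False using ne by (simp add: insert_commute)
  qed
qed

text \<open>The partner \<open>v'\<close> completes the pair of \<open>y\<close> and
  \<open>v\<close>, and if \<open>y = v'\<close>, any third vertex does. So a covered vertex accepts
  a leaf in its colour wherever the neighbour is.\<close>

lemma full_pair_extend:
  assumes "full_pair X c k v v'" "y \<in> X" "y \<noteq> v" "card X \<ge> 3" "finite X"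
  shows "\<exists>w\<in>X. w \<noteq> v \<and> w \<noteq> y \<and> c {y, v, w} = k"
proof (cases "y = v'")
  case True
  note m = full_pair_mem[OF assms(1)]
  have "card (X - {v, v'}) \<noteq> 0" using m assms(4) by (simp add: card_Diff_subset)
  then obtain w where w: "w \<in> X - {v, v'}" by (metis all_not_in_conv card.empty)
  then have "c {v, v', w} = k" using full_pair_color[OF assms(1)] by simp
  then show ?thesis using w True by (intro bexI[of _ w]) (auto simp: insert_commute)
next
  case False
  have "c {v, v', y} = k" using full_pair_color[OF assms(1,2)] assms(3) False by simp
  moreover have "{v, v', y} = {y, v, v'}" by auto
  ultimately show ?thesis using full_pair_mem[OF assms(1)] False by (intro bexI[of _ v']) auto
qed

lemma Berge_copy_add_covered:
  assumes "Berge_copy Y c k V E" "tree_on V E" "Y \<subseteq> X" "v \<in> X" "v \<notin> Y" "u \<in> V" "x \<notin> V"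
    "full_pair X c k v v'" "card X \<ge> 3" "finite X"
  shows "Berge_copy X c k (insert x V) (insert {u, x} E)"
proof -
  obtain \<phi> f where emb: "Berge_emb Y c k V E \<phi> f" using assms(1) by (auto simp: Berge_copy_def)
  have "\<phi> u \<in> Y" using emb assms(6) by (auto simp: Berge_emb_def)
  then obtain w where "w \<in> X" "w \<noteq> v" "w \<noteq> \<phi> u" "c {\<phi> u, v, w} = k"
    using full_pair_extend[OF assms(8) _ _ assms(9,10), of "\<phi> u"] assms(3,5) by blast
  then show ?thesis using Berge_emb_add_leaf[OF emb assms(2-7)] unfolding Berge_copy_def by blast
qed

text \<open>Here the full pair belongs to the image of \<open>u\<close>, so \<open>v\<close> may be
  any new vertex. Partners inside \<open>Y\<close> keep the triple within
  \<open>insert v Y\<close>.\<close>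

lemma Berge_copy_add_next:
  assumes "Berge_copy Y c k V E" "tree_on V E" "v \<in> X" "v \<notin> Y" "Y \<subseteq> X" "u \<in> V" "x \<notin> V"
    and full: "\<And>y. y \<in> Y \<Longrightarrow> \<exists>y'\<in>Y. full_pair X c k y y'"
  shows "Berge_copy (insert v Y) c k (insert x V) (insert {u, x} E)"
proof -
  obtain \<phi> f where emb: "Berge_emb Y c k V E \<phi> f" using assms(1) by (auto simp: Berge_copy_def)
  have "\<phi> u \<in> Y" using emb assms(6) by (auto simp: Berge_emb_def)
  then obtain y' where y': "y' \<in> Y" "full_pair X c k (\<phi> u) y'" using full by blast
  then have "c {\<phi> u, y', v} = k" using assms(3,4) \<open>\<phi> u \<in> Y\<close> by (intro full_pair_color) auto
  then have "c {\<phi> u, v, y'} = k" by (simp add: insert_commute)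
  moreover have "y' \<noteq> v" "y' \<noteq> \<phi> u" using y' assms(4) full_pair_mem by (blast, metis)
  moreover have "y' \<in> insert v Y" "Y \<subseteq> insert v Y" "v \<in> insert v Y" using y' by auto
  ultimately show ?thesis
    using Berge_emb_add_leaf[OF emb assms(2), of "insert v Y" v u x y'] assms(4,6,7)
    unfolding Berge_copy_def by blast
qed

lemma tree_on_lastE:
  assumes "tree_on V E" "card V \<ge> 2"
  obtains V0 E0 u x where "tree_on V0 E0" "u \<in> V0" "x \<notin> V0" "V = insert x V0" "E = insert {u, x} E0" "card V = Suc (card V0)"
  using assms(1)
proof (cases rule: tree_on.cases)
  case (single x)
  then show ?thesis using assms(2) by simp
next
  case (leaf V0 E0 u x)
  then show ?thesis using that tree_on_finite[of V0 E0] by simp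
qed

text \<open>Unique partners form a perfect matching, impossible on an odd set. Five is the size at
  which deleting a matched pair would leave fewer than the four vertices where the next induction
  starts.\<close>

lemma unique_partner_even:
  fixes R :: "'a \<Rightarrow> 'a \<Rightarrow> bool"
  assumes sym: "\<And>a b. R a b \<Longrightarrow> R b a" and uniq: "\<And>a b d. R a b \<Longrightarrow> R a d \<Longrightarrow> b = d"
    and irr: "\<And>a b. R a b \<Longrightarrow> a \<noteq> b \<and> a \<in> Y \<and> b \<in> Y" and tot: "\<And>a. a \<in> Y \<Longrightarrow> \<exists>b. R a b"
    and "card Y = 5"
  shows False
proof -
  have fin: "finite Y" using assms(5) card.infinite by fastforce
  obtain a where a: "a \<in> Y" using assms(5) by fastforce
  obtain b where b: "R a b" using tot a by blast
  have "card (Y - {a, b}) = 3" using irr[OF b] assms(5) by (simp add: card_Diff_subset)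
  then obtain d where d: "d \<in> Y" "d \<noteq> a" "d \<noteq> b" by (metis DiffE all_not_in_conv card.empty insertCI zero_neq_numeral)
  obtain e where e: "R d e" using tot d by blast
  have e': "e \<noteq> a" using uniq[of a b d] sym[OF e] b d by auto
  have e'': "e \<noteq> b" using uniq[of b a d] sym[OF e] sym[OF b] d by auto
  have "card (Y - {a, b, d, e}) = 1" using irr[OF b] irr[OF e] d e' e'' assms(5) by (simp add: card_Diff_subset)
  then obtain g where g: "Y - {a, b, d, e} = {g}" by (auto simp: card_1_singleton_iff)
  then have g': "g \<in> Y" "g \<noteq> a" "g \<noteq> b" "g \<noteq> d" "g \<noteq> e" by auto
  obtain h where h: "R g h" using tot g' by blast
  have inj: "x = y" if "R x z" "R y z" for x y z using uniq sym that by blast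
  have "h \<noteq> a" using inj[of g a b] h sym[OF b] g' by auto
  moreover have "h \<noteq> b" using inj[of g b a] h b g' by auto
  moreover have "h \<noteq> d" using inj[of g d e] h sym[OF e] g' by auto
  moreover have "h \<noteq> e" using inj[of g e d] h e g' by auto
  moreover have "h \<noteq> g" using irr[OF h] by auto
  ultimately show False using g irr[OF h] by auto
qed

text \<open>Delete a vertex, or both ends of an isolated edge, so that the remaining vertices are still
  covered by full pairs.\<close>

lemma full_cover_universal:
  assumes "finite Y" "card Y \<ge> 4" "\<And>v. v \<in> Y \<Longrightarrow> \<exists>u. full_pair Y c k v u"
    "tree_on V E" "card V = card Y"
  shows "Berge_copy Y c k V E"
  using assms
proof (induction "card Y" arbitrary: Y V E rule: less_induct)
  case less
  let ?F = "full_pair Y c k"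
  show ?case
  proof (cases "card Y = 4")
    case True
    then show ?thesis using four_vertices[of Y c k V E] less.prems by simp
  next
    case False
    then have c5: "card Y \<ge> 5" using less.prems(2) by simp
    have V2: "card V \<ge> 2" using less.prems(5) c5 by simp
    obtain V1 E1 u1 x1 where T1: "tree_on V1 E1" "u1 \<in> V1" "x1 \<notin> V1" "V = insert x1 V1"
        "E = insert {u1, x1} E1" "card V = Suc (card V1)"
      by (rule tree_on_lastE[OF less.prems(4) V2])
    show ?thesis
    proof (cases "\<exists>v\<in>Y. \<forall>x\<in>Y - {v}. \<exists>u\<in>Y - {v}. ?F x u")
      case True
      then obtain v where v: "v \<in> Y" "\<And>x. x \<in> Y - {v} \<Longrightarrow> \<exists>u\<in>Y - {v}. ?F x u" by blast
      have cY: "card (Y - {v}) = card Y - 1" using v(1) by simp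
      have "Berge_copy (Y - {v}) c k V1 E1"
      proof (rule less.hyps)
        show "\<exists>u. full_pair (Y - {v}) c k x u" if "x \<in> Y - {v}" for x
          using v(2)[OF that] that full_pair_subset[of Y c k x _ "Y - {v}"] by blast
      qed (use cY c5 less.prems T1 in auto)
      then have "Berge_copy (insert v (Y - {v})) c k (insert x1 V1) (insert {u1, x1} E1)"
        by (rule Berge_copy_add_next[where X = Y]) (use T1 v in auto)
      then show ?thesis using T1 v(1) by (simp add: insert_absorb)
    next
      case False
      have pend: "\<exists>x\<in>Y - {v}. \<forall>u. ?F x u \<longrightarrow> u = v" if "v \<in> Y" for v
        using False that full_pair_mem by (metis (no_types, lifting) DiffI singletonD)
      \<comment> \<open>Some \<open>x\<close> hangs on \<open>a\<close> alone, and some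
        \<open>y\<close> hangs on \<open>x\<close> alone. Then \<open>y\<close> is a partner of
        \<open>x\<close>, so \<open>y = a\<close>, and \<open>a\<close> has the single partner
        \<open>x\<close>. Thus the full pairs form a perfect matching.\<close>
      have uniq: "b = d" if "?F a b" "?F a d" for a b d
      proof -
        have aY: "a \<in> Y" using full_pair_mem[OF that(1)] by simp
        obtain x where x: "x \<in> Y - {a}" "\<forall>u. ?F x u \<longrightarrow> u = a" using pend[OF aY] by blast
        obtain y where y: "y \<in> Y - {x}" "\<forall>u. ?F y u \<longrightarrow> u = x" using pend[of x] x(1) by blast
        obtain u where "?F y u" using less.prems(3) y(1) by blast
        then have "?F y x" using y(2) by blast
        then have "y = a" using x(2) full_pair_sym by metis
        then show "b = d" using y(2) that by metis
      qed
      have "card Y \<noteq> 5"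
        using unique_partner_even[of ?F Y] full_pair_sym[of Y c k] uniq full_pair_mem[of Y c k] less.prems(3) by metis
      then have c6: "card Y \<ge> 6" using c5 by simp
      obtain v where v: "v \<in> Y" using c5 by fastforce
      obtain x where x: "?F v x" using less.prems(3) v by blast
      note xm = full_pair_mem[OF x]
      let ?Z = "Y - {v, x}"
      have Z: "\<exists>u\<in>?Z. ?F z u" if z: "z \<in> ?Z" for z
      proof -
        obtain u where u: "?F z u" using less.prems(3) z by blast
        have "u \<noteq> v" using uniq[OF x] full_pair_sym[OF u] z by blast
        moreover have "u \<noteq> x" using uniq[OF full_pair_sym[OF x]] full_pair_sym[OF u] z by blast
        ultimately show ?thesis using u full_pair_mem[OF u] by blast
      qed
      have cZ: "card ?Z = card Y - 2" using xm by (simp add: card_Diff_subset)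
      have V12: "card V1 \<ge> 2" using T1(6) less.prems(5) c5 by simp
      obtain V2 E2 u2 x2 where T2: "tree_on V2 E2" "u2 \<in> V2" "x2 \<notin> V2" "V1 = insert x2 V2"
          "E1 = insert {u2, x2} E2" "card V1 = Suc (card V2)"
        by (rule tree_on_lastE[OF T1(1) V12])
      have "Berge_copy ?Z c k V2 E2"
      proof (rule less.hyps)
        show "\<exists>u. full_pair ?Z c k z u" if "z \<in> ?Z" for z
          using Z[OF that] that full_pair_subset[of Y c k z _ ?Z] by blast
      qed (use cZ c6 less.prems T1 T2 in auto)
      then have "Berge_copy (insert v ?Z) c k (insert x2 V2) (insert {u2, x2} E2)"
        by (rule Berge_copy_add_next[where X = Y]) (use T2 v Z in auto)
      then have "Berge_copy (insert v ?Z) c k V1 E1" using T2 by simp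
      \<comment> \<open>The neighbour of \<open>x1\<close> may now sit on \<open>v\<close>, whose
        only partner is \<open>x\<close> itself; so this leaf uses the full pair of the vertex
        \<open>x\<close> that it is placed on.\<close>
      then have "Berge_copy Y c k (insert x1 V1) (insert {u1, x1} E1)"
        by (rule Berge_copy_add_covered[OF _ T1(1), of _ _ _ _ x _ _ v])
          (use xm T1 c6 less.prems(1) full_pair_sym[OF x] in auto)
      then show ?thesis using T1 by simp
    qed
  qed
qed

lemma Berge_emb_add_leaves:
  fixes X :: "'a set" and V :: "'b set"
  assumes "finite W" "A \<inter> W = {}" "A \<union> W \<subseteq> X"
    and full: "\<And>v. v \<in> A \<Longrightarrow> \<exists>r\<in>A. full_pair X c k v r"
    and univ: "\<And>V E. tree_on (V :: 'b set) E \<Longrightarrow> card V = card A \<Longrightarrow> Berge_copy A c k V E"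
    and "tree_on V E" "card V = card A + card W" "I \<subseteq> V" "card I = card W"
    and "\<And>i. i \<in> I \<Longrightarrow> \<exists>u\<in>V - I. {e \<in> E. i \<in> e} = {{u, i}}"
  shows "\<exists>\<phi> f. Berge_emb (A \<union> W) c k V E \<phi> f \<and> \<phi> ` (V - I) \<subseteq> A"
  using assms(1,2,3,6-)
proof (induction W arbitrary: V E I rule: finite_induct)
  case empty
  have "finite I" using empty.prems(5) tree_on_finite[OF empty.prems(3)] finite_subset by blast
  then have "I = {}" using empty.prems by simp
  moreover obtain \<phi> f where "Berge_emb A c k V E \<phi> f"
    using univ[OF empty.prems(3)] empty.prems(4) by (auto simp: Berge_copy_def)
  ultimately show ?case by (auto simp: Berge_emb_def)
next
  case (insert w W)
  have finI: "finite I" using insert.prems(5) tree_on_finite[OF insert.prems(3)] finite_subset by blast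
  have "card I \<noteq> 0" using insert.prems(6) insert.hyps by simp
  then obtain i where i: "i \<in> I" by (metis all_not_in_conv card.empty)
  obtain u where u: "u \<in> V - I" "{e \<in> E. i \<in> e} = {{u, i}}" using insert.prems(7)[OF i] by blast
  define V' E' I' where "V' = V - {i}" and "E' = E - {{u, i}}" and "I' = I - {i}"
  have iV: "i \<in> V" using i insert.prems(5) by blast
  have T': "tree_on V' E'" unfolding V'_def E'_def by (rule leaf_remove[OF insert.prems(3) u(2)])
  have fin: "finite V" using tree_on_finite[OF insert.prems(3)] by simp
  have V'I': "V' - I' = V - I" using i by (auto simp: V'_def I'_def)
  have "\<exists>\<phi> f. Berge_emb (A \<union> W) c k V' E' \<phi> f \<and> \<phi> ` (V' - I') \<subseteq> A"
  proof (rule insert.IH[OF _ _ T'])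
    show "A \<inter> W = {}" "A \<union> W \<subseteq> X" using insert.prems(1,2) by auto
    show "card V' = card A + card W" using insert.prems(4) insert.hyps iV fin by (simp add: V'_def)
    show "I' \<subseteq> V'" using insert.prems(5) by (auto simp: I'_def V'_def)
    show "card I' = card W" using insert.prems(6) insert.hyps i finI by (simp add: I'_def)
    show "\<exists>u'\<in>V' - I'. {e \<in> E'. j \<in> e} = {{u', j}}" if j: "j \<in> I'" for j
    proof -
      have jI: "j \<in> I" "j \<noteq> i" using j by (auto simp: I'_def)
      then obtain u' where u': "u' \<in> V - I" "{e \<in> E. j \<in> e} = {{u', j}}" using insert.prems(7) by blast
      have "j \<notin> {u, i}" using jI u by auto
      then have "{e \<in> E'. j \<in> e} = {e \<in> E. j \<in> e}" by (auto simp: E'_def)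
      then show ?thesis using u' V'I' by auto
    qed
  qed
  then obtain \<phi> f where emb: "Berge_emb (A \<union> W) c k V' E' \<phi> f" "\<phi> ` (V' - I') \<subseteq> A" by blast
  have uV': "u \<in> V' - I'" using u(1) V'I' by simp
  then have uA: "\<phi> u \<in> A" using emb(2) by blast
  obtain r where r: "r \<in> A" "full_pair X c k (\<phi> u) r" using full[OF uA] by blast
  have wX: "w \<in> X" "w \<notin> A" "w \<notin> A \<union> W" using insert.prems(1,2) insert.hyps by auto
  have "c {\<phi> u, r, w} = k" using full_pair_color[OF r(2) wX(1)] uA r(1) wX(2) by blast
  then have "c {\<phi> u, w, r} = k" by (simp add: insert_commute)
  then have "Berge_emb (A \<union> insert w W) c k (insert i V') (insert {u, i} E') (\<phi>(i := w)) (f({u, i} := {\<phi> u, w, r}))"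
    using uV' r wX full_pair_mem[OF r(2)] by (intro Berge_emb_add_leaf[OF emb(1) T']) (auto simp: V'_def)
  moreover have "insert i V' = V" using iV by (auto simp: V'_def)
  moreover have "insert {u, i} E' = E" using u(2) by (auto simp: E'_def)
  moreover have "(\<phi>(i := w)) ` (V - I) \<subseteq> A" using emb(2) V'I' i by auto
  ultimately show ?case by metis
qed

text \<open>Beyond two vertices, deleting \<open>x\<close> would leave \<open>y\<close> isolated in
  a tree. Hence neighbours of leaves are never among the leaves set aside.\<close>

lemma adjacent_leaves:
  assumes T: "tree_on V E" and xy: "{e \<in> E. x \<in> e} = {{y, x}}" "{e \<in> E. y \<in> e} = {{y, x}}"
  shows "card V \<le> 2"
proof (rule ccontr)
  assume big: "\<not> card V \<le> 2"
  have e: "{y, x} \<in> E" using xy by blast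
  then have m: "x \<in> V" "y \<in> V" using tree_on_edge_subset[OF T] by blast+
  have T': "tree_on (V - {x}) (E - {{y, x}})" by (rule leaf_remove[OF T xy(1)])
  have fin: "finite V" using tree_on_finite[OF T] by simp
  have "x \<noteq> y" using tree_on_edge[OF T e] by (metis doubleton_eq_iff)
  then have "deg (E - {{y, x}}) y \<ge> 1" using deg_pos[OF T'] m big fin by simp
  moreover have "{e \<in> E - {{y, x}}. y \<in> e} = {}" using xy(2) by blast
  ultimately show False by (simp only: deg_def card.empty)
qed

text \<open>The covered set \<open>A\<close> hosts the tree without some leaves; each vertex outside \<open>A\<close> receives a leaf.\<close>

lemma Berge_copy_many_leaves:
  fixes X :: "'a set" and V :: "'b set"
  assumes fin: "finite X" and A: "A = {v \<in> X. \<exists>u. full_pair X c k v u}" "card A \<ge> 4"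
    and T: "tree_on V E" "card V = card X" and L: "card (leaves V E) \<ge> card (X - A)"
  shows "Berge_copy X c k V E"
proof -
  have sub: "A \<subseteq> X" using A(1) by blast
  have cA: "card X = card A + card (X - A)" using sub fin by (simp add: card_Diff_subset finite_subset card_mono)
  obtain I where I: "I \<subseteq> leaves V E" "card I = card (X - A)" "finite I"
    using obtain_subset_with_card_n[OF L] by metis
  have full: "\<exists>r\<in>A. full_pair X c k v r" if vA: "v \<in> A" for v
  proof -
    obtain r where r: "full_pair X c k v r" using vA A(1) by blast
    then have "r \<in> A" using full_pair_sym[OF r] full_pair_mem[OF r] A(1) by blast
    with r show ?thesis by blast
  qed
  have "\<exists>\<phi> f. Berge_emb (A \<union> (X - A)) c k V E \<phi> f \<and> \<phi> ` (V - I) \<subseteq> A"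
  proof (rule Berge_emb_add_leaves[OF _ _ _ full _ T(1)])
    show "Berge_copy A c k V' E'" if "tree_on V' E'" "card V' = card A" for V' :: "'b set" and E'
    proof (rule full_cover_universal[OF _ A(2) _ that])
      show "finite A" using sub fin finite_subset by blast
      show "\<exists>u. full_pair A c k v u" if "v \<in> A" for v
        using full[OF that] full_pair_subset[OF _ sub that] by blast
    qed
    show "I \<subseteq> V" using I(1) by (auto simp: leaves_def)
    show "\<exists>u\<in>V - I. {e \<in> E. i \<in> e} = {{u, i}}" if i: "i \<in> I" for i
    proof -
      obtain u where u: "u \<in> V" "u \<noteq> i" "{u, i} \<in> E" "{e \<in> E. i \<in> e} = {{u, i}}"
        using leafE[OF T(1)] I(1) i by blast
      have "u \<notin> I"
      proof
        assume "u \<in> I"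
        then have "u \<in> leaves V E" using I(1) by blast
        then obtain w where w: "{e \<in> E. u \<in> e} = {{w, u}}" by (rule leafE[OF T(1)])
        have "{u, i} \<in> {e \<in> E. u \<in> e}" using u(3) by simp
        then have "{w, u} = {u, i}" by (simp only: w singleton_iff)
        with w have "{e \<in> E. u \<in> e} = {{u, i}}" by (simp only:)
        then have "card V \<le> 2" using adjacent_leaves[OF T(1) u(4)] by simp
        then show False using T(2) cA A(2) by simp
      qed
      then show ?thesis using u by blast
    qed
  qed (use fin sub cA T I in auto)
  moreover have "A \<union> (X - A) = X" using sub by blast
  ultimately show ?thesis unfolding Berge_copy_def by auto
qed

section \<open>Extending copies by structured placements\<close>

lemma ex_bij_extend:
  assumes "finite Q" "finite B" "card Q = card B" "a \<in> Q" "b \<in> B"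
  shows "\<exists>g. bij_betw g Q B \<and> g a = b"
proof -
  have "card (Q - {a}) = card (B - {b})" using assms by simp
  then obtain h where h: "bij_betw h (Q - {a}) (B - {b})"
    using finite_same_card_bij[of "Q - {a}" "B - {b}"] assms by blast
  have "bij_betw (h(a := b)) (Q - {a}) (B - {b})"
    using h by (rule bij_betw_cong[THEN iffD1, rotated]) auto
  then have "bij_betw (h(a := b)) (insert a (Q - {a})) (insert b (B - {b}))"
    using notIn_Un_bij_betw[of a "Q - {a}" "h(a := b)" "B - {b}"] by simp
  then show ?thesis using assms by (intro exI[of _ "h(a := b)"]) (simp add: insert_absorb)
qed

lemma ex_bij_extend2:
  assumes "finite Q" "finite B" "card Q = card B" "a \<in> Q" "b \<in> B" "a' \<in> Q" "b' \<in> B" "a \<noteq> a'" "b \<noteq> b'"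
  shows "\<exists>g. bij_betw g Q B \<and> g a = b \<and> g a' = b'"
proof -
  have "card (Q - {a}) = card (B - {b})" using assms by simp
  then obtain h where h: "bij_betw h (Q - {a}) (B - {b})" "h a' = b'"
    using ex_bij_extend[of "Q - {a}" "B - {b}" a' b'] assms by blast
  have "bij_betw (h(a := b)) (Q - {a}) (B - {b})"
    using h(1) by (rule bij_betw_cong[THEN iffD1, rotated]) auto
  then have "bij_betw (h(a := b)) (insert a (Q - {a})) (insert b (B - {b}))"
    using notIn_Un_bij_betw[of a "Q - {a}" "h(a := b)" "B - {b}"] by simp
  then show ?thesis using assms h by (intro exI[of _ "h(a := b)"]) (simp add: insert_absorb)
qed

text \<open>The centre goes to \<open>m\<close>, and \<open>y\<close> is served by
  \<open>{m, w1, y}\<close>, which degenerates only for \<open>y = w1\<close>. That vertex takes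
  \<open>{m, w1, w2}\<close>, so \<open>w2\<close> falls back on its own full pair with a fourth
  vertex \<open>z\<close>.\<close>

lemma Berge_copy_star:
  assumes fin: "finite X" and "card X \<ge> 4" and w: "full_pair X c k m w1" "full_pair X c k m w2" "w1 \<noteq> w2"
    and T: "tree_on V E" "card V = card X" "is_star V E"
  shows "Berge_copy X c k V E"
proof -
  obtain s where s: "s \<in> V" "\<forall>e\<in>E. s \<in> e" using T(3) by (auto simp: is_star_def)
  note mem = full_pair_mem[OF w(1)] full_pair_mem[OF w(2)]
  have finV: "finite V" using tree_on_finite[OF T(1)] by simp
  obtain \<phi> where \<phi>: "bij_betw \<phi> V X" "\<phi> s = m"
    using ex_bij_extend[OF finV fin T(2) s(1), of m] mem by blast
  have "card (X - {m, w1, w2}) \<noteq> 0" using mem w(3) assms(2) by (simp add: card_Diff_subset)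
  then obtain z where z: "z \<in> X - {m, w1, w2}" by (metis all_not_in_conv card.empty)
  define g where "g y = (if y = w1 then {m, w1, w2} else if y = w2 then {m, w2, z} else {m, w1, y})" for y
  have g: "g y \<in> nsets X 3 \<and> c (g y) = k \<and> m \<in> g y \<and> y \<in> g y" if y: "y \<in> X" "y \<noteq> m" for y
    unfolding g_def using y mem w(3) z
    by (auto intro!: triple_in_nsets full_pair_color[OF w(1)] full_pair_color[OF w(2)])
  have ginj: "inj_on g (X - {m})"
  proof (rule inj_onI)
    fix y y' assume yy: "y \<in> X - {m}" "y' \<in> X - {m}" and eq: "g y = g y'"
    have "y \<in> g y" "y' \<in> g y'" using g yy by blast+
    then have "y \<in> g y'" "y' \<in> g y" by (simp_all only: eq)
    then show "y = y'" using yy mem w(3) z by (auto simp: g_def split: if_splits)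
  qed
  define f where "f e = g (the_elem (\<phi> ` e - {m}))" for e
  have edge: "\<exists>y\<in>X - {m}. \<phi> ` e = {m, y} \<and> f e = g y" if e: "e \<in> E" for e
  proof -
    obtain a b where ab: "e = {a, b}" "a \<noteq> b" "a \<in> V" "b \<in> V" by (rule tree_on_edge[OF T(1) e])
    define x where "x = (if s = a then b else a)"
    have "s \<in> e" using s(2) e by blast
    then have x: "e = {s, x}" "x \<in> V" "x \<noteq> s" using ab by (auto simp: x_def)
    have "\<phi> x \<noteq> m" using \<phi> x s(1) by (auto simp: bij_betw_def dest: inj_onD)
    moreover have "\<phi> x \<in> X" using \<phi>(1) x(2) by (auto simp: bij_betw_def)
    moreover have "\<phi> ` e - {m} = {\<phi> x}" using x(1) \<phi>(2) \<open>\<phi> x \<noteq> m\<close> by auto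
    ultimately show ?thesis using x(1) \<phi>(2) by (intro bexI[of _ "\<phi> x"]) (auto simp: f_def)
  qed
  have "inj_on f E"
  proof (rule inj_onI)
    fix e e' assume ee: "e \<in> E" "e' \<in> E" and eq: "f e = f e'"
    obtain y where y: "y \<in> X - {m}" "\<phi> ` e = {m, y}" "f e = g y" using edge[OF ee(1)] by blast
    obtain y' where y': "y' \<in> X - {m}" "\<phi> ` e' = {m, y'}" "f e' = g y'" using edge[OF ee(2)] by blast
    have "y = y'" using inj_onD[OF ginj] eq y y' by metis
    then have "\<phi> ` e = \<phi> ` e'" using y y' by simp
    then show "e = e'" using inj_on_image_eq_iff[of \<phi> V e e'] \<phi>(1) tree_on_edge_subset[OF T(1)] ee
      by (simp add: bij_betw_def)
  qed
  moreover have "f e \<in> nsets X 3 \<and> c (f e) = k \<and> \<phi> ` e \<subseteq> f e" if e: "e \<in> E" for e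
  proof -
    obtain y where y: "y \<in> X" "y \<noteq> m" "\<phi> ` e = {m, y}" "f e = g y" using edge[OF e] by blast
    show ?thesis unfolding y(3,4) using g[OF y(1,2)] by simp
  qed
  ultimately have "Berge_emb X c k V E \<phi> f" using \<phi>(1) by (simp add: Berge_emb_def bij_betw_def)
  then show ?thesis unfolding Berge_copy_def by blast
qed

text \<open>The vertices \<open>w1\<close> and \<open>w2\<close> are arbitrary and may even be
  \<open>l2\<close> and \<open>l1\<close>. The two new triples still differ, since a common triple
  would contain the four vertices \<open>l1\<close>, \<open>l2\<close>, \<open>\<phi> u1\<close>,
  \<open>\<phi> u2\<close>.\<close>

lemma Berge_copy_add_two:
  assumes emb: "Berge_emb (X - {l1, l2}) c k V E \<phi> f" and T: "tree_on V E"
    and u: "u1 \<in> V" "u2 \<in> V" "u1 \<noteq> u2" and x: "x1 \<notin> V" "x2 \<notin> V" "x1 \<noteq> x2"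
    and l: "l1 \<in> X" "l2 \<in> X" "l1 \<noteq> l2"
    and w1: "w1 \<in> X" "w1 \<noteq> \<phi> u1" "w1 \<noteq> l1" "c {\<phi> u1, l1, w1} = k"
    and w2: "w2 \<in> X" "w2 \<noteq> \<phi> u2" "w2 \<noteq> l2" "c {\<phi> u2, l2, w2} = k"
  shows "Berge_copy X c k (insert x1 (insert x2 V)) (insert {u1, x1} (insert {u2, x2} E))"
proof -
  let ?t1 = "{\<phi> u1, l1, w1}" and ?t2 = "{\<phi> u2, l2, w2}"
  have \<phi>: "\<phi> u1 \<in> X - {l1, l2}" "\<phi> u2 \<in> X - {l1, l2}" "\<phi> u1 \<noteq> \<phi> u2"
    using emb u by (auto simp: Berge_emb_def dest: inj_onD)
  have t: "?t1 \<in> nsets X 3" "?t2 \<in> nsets X 3"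
    using \<phi> l w1 w2 by (auto intro!: triple_in_nsets)
  have fe: "l1 \<notin> f e" "l2 \<notin> f e" if "e \<in> E" for e
    using emb that by (auto simp: Berge_emb_def nsets_def)
  have sub: "e \<subseteq> V" if "e \<in> E" for e using tree_on_edge_subset[OF T that] .
  have neq: "?t1 \<noteq> ?t2"
  proof
    assume eq: "?t1 = ?t2"
    have "{\<phi> u1, \<phi> u2, l1, l2} \<subseteq> ?t1" using eq by blast
    then have "card {\<phi> u1, \<phi> u2, l1, l2} \<le> card ?t1" by (intro card_mono) auto
    moreover have "card {\<phi> u1, \<phi> u2, l1, l2} = 4" using \<phi> l by (auto simp: card_insert_if)
    moreover have "card ?t1 = 3" using t(1) by (simp add: nsets_def)
    ultimately show False by linarith
  qed
  have emb': "Berge_emb X c k (insert x2 V) (insert {u2, x2} E) (\<phi>(x2 := l2)) (f({u2, x2} := ?t2))"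
  proof (rule Berge_emb_insert[OF Berge_emb_mono[OF emb]])
    show "l2 \<notin> \<phi> ` V" using emb by (auto simp: Berge_emb_def)
    show "?t2 \<notin> f ` E" using fe by (metis imageE insertCI)
  qed (use sub u x l w2 t in auto)
  have new: "{u2, x2} \<notin> E" using sub x by blast
  have u1': "(\<phi>(x2 := l2)) u1 = \<phi> u1" using u x by auto
  have "Berge_emb X c k (insert x1 (insert x2 V)) (insert {u1, x1} (insert {u2, x2} E))
      (\<phi>(x2 := l2, x1 := l1)) (f({u2, x2} := ?t2, {u1, x1} := ?t1))"
  proof (rule Berge_emb_insert[OF emb'])
    show "e \<subseteq> insert x2 V" if "e \<in> insert {u2, x2} E" for e using that sub u by blast
    have "l1 \<notin> \<phi> ` V" using emb by (auto simp: Berge_emb_def)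
    then show "l1 \<notin> (\<phi>(x2 := l2)) ` insert x2 V" using l by auto
    have i1: "?t1 \<notin> f ` E" using fe by (metis imageE insertCI)
    have i2: "(f({u2, x2} := ?t2)) ` insert {u2, x2} E = insert ?t2 (f ` E)" using new by auto
    show "?t1 \<notin> (f({u2, x2} := ?t2)) ` insert {u2, x2} E"
      unfolding i2 using i1 neq by (simp only: insert_iff simp_thms)
    show "(\<phi>(x2 := l2)) u1 \<in> ?t1" using u1' by simp
  qed (use u x l w1 t in auto)
  then show ?thesis unfolding Berge_copy_def by blast
qed

text \<open>In colour \<open>k\<close> both \<open>l1\<close> and \<open>l2\<close> are covered and
  accept any leaf. In the other colour \<open>l1\<close> refuses only a neighbour on
  \<open>c1\<close>, and \<open>l2\<close> only one on \<open>c2\<close>, these being their unique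
  partners. The inclusions \<open>V0 \<subseteq> V\<close> and \<open>E0 \<subseteq> E\<close> in
  \<open>IH\<close> let degree bounds pass to the smaller tree.\<close>

lemma Berge_copy_pendants:
  fixes X :: "'a set" and V V' :: "'b set"
  assumes IH: "\<And>V0 E0 V0' E0'. tree_on (V0 :: 'b set) E0 \<Longrightarrow> card V0 = card X - 2 \<Longrightarrow> tree_on (V0' :: 'b set) E0' \<Longrightarrow>
      card V0' = card X - 2 \<Longrightarrow> V0 \<subseteq> V \<Longrightarrow> E0 \<subseteq> E \<Longrightarrow> Berge_copy (X - {l1, l2}) c k V0 E0 \<or> Berge_copy (X - {l1, l2}) c (opp k) V0' E0'"
    and fin: "finite X" "card X \<ge> 3"
    and l: "l1 \<noteq> l2" "full_pair X c k l1 c1" "full_pair X c k l2 c2" "c1 \<noteq> c2"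
    and uniq: "\<And>u. full_pair X c k l1 u \<Longrightarrow> u = c1" "\<And>u. full_pair X c k l2 u \<Longrightarrow> u = c2"
    and T: "tree_on V E" "card V = card X" "\<not> is_star V E"
    and T': "tree_on V' E'" "card V' = card X" "\<not> is_star V' E'"
  shows "Berge_copy X c k V E \<or> Berge_copy X c (opp k) V' E'"
proof -
  obtain V0 E0 x1 x2 u1 u2 where D: "tree_on V0 E0" "u1 \<in> V0" "u2 \<in> V0" "u1 \<noteq> u2" "x1 \<notin> V0" "x2 \<notin> V0"
      "x1 \<noteq> x2" "V = insert x1 (insert x2 V0)" "E = insert {u1, x1} (insert {u2, x2} E0)"
    using nonstar_two_leaves[OF T(1,3)] by blast
  obtain V0' E0' x1' x2' u1' u2' where D': "tree_on V0' E0'" "u1' \<in> V0'" "u2' \<in> V0'" "u1' \<noteq> u2'" "x1' \<notin> V0'" "x2' \<notin> V0'"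
      "x1' \<noteq> x2'" "V' = insert x1' (insert x2' V0')" "E' = insert {u1', x1'} (insert {u2', x2'} E0')"
    using nonstar_two_leaves[OF T'(1,3)] by blast
  have cV: "card V0 = card X - 2" using D T(2) tree_on_finite[OF D(1)] by simp
  have cV': "card V0' = card X - 2" using D' T'(2) tree_on_finite[OF D'(1)] by simp
  have lX: "l1 \<in> X" "l2 \<in> X" using l full_pair_mem by metis+
  have "V0 \<subseteq> V" "E0 \<subseteq> E" using D by auto
  then consider "Berge_copy (X - {l1, l2}) c k V0 E0" | "Berge_copy (X - {l1, l2}) c (opp k) V0' E0'"
    using IH[OF D(1) cV D'(1) cV'] by blast
  then show ?thesis
  proof cases
    case 1
    then obtain \<phi> f where emb: "Berge_emb (X - {l1, l2}) c k V0 E0 \<phi> f" by (auto simp: Berge_copy_def)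
    have \<phi>: "\<phi> u1 \<in> X - {l1, l2}" "\<phi> u2 \<in> X - {l1, l2}" using emb D by (auto simp: Berge_emb_def)
    obtain w1 where w1: "w1 \<in> X" "w1 \<noteq> l1" "w1 \<noteq> \<phi> u1" "c {\<phi> u1, l1, w1} = k"
      using full_pair_extend[OF l(2) _ _ fin(2,1), of "\<phi> u1"] \<phi> by blast
    obtain w2 where w2: "w2 \<in> X" "w2 \<noteq> l2" "w2 \<noteq> \<phi> u2" "c {\<phi> u2, l2, w2} = k"
      using full_pair_extend[OF l(3) _ _ fin(2,1), of "\<phi> u2"] \<phi> by blast
    have "Berge_copy X c k V E" unfolding D(8,9)
      by (rule Berge_copy_add_two[OF emb D(1-7) lX l(1) w1(1,3,2,4) w2(1,3,2,4)])
    then show ?thesis ..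
  next
    case 2
    then obtain \<phi> f where emb: "Berge_emb (X - {l1, l2}) c (opp k) V0' E0' \<phi> f" by (auto simp: Berge_copy_def)
    have \<phi>: "\<phi> u1' \<in> X - {l1, l2}" "\<phi> u2' \<in> X - {l1, l2}" "\<phi> u1' \<noteq> \<phi> u2'"
      using emb D' by (auto simp: Berge_emb_def dest: inj_onD)
    have ex: "\<exists>w\<in>X. w \<noteq> y \<and> w \<noteq> a \<and> c {y, a, w} = opp k"
      if "y \<in> X - {l1, l2}" "a \<in> X" "y \<noteq> a" "\<not> full_pair X c k a y" for y a
      using that not_full_pair[of X c k y a] full_pair_sym[of X c k y a] by (metis DiffD1)
    have ex1: "\<exists>w\<in>X. w \<noteq> y \<and> w \<noteq> l1 \<and> c {y, l1, w} = opp k" if "y \<in> X - {l1, l2}" "y \<noteq> c1" for y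
      using ex[of y l1] that uniq(1)[of y] lX by blast
    have ex2: "\<exists>w\<in>X. w \<noteq> y \<and> w \<noteq> l2 \<and> c {y, l2, w} = opp k" if "y \<in> X - {l1, l2}" "y \<noteq> c2" for y
      using ex[of y l2] that uniq(2)[of y] lX by blast
    \<comment> \<open>Each assignment has two ways to fail. As \<open>c1\<close> and
      \<open>c2\<close> differ and the two images differ, no failure of one is compatible with a
      failure of the other.\<close>
    consider (straight) "\<phi> u1' \<noteq> c1" "\<phi> u2' \<noteq> c2" | (swapped) "\<phi> u1' \<noteq> c2" "\<phi> u2' \<noteq> c1"
      using \<phi>(3) l(4) by metis
    then have "Berge_copy X c (opp k) V' E'"
    proof cases
      case straight
      obtain w1 where w1: "w1 \<in> X" "w1 \<noteq> \<phi> u1'" "w1 \<noteq> l1" "c {\<phi> u1', l1, w1} = opp k"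
        using ex1[OF \<phi>(1) straight(1)] by blast
      obtain w2 where w2: "w2 \<in> X" "w2 \<noteq> \<phi> u2'" "w2 \<noteq> l2" "c {\<phi> u2', l2, w2} = opp k"
        using ex2[OF \<phi>(2) straight(2)] by blast
      show ?thesis unfolding D'(8,9)
        by (rule Berge_copy_add_two[OF emb D'(1-7) lX l(1) w1 w2])
    next
      case swapped
      obtain w1 where w1: "w1 \<in> X" "w1 \<noteq> \<phi> u1'" "w1 \<noteq> l2" "c {\<phi> u1', l2, w1} = opp k"
        using ex2[OF \<phi>(1) swapped(1)] by blast
      obtain w2 where w2: "w2 \<in> X" "w2 \<noteq> \<phi> u2'" "w2 \<noteq> l1" "c {\<phi> u2', l1, w2} = opp k"
        using ex1[OF \<phi>(2) swapped(2)] by blast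
      have emb': "Berge_emb (X - {l2, l1}) c (opp k) V0' E0' \<phi> f" using emb by (simp add: insert_commute)
      show ?thesis unfolding D'(8,9)
        by (rule Berge_copy_add_two[OF emb' D'(1-7) lX(2,1) l(1)[symmetric] w1 w2])
    qed
    then show ?thesis ..
  qed
qed

text \<open>Every vertex outside \<open>C\<close> can be given its own incident edge: follow an edge towards \<open>C\<close> where
  possible; a component avoiding \<open>C\<close> has minimum degree 2, so it has a spanning tree plus an extra
  edge, and one roots the tree at an end of that edge.\<close>

lemma distinct_incident_edges:
  assumes "finite S" and sym: "\<And>a b. R a b \<Longrightarrow> R b a" and irr: "\<And>a b. R a b \<Longrightarrow> a \<noteq> b \<and> a \<in> S \<and> b \<in> S"
    and "C \<subseteq> S" and "\<And>x. x \<in> S - C \<Longrightarrow> (\<exists>d\<in>C. R x d) \<or> (\<exists>y z. y \<noteq> z \<and> R x y \<and> R x z)"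
  shows "\<exists>r. (\<forall>x\<in>S - C. R x (r x)) \<and> inj_on (\<lambda>x. {x, r x}) (S - C)"
  using assms(4,5)
proof (induction "card (S - C)" arbitrary: C rule: less_induct)
  case less
  show ?case
  proof (cases "\<exists>x\<in>S - C. \<exists>d\<in>C. R x d")
    case True
    then obtain x d where xd: "x \<in> S - C" "d \<in> C" "R x d" by blast
    have "S - C = insert x (S - insert x C)" using xd by blast
    moreover have lt: "card (S - insert x C) < card (S - C)"
      using xd(1) assms(1) by (intro psubset_card_mono) auto
    obtain r where r: "\<forall>y\<in>S - insert x C. R y (r y)" "inj_on (\<lambda>y. {y, r y}) (S - insert x C)"
      using less.hyps[OF lt] less.prems xd(1) by blast
    let ?r = "r(x := d)"
    have "inj_on (\<lambda>y. {y, ?r y}) (S - insert x C)"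
      using r(2) inj_on_cong[of "S - insert x C" "\<lambda>y. {y, ?r y}" "\<lambda>y. {y, r y}"] by simp
    moreover have "{x, ?r x} \<notin> (\<lambda>y. {y, ?r y}) ` (S - insert x C - {x})"
    proof
      assume "{x, ?r x} \<in> (\<lambda>y. {y, ?r y}) ` (S - insert x C - {x})"
      then obtain y where "y \<in> S - insert x C" "{x, d} = {y, r y}" by auto
      then show False using xd(2) by (auto simp: doubleton_eq_iff)
    qed
    ultimately have "inj_on (\<lambda>y. {y, ?r y}) (S - C)" by (simp only: inj_on_insert simp_thms)
    moreover have "\<forall>y\<in>S - C. R y (?r y)" using r(1) xd by auto
    ultimately show ?thesis by blast
  next
    case no: False
    show ?thesis
    proof (cases "S - C = {}")
      case True
      then show ?thesis by (simp only: ball_empty inj_on_empty simp_thms)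
    next
      case False
      then obtain x where x: "x \<in> S - C" by blast
      have finSC: "finite (S - C)" using assms(1) by simp
      define A where "A = {{a, b} | a b. R a b}"
      have AR: "{a, b} \<in> A \<longleftrightarrow> R a b" for a b using sym by (auto simp: A_def doubleton_eq_iff)
      obtain V E where VE: "tree_on V E" "V \<subseteq> S - C" "E \<subseteq> A" "x \<in> V"
        and closed: "\<forall>u\<in>V. \<forall>v\<in>S - C. {u, v} \<in> A \<longrightarrow> v \<in> V"
        using maximal_tree_on[OF finSC x, of A] by metis
      have cl: "b \<in> V" if ab: "a \<in> V" "R a b" for a b
      proof -
        have "b \<in> S - C" using no ab VE(2) irr by blast
        moreover have "{a, b} \<in> A" using ab AR by simp
        ultimately show ?thesis using closed ab(1) by blast
      qed
      \<comment> \<open>Such a \<open>p\<close> has two neighbours but at most one tree edge, so one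
        of its edges is outside the tree; that edge is reserved for \<open>p\<close> as
        root.\<close>
      have "\<exists>p\<in>V. deg E p \<le> 1"
      proof (cases "card V \<ge> 2")
        case True
        then have "card (leaves V E) \<noteq> 0" using two_le_leaves[OF VE(1)] by linarith
        then obtain p where "p \<in> leaves V E" by (metis all_not_in_conv card.empty)
        then show ?thesis by (intro bexI[of _ p]) (simp_all add: leaves_def)
      next
        case False
        then have "E = {}" using tree_on_card_1[OF VE(1) _ VE(4)] by simp
        then show ?thesis using VE(4) by auto
      qed
      then obtain p where p: "p \<in> V" "deg E p \<le> 1" by blast
      obtain y z where yz: "y \<noteq> z" "R p y" "R p z" using less.prems(2)[of p] no VE(2) p(1) by blast
      have "\<exists>q. R p q \<and> {p, q} \<notin> E"
      proof (rule ccontr)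
        assume "\<not> (\<exists>q. R p q \<and> {p, q} \<notin> E)"
        then have "{{p, y}, {p, z}} \<subseteq> {e \<in> E. p \<in> e}" using yz by blast
        then have "card {{p, y}, {p, z}} \<le> deg E p" unfolding deg_def
          using tree_on_finite[OF VE(1)] by (intro card_mono) auto
        moreover have "{p, y} \<noteq> {p, z}" using yz(1) by (auto simp: doubleton_eq_iff)
        ultimately show False using p(2) by simp
      qed
      then obtain q where q: "R p q" "{p, q} \<notin> E" by blast
      obtain r0 where r0: "\<forall>x\<in>V - {p}. r0 x \<in> V \<and> {x, r0 x} \<in> E" "inj_on (\<lambda>x. {x, r0 x}) (V - {p})"
        using tree_on_root[OF VE(1) p(1)] by blast
      have lt: "card (S - (C \<union> V)) < card (S - C)"
        using VE(2,4) assms(1) by (intro psubset_card_mono) auto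
      obtain r1 where r1: "\<forall>x\<in>S - (C \<union> V). R x (r1 x)" "inj_on (\<lambda>x. {x, r1 x}) (S - (C \<union> V))"
        using less.hyps[OF lt] less.prems VE(2) by blast
      define r where "r x = (if x = p then q else if x \<in> V then r0 x else r1 x)" for x
      have rV: "r v \<in> V \<and> R v (r v)" if "v \<in> V" for v
      proof (cases "v = p")
        case True
        then show ?thesis using q cl[OF p(1) q(1)] by (simp add: r_def)
      next
        case False
        then have "r0 v \<in> V" "{v, r0 v} \<in> E" using r0(1) that by auto
        then have "R v (r0 v)" using AR VE(3) by blast
        then show ?thesis using False that \<open>r0 v \<in> V\<close> by (simp add: r_def)
      qed
      have rS: "r v = r1 v" if "v \<in> S - (C \<union> V)" for v using that p(1) by (auto simp: r_def)
      have edgeE: "{v, r v} \<in> E" if "v \<in> V" "v \<noteq> p" for v using that r0(1) by (simp add: r_def)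
      have "inj_on (\<lambda>x. {x, r x}) (S - C)"
      proof (rule inj_onI)
        fix a b assume ab: "a \<in> S - C" "b \<in> S - C" "{a, r a} = {b, r b}"
        consider "a \<in> V" "b \<in> V" | "a \<notin> V" "b \<notin> V" | "a \<in> V" "b \<notin> V" | "a \<notin> V" "b \<in> V" by blast
        then show "a = b"
        proof cases
          case 1
          show ?thesis
          proof (cases "a = p \<or> b = p")
            case True
            have "{p, r p} \<notin> E" using q(2) by (simp add: r_def)
            then show ?thesis using True ab(3) edgeE 1 by metis
          next
            case False
            then have "{a, r0 a} = {b, r0 b}" using ab(3) 1 by (simp add: r_def)
            then show ?thesis using inj_onD[OF r0(2), of a b] 1 False by simp
          qed
        next
          case 2
          then have "a \<in> S - (C \<union> V)" "b \<in> S - (C \<union> V)" using ab by auto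
          then show ?thesis using inj_onD[OF r1(2), of a b] ab(3) rS by simp
        next
          case 3
          then have "b \<in> {a, r a}" using ab(3) by simp
          then show ?thesis using 3 rV[of a] by auto
        next
          case 4
          then have "a \<in> {b, r b}" using ab(3) by blast
          then show ?thesis using 4 rV[of b] by auto
        qed
      qed
      moreover have "R a (r a)" if "a \<in> S - C" for a
        using that rV[of a] rS[of a] r1(1) by (cases "a \<in> V") auto
      ultimately show ?thesis by blast
    qed
  qed
qed

text \<open>The classes can be swapped, so a tie may be broken in favour of one that contains a
  leaf. This matters when \<open>Q\<close> has to fill \<open>A\<close> completely.\<close>

lemma tree_on_bipartition_leaf:
  assumes T: "tree_on V E" "card V \<ge> 2"
  obtains P Q where "P \<inter> Q = {}" "P \<union> Q = V" "\<forall>e\<in>E. \<exists>q\<in>Q. \<exists>p\<in>P. e = {q, p}"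
    "card Q \<le> card P" "card P = card Q \<longrightarrow> (\<exists>l\<in>Q. l \<in> leaves V E)"
proof -
  obtain P Q where PQ: "P \<inter> Q = {}" "P \<union> Q = V" "\<And>e. e \<in> E \<Longrightarrow> \<exists>q\<in>Q. \<exists>p\<in>P. e = {q, p}"
    using tree_on_bipartition[OF T(1)] by metis
  have QP: "\<exists>q\<in>P. \<exists>p\<in>Q. e = {q, p}" if "e \<in> E" for e using PQ(3)[OF that] by (metis insert_commute)
  have "card (leaves V E) \<noteq> 0" using two_le_leaves[OF T] by linarith
  then obtain l where l: "l \<in> leaves V E" by (metis all_not_in_conv card.empty)
  then have lPQ: "l \<in> P \<or> l \<in> Q" using PQ(2) by (auto simp: leaves_def)
  consider "card Q < card P" | "card P < card Q" | "card P = card Q" "l \<in> Q" | "card P = card Q" "l \<in> P"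
    using lPQ by linarith
  then show thesis
  proof cases
    case 1
    show ?thesis by (rule that[OF PQ(1,2)]) (use 1 PQ(3) in auto)
  next
    case 2
    show ?thesis by (rule that[of Q P]) (use 2 PQ(1,2) QP in auto)
  next
    case 3
    show ?thesis by (rule that[OF PQ(1,2)]) (use 3 l PQ(3) in auto)
  next
    case 4
    show ?thesis by (rule that[of Q P]) (use 4 PQ(1,2) QP l in auto)
  qed
qed

lemma card_neighbours:
  assumes "tree_on V E"
  shows "finite {p. {q, p} \<in> E}" "card {p. {q, p} \<in> E} \<le> deg E q"
proof -
  have fin: "finite V" "finite E" using tree_on_finite[OF assms] by auto
  have sub: "{p. {q, p} \<in> E} \<subseteq> V" using tree_on_edge_subset[OF assms] by blast
  then show "finite {p. {q, p} \<in> E}" using fin finite_subset by blast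
  have "inj_on (\<lambda>p. {q, p}) {p. {q, p} \<in> E}" by (auto simp: inj_on_def doubleton_eq_iff)
  moreover have "(\<lambda>p. {q, p}) ` {p. {q, p} \<in> E} \<subseteq> {e \<in> E. q \<in> e}" by auto
  ultimately show "card {p. {q, p} \<in> E} \<le> deg E q"
    unfolding deg_def using fin by (intro card_inj_on_le[of "\<lambda>p. {q, p}"]) auto
qed

text \<open>One colour class \<open>Q\<close> of the tree goes into \<open>A\<close>, and an edge \<open>{q, p}\<close> with \<open>q \<in> Q\<close> receives the
  triple formed by the full pair of \<open>q\<close> and the image of \<open>p\<close>. If that image already belongs to the
  full pair, a vertex of \<open>B\<close> not adjacent to \<open>q\<close> completes the triple.\<close>

lemma Berge_copy_bipartite:
  assumes T: "tree_on V E" and PQ: "P \<inter> Q = {}" "P \<union> Q = V" "\<And>e. e \<in> E \<Longrightarrow> \<exists>q\<in>Q. \<exists>p\<in>P. e = {q, p}"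
    and \<phi>: "bij_betw \<phi> V X" "\<phi> ` Q \<subseteq> A" and AB: "A \<inter> B = {}" "A \<union> B = X"
    and r: "\<And>a. a \<in> A \<Longrightarrow> r a \<in> A \<and> full_pair X c k a (r a)" and inj: "inj_on (\<lambda>a. {a, r a}) (A - {m})"
    and m: "\<And>q q' p. q \<in> Q \<Longrightarrow> q' \<in> Q \<Longrightarrow> \<phi> q = m \<Longrightarrow> \<phi> q' = r m \<Longrightarrow> {q, p} \<in> E \<Longrightarrow> {q', p} \<in> E \<Longrightarrow> False"
    and B: "finite B" "\<And>q. q \<in> Q \<Longrightarrow> deg E q < card B"
  shows "Berge_copy X c k V E"
proof -
  have inj\<phi>: "inj_on \<phi> V" and im\<phi>: "\<phi> ` V = X" using \<phi>(1) by (auto simp: bij_betw_def)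
  have \<phi>PQ: "\<phi> p \<noteq> \<phi> q" if "p \<in> P" "q \<in> Q" for p q
  proof
    assume "\<phi> p = \<phi> q"
    then have "p = q" using inj_onD[OF inj\<phi>] that PQ(2) by blast
    then show False using that PQ(1) by blast
  qed
  have BP: "\<exists>p\<in>P. \<phi> p = b" if "b \<in> B" for b
  proof -
    have "b \<in> \<phi> ` V" using im\<phi> AB(2) that by auto
    then obtain v where v: "v \<in> V" "\<phi> v = b" by auto
    have "v \<notin> Q"
    proof
      assume "v \<in> Q"
      then have "b \<in> A" using \<phi>(2) v(2) by auto
      then show False using AB(1) that by auto
    qed
    then show ?thesis using v PQ(2) by auto
  qed
  have "\<exists>z\<in>B. z \<notin> \<phi> ` {p. {q, p} \<in> E}" if q: "q \<in> Q" for q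
  proof (rule ccontr)
    assume "\<not> (\<exists>z\<in>B. z \<notin> \<phi> ` {p. {q, p} \<in> E})"
    then have "B \<subseteq> \<phi> ` {p. {q, p} \<in> E}" by blast
    then have "card B \<le> card {p. {q, p} \<in> E}"
      using card_neighbours(1)[OF T] by (meson card_image_le card_mono finite_imageI le_trans)
    then show False using card_neighbours(2)[OF T, of q] B(2)[OF q] by linarith
  qed
  then obtain z where z: "\<And>q. q \<in> Q \<Longrightarrow> z q \<in> B" "\<And>q p. q \<in> Q \<Longrightarrow> {q, p} \<in> E \<Longrightarrow> z q \<noteq> \<phi> p"
    by (metis (mono_tags, lifting) imageI mem_Collect_eq)
  define t where "t q p = {\<phi> q, r (\<phi> q), if \<phi> p = r (\<phi> q) then z q else \<phi> p}" for q p
  have qA: "\<phi> q \<in> A" if "q \<in> Q" for q using \<phi>(2) that by blast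
  have t: "t q p \<in> nsets X 3 \<and> c (t q p) = k \<and> {\<phi> q, \<phi> p} \<subseteq> t q p" if qp: "q \<in> Q" "p \<in> P" for q p
  proof -
    note a = qA[OF qp(1)]
    note ra = r[OF a]
    have "\<phi> p \<in> X" using im\<phi> qp(2) PQ(2) by blast
    moreover have "z q \<in> X" "z q \<notin> A" using z(1)[OF qp(1)] AB by auto
    ultimately have "(if \<phi> p = r (\<phi> q) then z q else \<phi> p) \<in> X - {\<phi> q, r (\<phi> q)}"
      using ra a \<phi>PQ[OF qp(2,1)] by auto
    then have w: "(if \<phi> p = r (\<phi> q) then z q else \<phi> p) \<in> X" "(if \<phi> p = r (\<phi> q) then z q else \<phi> p) \<noteq> \<phi> q"
      "(if \<phi> p = r (\<phi> q) then z q else \<phi> p) \<noteq> r (\<phi> q)" by blast+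
    have mem: "\<phi> q \<in> X" "r (\<phi> q) \<in> X" "\<phi> q \<noteq> r (\<phi> q)" using ra full_pair_mem by metis+
    have "t q p \<in> nsets X 3" unfolding t_def
      by (rule triple_in_nsets[OF mem(1,2) w(1) mem(3) w(2)[symmetric] w(3)[symmetric]])
    moreover have "c (t q p) = k" unfolding t_def
      by (rule full_pair_color[OF conjunct2[OF ra] w])
    moreover have "{\<phi> q, \<phi> p} \<subseteq> t q p" by (auto simp: t_def)
    ultimately show ?thesis by blast
  qed
  \<comment> \<open>If \<open>q = q'\<close>, the third vertices agree. If not, the third vertex of
    each triple is an image of \<open>P\<close>, so each of \<open>\<phi> q\<close> and
    \<open>\<phi> q'\<close> is the chosen partner of the other, and \<open>p = p'\<close>.
    Injectivity of the pairs confines this to \<open>m\<close> and \<open>r m\<close>, where the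
    assumption excludes common neighbours.\<close>
  have t_inj: "q = q' \<and> p = p'" if qp: "q \<in> Q" "p \<in> P" "{q, p} \<in> E" "q' \<in> Q" "p' \<in> P" "{q', p'} \<in> E" and eq: "t q p = t q' p'"
    for q p q' p'
  proof -
    have zP: "z q \<in> \<phi> ` P" if "q \<in> Q" for q using BP[OF z(1)[OF that]] by (metis imageI)
    have disj: "\<phi> ` P \<inter> \<phi> ` Q = {}" using \<phi>PQ by blast
    have inA: "\<phi> q \<in> A" "\<phi> q' \<in> A" using qA qp by auto
    have rne: "r (\<phi> q) \<noteq> \<phi> q" "r (\<phi> q') \<noteq> \<phi> q'" using r inA full_pair_mem by metis+
    have zne: "z q \<notin> A" "z q' \<notin> A" using z(1) qp AB(1) by blast+
    have rA: "r (\<phi> q) \<in> A" "r (\<phi> q') \<in> A" using r inA by blast+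
    have nP: "\<phi> q \<notin> \<phi> ` P" "\<phi> q' \<notin> \<phi> ` P" using disj qp by auto
    have mP: "\<phi> p \<in> \<phi> ` P" "\<phi> p' \<in> \<phi> ` P" "z q \<in> \<phi> ` P" "z q' \<in> \<phi> ` P" using qp zP by auto
    have zp: "z q \<noteq> \<phi> p" "z q' \<noteq> \<phi> p'" using z(2) qp by blast+
    have phi_eq: "x = y" if "x \<in> V" "y \<in> V" "\<phi> x = \<phi> y" for x y using inj_onD[OF inj\<phi>] that by blast
    have V: "q \<in> V" "p \<in> V" "q' \<in> V" "p' \<in> V" using qp PQ(2) by auto
    have pp: "p = p'" if "q = q'"
    proof -
      have "\<phi> p = \<phi> p'"
      proof (cases "\<phi> p = r (\<phi> q)"; cases "\<phi> p' = r (\<phi> q)")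
        assume a: "\<phi> p = r (\<phi> q)" "\<phi> p' \<noteq> r (\<phi> q)"
        then have "\<phi> p' \<in> {\<phi> q, r (\<phi> q), z q}" using eq that by (auto simp: t_def)
        then show ?thesis using a zp nP mP that by auto
      next
        assume a: "\<phi> p \<noteq> r (\<phi> q)" "\<phi> p' = r (\<phi> q)"
        then have "\<phi> p \<in> {\<phi> q, r (\<phi> q), z q}" using eq that by (auto simp: t_def)
        then show ?thesis using a zp nP mP that by auto
      next
        assume a: "\<phi> p \<noteq> r (\<phi> q)" "\<phi> p' \<noteq> r (\<phi> q)"
        then have "\<phi> p \<in> {\<phi> q, r (\<phi> q), \<phi> p'}" using eq that by (auto simp: t_def)
        then show ?thesis using a nP mP that by auto
      qed auto
      then show ?thesis using phi_eq V by blast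
    qed
    show ?thesis
    proof (cases "q = q'")
      case True
      then show ?thesis using pp by blast
    next
      case False
      then have ne: "\<phi> q \<noteq> \<phi> q'" using phi_eq V by blast
      have q1: "\<phi> q \<in> t q' p'" "\<phi> q' \<in> t q p" using eq unfolding t_def by blast+
      have a: "\<phi> p \<noteq> r (\<phi> q)"
      proof
        assume "\<phi> p = r (\<phi> q)"
        then have "\<phi> q' = r (\<phi> q) \<or> \<phi> q' = z q" using q1(2) ne by (auto simp: t_def)
        then show False using \<open>\<phi> p = r (\<phi> q)\<close> mP nP by metis
      qed
      have a': "\<phi> p' \<noteq> r (\<phi> q')"
      proof
        assume "\<phi> p' = r (\<phi> q')"
        then have "\<phi> q = r (\<phi> q') \<or> \<phi> q = z q'" using q1(1) ne by (auto simp: t_def)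
        then show False using \<open>\<phi> p' = r (\<phi> q')\<close> mP nP by metis
      qed
      have "\<phi> q' \<noteq> \<phi> p" "\<phi> q \<noteq> \<phi> p'" using mP nP by metis+
      then have rr: "\<phi> q' = r (\<phi> q)" "\<phi> q = r (\<phi> q')" using q1 ne a a' by (auto simp: t_def)
      have "\<phi> p \<in> t q p" using a by (simp add: t_def)
      then have "\<phi> p \<in> t q' p'" by (simp only: eq)
      then have "\<phi> p \<in> {\<phi> q', r (\<phi> q'), \<phi> p'}" using a' by (simp add: t_def)
      moreover have "\<phi> p \<noteq> \<phi> q'" "\<phi> p \<noteq> r (\<phi> q')" using rr(2) mP nP by metis+
      ultimately have "\<phi> p = \<phi> p'" by blast
      then have p: "p = p'" using phi_eq V by blast
      have "{\<phi> q, r (\<phi> q)} = {\<phi> q', r (\<phi> q')}" using rr by auto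
      then have "\<phi> q = m \<or> \<phi> q' = m" using inj_onD[OF inj, of "\<phi> q" "\<phi> q'"] ne inA by blast
      then show ?thesis
      proof
        assume qm: "\<phi> q = m"
        have "\<phi> q' = r m" by (simp only: rr(1) qm)
        moreover have "{q', p} \<in> E" using qp(6) by (simp only: p)
        ultimately show ?thesis using m[OF qp(1,4) qm _ qp(3)] by blast
      next
        assume qm: "\<phi> q' = m"
        have "\<phi> q = r m" by (simp only: rr(2) qm)
        moreover have "{q', p} \<in> E" using qp(6) by (simp only: p)
        ultimately show ?thesis using m[OF qp(4,1) qm _ _ qp(3)] by blast
      qed
    qed
  qed
  define f where "f e = t (the_elem (e \<inter> Q)) (the_elem (e \<inter> P))" for e
  have f: "f {q, p} = t q p" if "q \<in> Q" "p \<in> P" for q p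
  proof -
    have "{q, p} \<inter> Q = {q}" "{q, p} \<inter> P = {p}" using that PQ(1) by auto
    then show ?thesis by (simp add: f_def)
  qed
  have "inj_on f E"
  proof (rule inj_onI)
    fix e e' assume ee: "e \<in> E" "e' \<in> E" "f e = f e'"
    obtain q p where e: "q \<in> Q" "p \<in> P" "e = {q, p}" using PQ(3)[OF ee(1)] by blast
    obtain q' p' where e': "q' \<in> Q" "p' \<in> P" "e' = {q', p'}" using PQ(3)[OF ee(2)] by blast
    have "t q p = t q' p'" using ee(3) f e e' by simp
    then have "q = q' \<and> p = p'" using t_inj[OF e(1,2) _ e'(1,2)] ee e(3) e'(3) by blast
    then show "e = e'" using e e' by simp
  qed
  moreover have "f e \<in> nsets X 3 \<and> c (f e) = k \<and> \<phi> ` e \<subseteq> f e" if eE: "e \<in> E" for e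
  proof -
    obtain q p where e: "q \<in> Q" "p \<in> P" "e = {q, p}" using PQ(3)[OF eE] by blast
    show ?thesis using t[OF e(1,2)] f[OF e(1,2)] e(3) by simp
  qed
  ultimately have "Berge_emb X c k V E \<phi> f" using inj\<phi> im\<phi> by (simp add: Berge_emb_def)
  then show ?thesis unfolding Berge_copy_def by blast
qed

text \<open>Only the vertices placed on \<open>m\<close> and \<open>r m\<close> can conflict,
  through a common neighbour. If \<open>Q\<close> does not fill \<open>A\<close>, then
  \<open>r m\<close> is left out. Otherwise \<open>P\<close>, \<open>Q\<close>, \<open>A\<close>,
  \<open>B\<close> have equal sizes; a leaf of \<open>Q\<close> goes to \<open>m\<close>, and
  \<open>r m\<close> receives a vertex not adjacent to the only neighbour of that leaf.\<close>

lemma Berge_copy_small_degrees: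
  assumes fin: "finite X" and AB: "A \<inter> B = {}" "A \<union> B = X" "card B \<le> card A"
    and r: "\<And>a. a \<in> A \<Longrightarrow> r a \<in> A \<and> full_pair X c k a (r a)" and inj: "inj_on (\<lambda>a. {a, r a}) (A - {m})"
    and m: "m \<in> A" and T: "tree_on V E" "card V = card X" "\<And>v. v \<in> V \<Longrightarrow> deg E v < card B"
  shows "Berge_copy X c k V E"
proof -
  have finA: "finite A" "finite B" using fin AB(2) by auto
  have finV: "finite V" using tree_on_finite[OF T(1)] by simp
  have rm: "r m \<in> A" "r m \<noteq> m" using r[OF m] full_pair_mem by metis+
  have cX: "card X = card A + card B" using AB finA card_Un_disjoint by blast
  have cV2: "card V \<ge> 2"
  proof -
    have "card {m, r m} \<le> card A" using m rm finA by (intro card_mono) auto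
    then show ?thesis using rm T(2) cX by simp
  qed
  obtain P Q where PQ: "P \<inter> Q = {}" "P \<union> Q = V" "\<forall>e\<in>E. \<exists>q\<in>Q. \<exists>p\<in>P. e = {q, p}"
    and le: "card Q \<le> card P" and lf: "card P = card Q \<longrightarrow> (\<exists>l\<in>Q. l \<in> leaves V E)"
    by (rule tree_on_bipartition_leaf[OF T(1) cV2])
  have finPQ: "finite P" "finite Q" using PQ(2) finV by auto
  have cPQ: "card P + card Q = card A + card B"
    using T(2) cX PQ(1,2) finPQ card_Un_disjoint by metis
  have "\<exists>g Q'. bij_betw g Q Q' \<and> Q' \<subseteq> A \<and>
      (\<forall>q\<in>Q. \<forall>q'\<in>Q. \<forall>p. g q = m \<longrightarrow> g q' = r m \<longrightarrow> {q, p} \<in> E \<longrightarrow> {q', p} \<in> E \<longrightarrow> False)"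
  proof (cases "card Q < card A")
    case True
    then have "card Q \<le> card (A - {r m})" using rm finA by simp
    then obtain Q' where Q': "Q' \<subseteq> A - {r m}" "card Q' = card Q" "finite Q'"
      by (rule obtain_subset_with_card_n)
    obtain g where g: "bij_betw g Q Q'" using finite_same_card_bij[OF finPQ(2) Q'(3)] Q'(2) by metis
    have "g q \<noteq> r m" if "q \<in> Q" for q using g Q'(1) that by (auto simp: bij_betw_def)
    then show ?thesis using g Q'(1) by (intro exI[of _ g] exI[of _ Q']) blast
  next
    case False
    then have eq: "card Q = card A" "card P = card Q" "card B = card Q" using le cPQ AB(3) by linarith+
    obtain l where l: "l \<in> Q" "l \<in> leaves V E" using mp[OF lf eq(2)] by blast
    obtain i where i: "i \<in> V" "i \<noteq> l" "{i, l} \<in> E" "{e \<in> E. l \<in> e} = {{i, l}}" by (rule leafE[OF T(1) l(2)])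
    \<comment> \<open>The degree of \<open>i\<close> is below \<open>card B\<close>, which equals
      \<open>card Q\<close> here.\<close>
    have "\<exists>q\<in>Q. {q, i} \<notin> E"
    proof (rule ccontr)
      assume "\<not> (\<exists>q\<in>Q. {q, i} \<notin> E)"
      then have "Q \<subseteq> {p. {i, p} \<in> E}" by (auto simp: insert_commute)
      then have "card Q \<le> deg E i" using card_neighbours[OF T(1), of i] card_mono le_trans by metis
      then show False using T(3)[OF i(1)] eq(3) by simp
    qed
    then obtain q where q: "q \<in> Q" "{q, i} \<notin> E" by blast
    have "q \<noteq> l" using q i by (auto simp: insert_commute)
    then obtain g where g: "bij_betw g Q A" "g l = m" "g q = r m"
      using ex_bij_extend2[OF finPQ(2) finA(1) eq(1) l(1) m q(1) rm(1)] rm(2) by metis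
    have "False" if that: "a \<in> Q" "b \<in> Q" "g a = m" "g b = r m" "{a, p} \<in> E" "{b, p} \<in> E" for a b p
    proof -
      have gi: "inj_on g Q" using g(1) by (simp add: bij_betw_def)
      have "a = l" using inj_onD[OF gi] that g l by metis
      moreover have "b = q" using inj_onD[OF gi] that g q by metis
      moreover have "{l, p} \<in> {e \<in> E. l \<in> e}" using that(5) \<open>a = l\<close> by simp
      then have "{l, p} = {i, l}" by (simp only: i(4) singleton_iff)
      ultimately show False using that(6) q(2) i(2) by (auto simp: doubleton_eq_iff)
    qed
    then show ?thesis using g(1) by (intro exI[of _ g] exI[of _ A]) blast
  qed
  then obtain g Q' where g: "bij_betw g Q Q'" "Q' \<subseteq> A"
    "\<And>q q' p. q \<in> Q \<Longrightarrow> q' \<in> Q \<Longrightarrow> g q = m \<Longrightarrow> g q' = r m \<Longrightarrow> {q, p} \<in> E \<Longrightarrow> {q', p} \<in> E \<Longrightarrow> False" by blast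
  have Q'X: "Q' \<subseteq> X" using g(2) AB(2) by blast
  have "card (X - Q') = card P"
    using bij_betw_same_card[OF g(1)] Q'X fin cPQ cX by (simp add: card_Diff_subset finite_subset)
  then obtain h where h: "bij_betw h P (X - Q')"
    using finite_same_card_bij[of P "X - Q'"] finPQ fin by auto
  define \<phi> where "\<phi> x = (if x \<in> Q then g x else h x)" for x
  have \<phi>Q: "\<phi> q = g q" if "q \<in> Q" for q using that by (simp add: \<phi>_def)
  have "bij_betw \<phi> Q Q'" using g(1) by (subst bij_betw_cong[of _ _ g]) (simp_all add: \<phi>_def)
  moreover have "bij_betw \<phi> P (X - Q')"
    using h PQ(1) by (subst bij_betw_cong[of _ _ h]) (auto simp: \<phi>_def)
  ultimately have "bij_betw \<phi> (Q \<union> P) (Q' \<union> (X - Q'))" by (rule bij_betw_combine) auto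
  moreover have "Q \<union> P = V" "Q' \<union> (X - Q') = X" using PQ(2) Q'X by auto
  ultimately have \<phi>: "bij_betw \<phi> V X" by simp
  show ?thesis
  proof (rule Berge_copy_bipartite[OF T(1) PQ(1,2) _ \<phi> _ AB(1,2) r inj])
    show "\<phi> ` Q \<subseteq> A" using \<phi>Q g(1,2) by (auto simp: bij_betw_def)
    show False if "q \<in> Q" "q' \<in> Q" "\<phi> q = m" "\<phi> q' = r m" "{q, p} \<in> E" "{q', p} \<in> E" for q q' p
      using g(3)[of q q' p] that \<phi>Q by simp
    show "deg E q < card B" if "q \<in> Q" for q using T(3) that PQ(2) by blast
  qed (use finA PQ(3) in auto)
qed

section \<open>The induction\<close>

lemma star_deg:
  assumes "tree_on V E" "\<forall>e\<in>E. s \<in> e" "s \<in> V"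
  shows "card V - 1 \<le> deg E s" "V - {s} \<subseteq> leaves V E"
proof -
  have fin: "finite V" "finite E" using tree_on_finite[OF assms(1)] by auto
  have z: "{e \<in> E. z \<in> e} = {{s, z}}" if "z \<in> V - {s}" for z
    using star_leaf[OF assms] that by blast
  have "inj_on (\<lambda>z. {s, z}) (V - {s})" by (auto simp: inj_on_def doubleton_eq_iff)
  moreover have "(\<lambda>z. {s, z}) ` (V - {s}) \<subseteq> {e \<in> E. s \<in> e}"
  proof (rule image_subsetI)
    fix x assume "x \<in> V - {s}"
    then have "{s, x} \<in> {e \<in> E. x \<in> e}" using z by simp
    then show "{s, x} \<in> {e \<in> E. s \<in> e}" by simp
  qed
  ultimately have "card (V - {s}) \<le> deg E s" unfolding deg_def using fin by (intro card_inj_on_le) auto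
  then show "card V - 1 \<le> deg E s" using assms(3) fin by simp
  show "V - {s} \<subseteq> leaves V E" using z by (auto simp: leaves_def deg_def)
qed

lemma star_leaves:
  assumes "tree_on V E" "is_star V E"
  shows "card V - 1 \<le> card (leaves V E)"
proof -
  obtain s where s: "s \<in> V" "\<forall>e\<in>E. s \<in> e" using assms(2) by (auto simp: is_star_def)
  have "card (V - {s}) \<le> card (leaves V E)"
    by (rule card_mono[OF finite_leaves[OF assms(1)] star_deg(2)[OF assms(1) s(2,1)]])
  then show ?thesis using s(1) tree_on_finite[OF assms(1)] by simp
qed

lemma deg_mono: "finite E \<Longrightarrow> E0 \<subseteq> E \<Longrightarrow> deg E0 v \<le> deg E v"
  unfolding deg_def by (intro card_mono) auto

text \<open>Pairs covering three vertices cannot all be disjoint: the third vertex has its partner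
  in the first pair.\<close>

lemma three_covered_cherry:
  assumes "card A = 3" "\<And>v. v \<in> A \<Longrightarrow> \<exists>u\<in>A. full_pair X c k v u"
  shows "\<exists>m l l'. full_pair X c k m l \<and> full_pair X c k m l' \<and> l \<noteq> l'"
proof -
  have fin: "finite A" using assms(1) card.infinite by fastforce
  obtain a where a: "a \<in> A" using assms(1) by fastforce
  obtain b where b: "b \<in> A" "full_pair X c k a b" using assms(2)[OF a] by blast
  have "card (A - {a, b}) = 1" using full_pair_mem[OF b(2)] a b(1) assms(1) by (simp add: card_Diff_subset)
  then obtain d where d: "A - {a, b} = {d}" by (auto simp: card_1_singleton_iff)
  then have dA: "d \<in> A" "d \<noteq> a" "d \<noteq> b" by auto
  obtain e where e: "e \<in> A" "full_pair X c k d e" using assms(2)[OF dA(1)] by blast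
  have "e \<noteq> d" using full_pair_mem[OF e(2)] by auto
  then have "e \<notin> A - {a, b}" unfolding d by simp
  then have "e = a \<or> e = b" using e(1) by simp
  then show ?thesis
  proof
    assume "e = a"
    then have "full_pair X c k a d" using full_pair_sym[OF e(2)] by simp
    then show ?thesis using b(2) dA(3) by blast
  next
    assume "e = b"
    then have "full_pair X c k b d" using full_pair_sym[OF e(2)] by simp
    then show ?thesis using full_pair_sym[OF b(2)] dA(2) by blast
  qed
qed

text \<open>\<open>IH\<close> promises no more than five vertices permit: when two of seven vertices
  are deleted, the tree left for the colour of \<open>A\<close> must not be a star.\<close>

lemma dichotomy_covered:
  fixes X :: "'a set" and V V' :: "'b set"
  assumes fin: "finite X" and n: "card X \<ge> 6"
    and A: "A = {v \<in> X. \<exists>u. full_pair X c k v u}" and B: "B = {v \<in> X. \<exists>u. full_pair X c (opp k) v u}"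
    and AB: "A \<union> B = X" "card B \<le> card A"
    and T: "tree_on V E" "card V = card X" and T': "tree_on V' E'" "card V' = card X"
    and IH: "\<And>l1 l2 V0 E0 V0' E0'. card X \<ge> 7 \<Longrightarrow> l1 \<in> X \<Longrightarrow> l2 \<in> X \<Longrightarrow> l1 \<noteq> l2 \<Longrightarrow>
      tree_on (V0 :: 'b set) E0 \<Longrightarrow> card V0 = card X - 2 \<Longrightarrow> tree_on (V0' :: 'b set) E0' \<Longrightarrow> card V0' = card X - 2 \<Longrightarrow>
      (card X = 7 \<Longrightarrow> \<not> is_star V0 E0) \<Longrightarrow>
      Berge_copy (X - {l1, l2}) c k V0 E0 \<or> Berge_copy (X - {l1, l2}) c (opp k) V0' E0'"
  shows "Berge_copy X c k V E \<or> Berge_copy X c (opp k) V' E'"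
proof -
  have disj: "A \<inter> B = {}" using full_pair_opp_disjoint[of X c k] fin n unfolding A B by fastforce
  have finAB: "finite A" "finite B" using fin AB(1) by auto
  have cX: "card X = card A + card B" using disj AB(1) finAB card_Un_disjoint by blast
  have XA: "X - A = B" "X - B = A" using disj AB(1) by auto
  have a3: "card A \<ge> 3" using cX n AB(2) by linarith
  have pA: "\<exists>u\<in>A. full_pair X c k v u" if vA: "v \<in> A" for v
  proof -
    obtain u where u: "full_pair X c k v u" using vA A by blast
    then have "u \<in> A" using full_pair_sym[OF u] full_pair_mem[OF u] A by blast
    with u show ?thesis by blast
  qed
  have pB: "\<exists>u\<in>B. full_pair X c (opp k) v u" if vB: "v \<in> B" for v
  proof -
    obtain u where u: "full_pair X c (opp k) v u" using vB B by blast
    then have "u \<in> B" using full_pair_sym[OF u] full_pair_mem[OF u] B by blast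
    with u show ?thesis by blast
  qed
  have V2: "card V \<ge> 2" "card V' \<ge> 2" using T(2) T'(2) n by auto
  show ?thesis
  proof (cases "card A = 3")
    case True
    then obtain m l l' where "full_pair X c k m l" "full_pair X c k m l'" "l \<noteq> l'"
      using three_covered_cherry[OF True pA] by blast
    moreover have "card X = 6" using True cX AB(2) n by linarith
    ultimately have "Berge_copy X c k V E" using six_vertices_cherry[of X c k m l l' V E] T by simp
    then show ?thesis ..
  next
    case False
    then have a4: "card A \<ge> 4" using a3 by simp
    show ?thesis
    proof (cases "card B \<le> card (leaves V E)")
      case True
      then have "Berge_copy X c k V E" using Berge_copy_many_leaves[OF fin A a4 T] XA by simp
      then show ?thesis ..
    next
      case few: False
      \<comment> \<open>A tree has at least two leaves, so \<open>card B \<ge> 3\<close>. Together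
        with \<open>card A \<ge> 4\<close> this gives seven vertices: six are already settled, and
        deleting two never goes below five.\<close>
      then have b3: "card B \<ge> 3" using two_le_leaves[OF T(1) V2(1)] by linarith
      have n7: "card X \<ge> 7" using cX a4 b3 by linarith
      have degs: "deg E v < card B" if "v \<in> V" for v using deg_le_leaves[OF T(1) V2(1) that] few by linarith
      have ns: "\<not> is_star V E" using star_leaves[OF T(1)] few T(2) cX a4 by fastforce
      show ?thesis
      proof (cases "is_star V' E'")
        \<comment> \<open>A star has no two leaves with different neighbours and is placed directly.
          Its \<open>card X - 1\<close> leaves are enough to cover \<open>A\<close>, provided that
          \<open>B\<close> has the four vertices needed to host the rest.\<close>
        case star: True
        show ?thesis
        proof (cases "card B \<ge> 4")
          case True
          have "card (X - B) \<le> card (leaves V' E')" using star_leaves[OF T'(1) star] T'(2) cX XA b3 by simp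
          then have "Berge_copy X c (opp k) V' E'" using Berge_copy_many_leaves[OF fin B True T'] by simp
          then show ?thesis ..
        next
          case False
          then have "card B = 3" using b3 by simp
          then obtain m l l' where "full_pair X c (opp k) m l" "full_pair X c (opp k) m l'" "l \<noteq> l'"
            using three_covered_cherry[OF _ pB] by blast
          then have "Berge_copy X c (opp k) V' E'" using Berge_copy_star[OF fin _ _ _ _ T' star] n by simp
          then show ?thesis ..
        qed
      next
        case ns': False
        show ?thesis
        proof (cases "\<exists>l1 l2 c1 c2. full_pair X c k l1 c1 \<and> full_pair X c k l2 c2 \<and> c1 \<noteq> c2 \<and>
            (\<forall>u. full_pair X c k l1 u \<longrightarrow> u = c1) \<and> (\<forall>u. full_pair X c k l2 u \<longrightarrow> u = c2)")
          case True
          then obtain l1 l2 c1 c2 where l: "full_pair X c k l1 c1" "full_pair X c k l2 c2" "c1 \<noteq> c2"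
            and u: "\<And>u. full_pair X c k l1 u \<Longrightarrow> u = c1" "\<And>u. full_pair X c k l2 u \<Longrightarrow> u = c2" by blast
          have l12: "l1 \<noteq> l2" using l u by blast
          have lX: "l1 \<in> X" "l2 \<in> X" using full_pair_mem[OF l(1)] full_pair_mem[OF l(2)] by auto
          show ?thesis
          proof (rule Berge_copy_pendants[OF _ fin _ l12 l u T ns T' ns'])
            fix V0 E0 V0' E0'
            assume V0: "tree_on (V0 :: 'b set) E0" "card V0 = card X - 2" "tree_on (V0' :: 'b set) E0'" "card V0' = card X - 2"
              "V0 \<subseteq> V" "E0 \<subseteq> E"
            \<comment> \<open>A star on five vertices has degree 4 at its centre, but degrees in
              \<open>V\<close> stay below \<open>card B\<close>, which is at most 3 here.\<close>
            have "\<not> is_star V0 E0" if "card X = 7"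
            proof
              assume "is_star V0 E0"
              then obtain s where s: "s \<in> V0" "\<forall>e\<in>E0. s \<in> e" by (auto simp: is_star_def)
              have "card V0 - 1 \<le> deg E0 s" by (rule star_deg(1)[OF V0(1) s(2,1)])
              also have "\<dots> \<le> deg E s" using deg_mono[OF _ V0(6)] tree_on_finite[OF T(1)] by blast
              also have "\<dots> < card B" using degs s(1) V0(5) by blast
              finally show False using V0(2) that cX a4 by linarith
            qed
            then show "Berge_copy (X - {l1, l2}) c k V0 E0 \<or> Berge_copy (X - {l1, l2}) c (opp k) V0' E0'"
              using IH[OF n7 lX l12 V0(1-4)] by blast
          qed (use n in simp)
        next
          case no: False
          let ?R = "full_pair X c k"
          have "\<exists>r m. m \<in> A \<and> (\<forall>x\<in>A. ?R x (r x)) \<and> inj_on (\<lambda>x. {x, r x}) (A - {m})"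
          proof (cases "\<exists>l y. ?R l y \<and> (\<forall>u. ?R l u \<longrightarrow> u = y)")
            case True
            then obtain l y where ly: "?R l y" "\<forall>u. ?R l u \<longrightarrow> u = y" by blast
            have yA: "y \<in> A" using full_pair_sym[OF ly(1)] full_pair_mem[OF ly(1)] A by blast
            \<comment> \<open>All vertices with a unique partner share the partner \<open>y\<close>,
              so every other vertex is adjacent to \<open>y\<close> or has two partners. Since
              \<open>l\<close> takes the pair with \<open>y\<close> and \<open>y\<close> is
              afterwards assigned \<open>l\<close>, this pair occurs twice; hence the exceptional
              vertex \<open>m\<close>.\<close>
            have "\<exists>r. (\<forall>x\<in>A - {y}. ?R x (r x)) \<and> inj_on (\<lambda>x. {x, r x}) (A - {y})"
            proof (rule distinct_incident_edges[OF finAB(1)])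
              show "(\<exists>d\<in>{y}. ?R x d) \<or> (\<exists>w z. w \<noteq> z \<and> ?R x w \<and> ?R x z)" if x: "x \<in> A - {y}" for x
              proof (rule ccontr)
                assume neg: "\<not> ((\<exists>d\<in>{y}. ?R x d) \<or> (\<exists>w z. w \<noteq> z \<and> ?R x w \<and> ?R x z))"
                obtain w where w: "?R x w" using pA x by blast
                then have "\<forall>u. ?R x u \<longrightarrow> u = w" "w \<noteq> y" using neg by blast+
                then show False using no ly w by blast
              qed
              show "a \<noteq> b \<and> a \<in> A \<and> b \<in> A" if "?R a b" for a b
                using full_pair_sym[OF that] full_pair_mem[OF that] that A by blast
            qed (use full_pair_sym yA in auto)
            then obtain r where r: "\<forall>x\<in>A - {y}. ?R x (r x)" "inj_on (\<lambda>x. {x, r x}) (A - {y})" by blast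
            let ?r = "r(y := l)"
            have "inj_on (\<lambda>x. {x, ?r x}) (A - {y})"
              using r(2) inj_on_cong[of "A - {y}" "\<lambda>x. {x, ?r x}" "\<lambda>x. {x, r x}"] by simp
            moreover have "\<forall>x\<in>A. ?R x (?r x)" using r(1) full_pair_sym[OF ly(1)] by simp
            ultimately show ?thesis using yA by blast
          next
            case False
            have "\<exists>r. (\<forall>x\<in>A - {}. ?R x (r x)) \<and> inj_on (\<lambda>x. {x, r x}) (A - {})"
            proof (rule distinct_incident_edges[OF finAB(1)])
              show "(\<exists>d\<in>{}. ?R x d) \<or> (\<exists>w z. w \<noteq> z \<and> ?R x w \<and> ?R x z)" if x: "x \<in> A - {}" for x
                using False pA x by blast
              show "a \<noteq> b \<and> a \<in> A \<and> b \<in> A" if "?R a b" for a b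
                using full_pair_sym[OF that] full_pair_mem[OF that] that A by blast
            qed (use full_pair_sym in auto)
            then obtain r where r: "\<forall>x\<in>A. ?R x (r x)" "inj_on (\<lambda>x. {x, r x}) A" by auto
            obtain m where "m \<in> A" using a4 by fastforce
            moreover have "inj_on (\<lambda>x. {x, r x}) (A - {m})" using r(2) by (rule inj_on_subset) blast
            ultimately show ?thesis using r(1) by blast
          qed
          then obtain r m where m: "m \<in> A" and r: "\<forall>x\<in>A. ?R x (r x)" "inj_on (\<lambda>x. {x, r x}) (A - {m})" by blast
          have rA: "r a \<in> A \<and> ?R a (r a)" if "a \<in> A" for a
          proof -
            have R: "?R a (r a)" using r(1) that by blast
            then have "r a \<in> A" using full_pair_sym[OF R] full_pair_mem[OF R] A by blast
            with R show ?thesis by blast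
          qed
          have "Berge_copy X c k V E"
            by (rule Berge_copy_small_degrees[OF fin disj AB rA r(2) m T degs])
          then show ?thesis ..
        qed
      qed
    qed
  qed
qed

lemma Berge_copy_add_leaf_uncovered:
  assumes "Berge_copy (X - {z}) c k V0 E0" "tree_on V0 E0" "z \<in> X" "u \<in> V0" "x \<notin> V0"
    "\<nexists>u. full_pair X c (opp k) z u"
  shows "Berge_copy X c k (insert x V0) (insert {u, x} E0)"
proof -
  obtain \<phi> f where emb: "Berge_emb (X - {z}) c k V0 E0 \<phi> f" using assms(1) by (auto simp: Berge_copy_def)
  have \<phi>u: "\<phi> u \<in> X" "\<phi> u \<noteq> z" using emb assms(4) by (auto simp: Berge_emb_def)
  have "\<not> full_pair X c (opp k) (\<phi> u) z" using assms(6) full_pair_sym by metis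
  then obtain w where w: "w \<in> X" "w \<noteq> \<phi> u" "w \<noteq> z" "c {\<phi> u, z, w} = opp (opp k)"
    using not_full_pair[OF _ \<phi>u(1) assms(3) \<phi>u(2)] by metis
  have "Berge_emb X c k (insert x V0) (insert {u, x} E0) (\<phi>(x := z)) (f({u, x} := {\<phi> u, z, w}))"
    by (rule Berge_emb_add_leaf[OF emb assms(2)]) (use w assms in auto)
  then show ?thesis unfolding Berge_copy_def by blast
qed

lemma Berge_copy_dichotomy:
  fixes X :: "'a set" and V1 V2 :: "'b set"
  assumes "card X \<ge> 5" "tree_on V1 E1" "card V1 = card X" "tree_on V2 E2" "card V2 = card X"
    "card X = 5 \<Longrightarrow> \<not> (is_star V1 E1 \<and> is_star V2 E2)"
  shows "Berge_copy X c k V1 E1 \<or> Berge_copy X c (opp k) V2 E2"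
  using assms
proof (induction "card X" arbitrary: X k V1 E1 V2 E2 rule: less_induct)
  case less
  show ?case
  proof (cases "card X = 5")
    case True
    then show ?thesis using five_vertices[of X V1 E1 V2 E2] less.prems by simp
  next
    case False
    then have n: "card X \<ge> 6" using less.prems(1) by simp
    have fin: "finite X" using n card.infinite by fastforce
    show ?thesis
    proof (rule ccontr)
      assume neg: "\<not> (Berge_copy X c k V1 E1 \<or> Berge_copy X c (opp k) V2 E2)"
      have covered: "(\<exists>u. full_pair X c k z u) \<or> (\<exists>u. full_pair X c (opp k) z u)" if z: "z \<in> X" for z
      proof (cases "card X = 6 \<and> is_star V1 E1 \<and> is_star V2 E2")
        \<comment> \<open>Deleting leaves would produce two stars on five vertices here.\<close>
        case True
        then show ?thesis using six_vertices_stars[of X z V1 E1 V2 E2 c k] z less.prems neg by auto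
      next
        case False
        have c2: "card V1 \<ge> 2" "card V2 \<ge> 2" using less.prems n by auto
        have "\<exists>V0 E0 u x V0' E0' u' x'. tree_on V0 E0 \<and> u \<in> V0 \<and> x \<notin> V0 \<and> V1 = insert x V0 \<and> E1 = insert {u, x} E0 \<and>
          tree_on V0' E0' \<and> u' \<in> V0' \<and> x' \<notin> V0' \<and> V2 = insert x' V0' \<and> E2 = insert {u', x'} E0' \<and>
          (card X = 6 \<longrightarrow> \<not> (is_star V0 E0 \<and> is_star V0' E0'))"
        proof -
          obtain V0 E0 u x where D: "tree_on V0 E0" "u \<in> V0" "x \<notin> V0" "V1 = insert x V0" "E1 = insert {u, x} E0"
              "card V1 = Suc (card V0)"
            by (rule tree_on_lastE[OF less.prems(2) c2(1)])
          obtain V0' E0' u' x' where D': "tree_on V0' E0'" "u' \<in> V0'" "x' \<notin> V0'" "V2 = insert x' V0'" "E2 = insert {u', x'} E0'"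
              "card V2 = Suc (card V0')"
            by (rule tree_on_lastE[OF less.prems(4) c2(2)])
          \<comment> \<open>On six vertices the leaf is chosen so that one of the trees remains a
            non-star; otherwise the last leaves will do.\<close>
          consider "card X \<noteq> 6" | "\<not> is_star V1 E1" | "\<not> is_star V2 E2" using False by blast
          then show ?thesis
          proof cases
            case 1
            show ?thesis
              by (rule exI[of _ V0], rule exI[of _ E0], rule exI[of _ u], rule exI[of _ x],
                  rule exI[of _ V0'], rule exI[of _ E0'], rule exI[of _ u'], rule exI[of _ x'])
                (use 1 D(1-5) D'(1-5) in simp)
          next
            case 2
            obtain V3 E3 u3 x3 where D3: "tree_on V3 E3" "u3 \<in> V3" "x3 \<notin> V3" "V1 = insert x3 V3" "E1 = insert {u3, x3} E3"
                "\<not> is_star V3 E3"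
              using nonstar_remove_leaf[OF less.prems(2) 2] less.prems n by auto
            show ?thesis
              by (rule exI[of _ V3], rule exI[of _ E3], rule exI[of _ u3], rule exI[of _ x3],
                  rule exI[of _ V0'], rule exI[of _ E0'], rule exI[of _ u'], rule exI[of _ x'])
                (use D3 D'(1-5) in simp)
          next
            case 3
            obtain V3 E3 u3 x3 where D3: "tree_on V3 E3" "u3 \<in> V3" "x3 \<notin> V3" "V2 = insert x3 V3" "E2 = insert {u3, x3} E3"
                "\<not> is_star V3 E3"
              using nonstar_remove_leaf[OF less.prems(4) 3] less.prems n by auto
            show ?thesis
              by (rule exI[of _ V0], rule exI[of _ E0], rule exI[of _ u], rule exI[of _ x],
                  rule exI[of _ V3], rule exI[of _ E3], rule exI[of _ u3], rule exI[of _ x3])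
                (use D3 D(1-5) in simp)
          qed
        qed
        then obtain V0 E0 u x V0' E0' u' x' where
          D: "tree_on V0 E0" "u \<in> V0" "x \<notin> V0" "V1 = insert x V0" "E1 = insert {u, x} E0" and
          D': "tree_on V0' E0'" "u' \<in> V0'" "x' \<notin> V0'" "V2 = insert x' V0'" "E2 = insert {u', x'} E0'" and
          ns: "card X = 6 \<longrightarrow> \<not> (is_star V0 E0 \<and> is_star V0' E0')" by blast
        have cz: "card (X - {z}) = card X - 1" using z by simp
        have cV: "card V0 = card X - 1" "card V0' = card X - 1"
          using D D' less.prems(3,5) tree_on_finite[OF D(1)] tree_on_finite[OF D'(1)] by auto
        have "Berge_copy (X - {z}) c k V0 E0 \<or> Berge_copy (X - {z}) c (opp k) V0' E0'"
          by (rule less.hyps) (use cz cV n ns D(1) D'(1) in auto)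
        then show ?thesis
          using Berge_copy_add_leaf_uncovered[OF _ D(1) z D(2,3), of c k]
            Berge_copy_add_leaf_uncovered[OF _ D'(1) z D'(2,3), of c "opp k"] neg D(4,5) D'(4,5)
          by auto
      qed
      define F where "F j = {v \<in> X. \<exists>u. full_pair X c j v u}" for j
      have "x \<in> F k \<union> F (opp k)" if "x \<in> X" for x using covered[OF that] that by (simp add: F_def)
      moreover have "F j \<subseteq> X" for j by (auto simp: F_def)
      ultimately have cov: "F k \<union> F (opp k) = X" by blast
      have small: "Berge_copy (X - {l1, l2}) c j V0 E0 \<or> Berge_copy (X - {l1, l2}) c (opp j) V0' E0'"
        if h: "card X \<ge> 7" "l1 \<in> X" "l2 \<in> X" "l1 \<noteq> l2" "tree_on V0 E0" "card V0 = card X - 2"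
          "tree_on V0' E0'" "card V0' = card X - 2" "card X = 7 \<Longrightarrow> \<not> is_star V0 E0"
        for j l1 l2 E0 E0' and V0 V0' :: "'b set"
      proof -
        have cl: "card (X - {l1, l2}) = card X - 2" using h(2-4) by (simp add: card_Diff_subset)
        show ?thesis
          by (rule less.hyps) (use h cl in auto)
      qed
      consider "card (F (opp k)) \<le> card (F k)" | "card (F k) \<le> card (F (opp k))" by linarith
      then show False
      proof cases
        case 1
        have "Berge_copy X c k V1 E1 \<or> Berge_copy X c (opp k) V2 E2"
          by (rule dichotomy_covered[OF fin n F_def F_def cov 1 less.prems(2,3,4,5)]) (rule small)
        then show False using neg by blast
      next
        case 2
        \<comment> \<open>Colours and trees are exchanged together, for which the induction leaves
          \<open>k\<close> arbitrary.\<close>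
        have "Berge_copy X c (opp k) V2 E2 \<or> Berge_copy X c (opp (opp k)) V1 E1"
        proof (rule dichotomy_covered[OF fin n F_def F_def _ _ less.prems(4,5,2,3)])
          show "F (opp k) \<union> F (opp (opp k)) = X" using cov by auto
          show "card (F (opp (opp k))) \<le> card (F (opp k))" using 2 by simp
        qed (rule small)
        then show False using neg by auto
      qed
    qed
  qed
qed

section \<open>Return to the given hypergraphs and the exact value\<close>

lemma contains_BergeI:
  assumes emb: "Berge_emb {..<n} c k (g ` verts T) ((`) g ` edges T) \<phi> f"
    and g: "inj_on g (verts T)" and t: "tree_on (verts T) (edges T)"
  shows "contains_Berge (colour_class (complete3 n) c k) T"
proof -
  have inj: "inj_on ((`) g) (edges T)"
    using inj_on_image_eq_iff[OF g] tree_on_edge_subset[OF t] by (auto intro!: inj_onI)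
  have "inj_on (\<phi> \<circ> g) (verts T)" using emb g by (simp add: Berge_emb_def comp_inj_on)
  moreover have "(\<phi> \<circ> g) ` verts T \<subseteq> {..<n}" using emb by (auto simp: Berge_emb_def)
  moreover have "inj_on (f \<circ> (`) g) (edges T)" using emb inj by (simp add: Berge_emb_def comp_inj_on)
  moreover have "(f \<circ> (`) g) ` edges T \<subseteq> {h \<in> nsets {..<n} 3. c h = k}"
    using emb by (auto simp: Berge_emb_def)
  moreover have "\<forall>x y. {x, y} \<in> edges T \<longrightarrow> {(\<phi> \<circ> g) x, (\<phi> \<circ> g) y} \<subseteq> (f \<circ> (`) g) {x, y}"
  proof (intro allI impI)
    fix x y assume "{x, y} \<in> edges T"
    then have "g ` {x, y} \<in> (`) g ` edges T" by (rule imageI)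
    moreover have "\<forall>e\<in>(`) g ` edges T. \<phi> ` e \<subseteq> f e" using emb by (simp add: Berge_emb_def)
    ultimately have "\<phi> ` (g ` {x, y}) \<subseteq> f (g ` {x, y})" by (rule bspec[rotated])
    then show "{(\<phi> \<circ> g) x, (\<phi> \<circ> g) y} \<subseteq> (f \<circ> (`) g) {x, y}" by simp
  qed
  ultimately have "inj_on (\<phi> \<circ> g) (verts T) \<and> (\<phi> \<circ> g) ` verts T \<subseteq> {..<n} \<and> inj_on (f \<circ> (`) g) (edges T) \<and>
    (f \<circ> (`) g) ` edges T \<subseteq> {h \<in> nsets {..<n} 3. c h = k} \<and>
    (\<forall>x y. {x, y} \<in> edges T \<longrightarrow> {(\<phi> \<circ> g) x, (\<phi> \<circ> g) y} \<subseteq> (f \<circ> (`) g) {x, y})"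
    by (intro conjI)
  then show ?thesis
    unfolding contains_Berge_def colour_class_def complete3_def hypergraph.select_convs by (intro exI)
qed

theorem theorem21:
  fixes T1 :: "'a hypergraph" and T2 :: "'b hypergraph" and n :: nat
  assumes "is_tree T1" and "is_tree T2"
    and "card (verts T2) \<ge> 2"
    and "n = card (verts T1)"
    and "6 \<le> n"
    and "n \<ge> card (verts T2)"
  shows "Berge3_arrows n T1 T2 \<and> Berge3_Ramsey T1 T2 = n"
proof -
  have t1: "tree_on (verts T1) (edges T1)" and t2: "tree_on (verts T2) (edges T2)"
    using is_tree_imp_tree_on assms(1,2) by auto
  \<comment> \<open>The trees have unrelated vertex types, whereas the dichotomy works with one type
    for both; the vertices are therefore relabelled by natural numbers.\<close>
  obtain g1 :: "'a \<Rightarrow> nat" where g1: "inj_on g1 (verts T1)"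
    using finite_imp_inj_to_nat_seg[OF conjunct1[OF tree_on_finite[OF t1]]] by blast
  obtain g2 :: "'b \<Rightarrow> nat" where g2: "inj_on g2 (verts T2)"
    using finite_imp_inj_to_nat_seg[OF conjunct1[OF tree_on_finite[OF t2]]] by blast
  note n1 = tree_on_image[OF t1 g1]
  have c1: "card (g1 ` verts T1) = n" using g1 assms(4) by (simp add: card_image)
  have "card (g2 ` verts T2) \<le> n" using g2 assms(6) by (simp add: card_image)
  \<comment> \<open>A copy of the enlarged tree restricts to a copy of the relabelled
    \<open>T2\<close>.\<close>
  then obtain V E where VE: "tree_on V E" "g2 ` verts T2 \<subseteq> V" "(`) g2 ` edges T2 \<subseteq> E" "card V = n"
    using tree_on_extend[OF tree_on_image[OF t2 g2]] by blast
  have arrows: "Berge3_arrows n T1 T2"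
    unfolding Berge3_arrows_def
  proof
    fix c :: "nat set \<Rightarrow> colour"
    have "Berge_copy {..<n} c Blue (g1 ` verts T1) ((`) g1 ` edges T1) \<or> Berge_copy {..<n} c (opp Blue) V E"
      by (rule Berge_copy_dichotomy[OF _ n1 _ VE(1)]) (use assms(5) c1 VE(4) in auto)
    then consider \<phi> f where "Berge_emb {..<n} c Blue (g1 ` verts T1) ((`) g1 ` edges T1) \<phi> f"
      | \<phi> f where "Berge_emb {..<n} c Red V E \<phi> f"
      by (auto simp: Berge_copy_def)
    then show "contains_Berge (colour_class (complete3 n) c Blue) T1 \<or> contains_Berge (colour_class (complete3 n) c Red) T2"
    proof cases
      case 1
      then show ?thesis using contains_BergeI[OF 1 g1 t1] by blast
    next
      case 2
      show ?thesis using contains_BergeI[OF Berge_emb_subgraph[OF 2 VE(2,3)] g2 t2] by blast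
    qed
  qed
  \<comment> \<open>Colour every triple blue. No red triple can serve an edge of \<open>T2\<close>,
    which has one because it has two vertices; so \<open>T1\<close> must fit into \<open>N\<close>
    points.\<close>
  have lower: "n \<le> N" if "Berge3_arrows N T1 T2" for N
  proof -
    have "contains_Berge (colour_class (complete3 N) (\<lambda>_. Blue) Blue) T1 \<or>
        contains_Berge (colour_class (complete3 N) (\<lambda>_. Blue) Red) T2"
      using that unfolding Berge3_arrows_def by blast
    then show ?thesis
    proof
      assume "contains_Berge (colour_class (complete3 N) (\<lambda>_. Blue) Blue) T1"
      then obtain \<phi> where "inj_on \<phi> (verts T1)" "\<phi> ` verts T1 \<subseteq> {..<N}"
        unfolding contains_Berge_def colour_class_def complete3_def by auto
      then show ?thesis using card_inj_on_le[of \<phi> "verts T1" "{..<N}"] assms(4) by simp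
    next
      assume "contains_Berge (colour_class (complete3 N) (\<lambda>_. Blue) Red) T2"
      then obtain f where f: "f ` edges T2 \<subseteq> edges (colour_class (complete3 N) (\<lambda>_. Blue) Red)"
        unfolding contains_Berge_def by (elim exE conjE) (rule that)
      obtain v where v: "v \<in> verts T2" using tree_on_finite[OF t2] by blast
      have "deg (edges T2) v \<ge> 1" using deg_pos[OF t2 assms(3) v] .
      then have "edges T2 \<noteq> {}" by auto
      then show ?thesis using f by (auto simp: colour_class_def)
    qed
  qed
  have "Berge3_Ramsey T1 T2 = n"
    unfolding Berge3_Ramsey_def using arrows lower by (rule Least_equality)
  with arrows show ?thesis by blast
qed

end
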